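(* $\mathrm{GI}$ is polynomial-time many-one equivalent to $\mathrm{ISO}(\{\{(1,0,0),(0,1,0),(0,0,1),(1,1,1)\}\})$ and to $\mathrm{ISO}_c(\{\{(1,0,0),(0,1,0),(0,0,1),(1,1,1)\}\})$.
   Context: A constraint is identified with the set of tuples it accepts; thus $\{(1,0,0),(0,1,0),(0,0,1),(1,1,1)\}$ is the ternary constraint $x\oplus y\oplus z$ (true iff an odd number of arguments are $1$). A constraint application of a $k$-ary constraint $C$ is $C(x_1,\dots,x_k)$ with (not necessarily distinct) variables $x_i$; with constants, the $x_i$ may also be $0$ or $1$. A set of constraint applications is interpreted as the conjunction of its members; two sets are equivalent if they are satisfied by exactly the same assignments. For a permutation $\pi$ of a variable set $X$, $\pi(S)$ is obtained by simultaneously replacing each variable $x$ by $\pi(x)$. For a set $\mathcal{C}$ of constraints, $\mathrm{ISO}(\mathcal{C})$: given two sets $S,U$ of constraint applications of $\mathcal{C}$ over the same variable set $X$, decide whether some permutation $\pi$ of $X$ makes $\pi(S)$ equivalent to $U$; $\mathrm{ISO}_c(\mathcal{C})$ is the same with constants allowed. $\mathrm{GI}$ is the graph isomorphism problem. *)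

theory Defs
  imports
    Complex_Main
    "HOL-Computational_Algebra.Polynomial"
    "HOL-Combinatorics.Permutations"
begin

section \<open>Deterministic multitape Turing machines\<close>

datatype move = MoveL | Stay | MoveR

text \<open>
  States and symbols are initial segments of the naturals. State 0 is the start state, and the
  extra state numbered \<open>states M\<close> is the only halting state. Symbol 0 is the blank;
  the symbols 1 and 2 stand for the input/output bits \<open>False\<close> and \<open>True\<close>.
\<close>
record tm =
  tapes :: nat
  symbols :: nat
  states :: nat
  delta :: "nat \<Rightarrow> nat list \<Rightarrow> nat \<times> (nat \<times> move) list"

definition wf_tm :: "tm \<Rightarrow> bool" where
  "wf_tm M \<longleftrightarrow> tapes M \<ge> 2 \<and> symbols M \<ge> 3 \<and>
     (\<forall>q < states M. \<forall>ss. length ss = tapes M \<and> (\<forall>s \<in> set ss. s < symbols M) \<longrightarrow>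
        (case delta M q ss of (q', acts) \<Rightarrow>
           q' \<le> states M \<and> length acts = tapes M \<and> (\<forall>(s, d) \<in> set acts. s < symbols M)))"

text \<open>A two-way infinite tape, given by its contents and the position of the head.\<close>
type_synonym tape = "(int \<Rightarrow> nat) \<times> int"

type_synonym config = "nat \<times> tape list"

fun read_tape :: "tape \<Rightarrow> nat" where
  "read_tape (c, h) = c h"

fun shift :: "move \<Rightarrow> int \<Rightarrow> int" where
  "shift MoveL h = h - 1"
| "shift Stay h = h"
| "shift MoveR h = h + 1"

fun act :: "nat \<times> move \<Rightarrow> tape \<Rightarrow> tape" where
  "act (s, d) (c, h) = (c(h := s), shift d h)"

fun step :: "tm \<Rightarrow> config \<Rightarrow> config" where
  "step M (q, ts) =
     (if q < states M
      then (case delta M q (map read_tape ts) of (q', acts) \<Rightarrow> (q', map2 act acts ts))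
      else (q, ts))"

definition contents :: "bool list \<Rightarrow> int \<Rightarrow> nat" where
  "contents w i =
     (if 0 \<le> i \<and> i < int (length w) then (if w ! nat i then 2 else 1) else 0)"

text \<open>The input is on the first tape; all other tapes are blank.\<close>
definition init_config :: "tm \<Rightarrow> bool list \<Rightarrow> config" where
  "init_config M w = (0, (contents w, 0) # replicate (tapes M - 1) (contents [], 0))"

text \<open>The output is the string left on the second tape.\<close>
definition computes_in_time :: "tm \<Rightarrow> (bool list \<Rightarrow> bool list) \<Rightarrow> (nat \<Rightarrow> nat) \<Rightarrow> bool" where
  "computes_in_time M f T \<longleftrightarrow>
     (\<forall>w. \<exists>t \<le> T (length w). \<exists>ts.
        (step M ^^ t) (init_config M w) = (states M, ts) \<and> fst (ts ! 1) = contents (f w))"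

definition polytime_computable :: "(bool list \<Rightarrow> bool list) \<Rightarrow> bool" where
  "polytime_computable f \<longleftrightarrow> (\<exists>M (p :: nat poly). wf_tm M \<and> computes_in_time M f (poly p))"

type_synonym language = "bool list set"

definition poly_many_one_reducible :: "language \<Rightarrow> language \<Rightarrow> bool" where
  "poly_many_one_reducible A B \<longleftrightarrow>
     (\<exists>f. polytime_computable f \<and> (\<forall>w. w \<in> A \<longleftrightarrow> f w \<in> B))"

definition poly_many_one_equivalent :: "language \<Rightarrow> language \<Rightarrow> bool" where
  "poly_many_one_equivalent A B \<longleftrightarrow>
     poly_many_one_reducible A B \<and> poly_many_one_reducible B A"


section \<open>Self-delimiting bit-string encodings\<close>

text \<open>
  Numbers are in unary. They only occur as the number \<open>n\<close> of vertices or variables of an instance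
  and as indices below \<open>n\<close>, so this is polynomially related to listing the vertex (variable) set
  and writing indices in binary.
\<close>
definition enc_nat :: "nat \<Rightarrow> bool list" where
  "enc_nat n = replicate n True @ [False]"

definition enc_list :: "('a \<Rightarrow> bool list) \<Rightarrow> 'a list \<Rightarrow> bool list" where
  "enc_list e xs = concat (map (\<lambda>x. True # e x) xs) @ [False]"


section \<open>Graph isomorphism\<close>

definition simple_graph :: "'a set \<Rightarrow> 'a set set \<Rightarrow> bool" where
  "simple_graph V E \<longleftrightarrow> finite V \<and> (\<forall>e \<in> E. e \<subseteq> V \<and> card e = 2)"

definition graph_isomorphic :: "'a set \<Rightarrow> 'a set set \<Rightarrow> 'b set \<Rightarrow> 'b set set \<Rightarrow> bool" where
  "graph_isomorphic V E W F \<longleftrightarrow>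
     (\<exists>\<phi>. bij_betw \<phi> V W \<and> (\<forall>u \<in> V. \<forall>v \<in> V. {u, v} \<in> E \<longleftrightarrow> {\<phi> u, \<phi> v} \<in> F))"

definition edge_set :: "('a \<times> 'a) list \<Rightarrow> 'a set set" where
  "edge_set es = (\<lambda>(u, v). {u, v}) ` set es"

definition enc_graph :: "nat \<Rightarrow> (nat \<times> nat) list \<Rightarrow> bool list" where
  "enc_graph n es = enc_nat n @ enc_list (\<lambda>(u, v). enc_nat u @ enc_nat v) es"

definition GI :: language where
  "GI = {enc_graph n es @ enc_graph m fs | n es m fs.
     simple_graph {..<n} (edge_set es) \<and> simple_graph {..<m} (edge_set fs) \<and>
     graph_isomorphic {..<n} (edge_set es) {..<m} (edge_set fs)}"


section \<open>Constraint isomorphism\<close>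

type_synonym "constraint" = "bool list set"

datatype 'v arg = Var 'v | Const bool

type_synonym 'v application = "constraint \<times> 'v arg list"

text \<open>The arity of a constraint is the common length of its tuples.\<close>
definition application_of :: "constraint set \<Rightarrow> 'v set \<Rightarrow> 'v application \<Rightarrow> bool" where
  "application_of \<C> X A \<longleftrightarrow> (case A of (C, as) \<Rightarrow>
     C \<in> \<C> \<and> (\<forall>t \<in> C. length t = length as) \<and> (\<forall>a \<in> set as. set_arg a \<subseteq> X))"

definition constant_free :: "'v application \<Rightarrow> bool" where
  "constant_free A \<longleftrightarrow> (\<forall>a \<in> set (snd A). \<exists>x. a = Var x)"

fun arg_value :: "('v \<Rightarrow> bool) \<Rightarrow> 'v arg \<Rightarrow> bool" where
  "arg_value \<alpha> (Var x) = \<alpha> x"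
| "arg_value \<alpha> (Const b) = b"

definition satisfies :: "('v \<Rightarrow> bool) \<Rightarrow> 'v application set \<Rightarrow> bool" where
  "satisfies \<alpha> S \<longleftrightarrow> (\<forall>(C, as) \<in> S. map (arg_value \<alpha>) as \<in> C)"

definition equivalent :: "'v application set \<Rightarrow> 'v application set \<Rightarrow> bool" where
  "equivalent S U \<longleftrightarrow> (\<forall>\<alpha>. satisfies \<alpha> S \<longleftrightarrow> satisfies \<alpha> U)"

definition rename :: "('v \<Rightarrow> 'v) \<Rightarrow> 'v application set \<Rightarrow> 'v application set" where
  "rename \<pi> S = (\<lambda>(C, as). (C, map (map_arg \<pi>) as)) ` S"

definition isomorphic :: "'v set \<Rightarrow> 'v application set \<Rightarrow> 'v application set \<Rightarrow> bool" where
  "isomorphic X S U \<longleftrightarrow> (\<exists>\<pi>. \<pi> permutes X \<and> equivalent (rename \<pi> S) U)"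

fun enc_arg :: "nat arg \<Rightarrow> bool list" where
  "enc_arg (Var x) = True # enc_nat x"
| "enc_arg (Const b) = [False, b]"

text \<open>The constraint of an application is written as its truth table.\<close>
definition enc_application :: "nat application \<Rightarrow> bool list" where
  "enc_application A = (case A of (C, as) \<Rightarrow>
     enc_list enc_arg as @ map (\<lambda>t. t \<in> C) (List.n_lists (length as) [False, True]))"

definition enc_instance :: "nat \<Rightarrow> nat application list \<Rightarrow> nat application list \<Rightarrow> bool list" where
  "enc_instance n S U = enc_nat n @ enc_list enc_application S @ enc_list enc_application U"

text \<open>
  The variable set is \<open>{..<n}\<close>; it may contain variables that occur in neither set of applications.
\<close>
definition ISO_c :: "constraint set \<Rightarrow> language" where
  "ISO_c \<C> = {enc_instance n S U | n S U.
     (\<forall>A \<in> set S \<union> set U. application_of \<C> {..<n} A) \<and>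
     isomorphic {..<n} (set S) (set U)}"

definition ISO :: "constraint set \<Rightarrow> language" where
  "ISO \<C> = {enc_instance n S U | n S U.
     (\<forall>A \<in> set S \<union> set U. application_of \<C> {..<n} A \<and> constant_free A) \<and>
     isomorphic {..<n} (set S) (set U)}"

definition xor3 :: "constraint" where
  "xor3 = {[True, False, False], [False, True, False], [False, False, True], [True, True, True]}"

end

theory Submission
  imports Defs
begin

text \<open>
  All reductions are computed by programs with bounded loops over registers and bit arrays, which are
  compiled to Turing machines running in polynomial time.

  A graph becomes a set of equations with one variable \<open>x\<^sub>u\<close> per vertex and one variable
  \<open>y\<^sub>u\<^sub>v\<close> per ordered pair of vertices, namely \<open>x\<^sub>u + x\<^sub>v + y\<^sub>u\<^sub>v = 1\<close> for adjacent and
  \<open>y\<^sub>u\<^sub>v = 1\<close> for nonadjacent pairs. The vertices, and whether two of them are adjacent, can be recognized from the solutions: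
  \<open>x\<^sub>u\<close> is neither constant nor equal to another variable, and \<open>u\<close>, \<open>v\<close> are adjacent iff
  \<open>x\<^sub>u + x\<^sub>v + z = 1\<close> holds in all solutions for some variable \<open>z\<close>.

  Conversely, a set of equations is determined up to equivalence by the finite set of all equations
  in at most three variables or constants that it implies. Implication is decided by Gaussian elimination, and the
  implied equations, being a symmetric ternary relation, are encoded by a graph.
\<close>

section \<open>Structured tape programs\<close>

text \<open>Equivalence compares solution sets, so neither direction may depend on how the equations
  are presented. This shapes both encodings. From graphs, everything must be legible from the
  solutions: an edge therefore gets two pair variables, which are forced to be equal, and a nonedge
  (the diagonal included) gets constant ones, so that no pair variable can be mistaken for a vertex.
  From constraints, closing under implication removes the presentation; the bound of three elements
  keeps the closure polynomial in size and still large enough to contain the given equations.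
  Constants take part in implied equations, so an isomorphism of the closures must be prevented from
  mixing them with variables: the copies of false and of true are tagged by hyperedges with two
  members and with one. A many-one reduction must also handle strings that encode nothing. They are
  sent to the empty string, which is in none of the languages; hence each parser is proved to fail
  exactly on the strings that do not start with a valid code.\<close>

datatype tprog =
    Write nat nat
  | Move nat move
  | TSeq tprog tprog
  | Branch nat "nat \<Rightarrow> bool" tprog tprog
  | While nat "nat \<Rightarrow> bool" tprog

abbreviation under_head :: "(nat \<Rightarrow> tape) \<Rightarrow> nat \<Rightarrow> nat" where
  "under_head \<tau> i \<equiv> read_tape (\<tau> i)"

text \<open>The number counts machine steps exactly: every test occupies a state of its own, so
  \<open>Branch\<close> and each evaluation of a \<open>While\<close> condition cost one
  step.\<close>

inductive run :: "tprog \<Rightarrow> (nat \<Rightarrow> tape) \<Rightarrow> nat \<Rightarrow> (nat \<Rightarrow> tape) \<Rightarrow> bool" where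
  run_Write: "run (Write i s) \<tau> 1 (\<tau>(i := act (s, Stay) (\<tau> i)))"
| run_Move: "run (Move i d) \<tau> 1 (\<tau>(i := act (under_head \<tau> i, d) (\<tau> i)))"
| run_TSeq: "run p \<tau> t \<tau>' \<Longrightarrow> run q \<tau>' t' \<tau>'' \<Longrightarrow> run (TSeq p q) \<tau> (t + t') \<tau>''"
| run_Branch: "run (if P (under_head \<tau> i) then p else q) \<tau> t \<tau>' \<Longrightarrow> run (Branch i P p q) \<tau> (Suc t) \<tau>'"
| run_While_end: "\<not> P (under_head \<tau> i) \<Longrightarrow> run (While i P p) \<tau> 1 \<tau>"
| run_While_step: "P (under_head \<tau> i) \<Longrightarrow> run p \<tau> t \<tau>' \<Longrightarrow> run (While i P p) \<tau>' t' \<tau>'' \<Longrightarrow>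
    run (While i P p) \<tau> (Suc (t + t')) \<tau>''"

primrec wf_tprog :: "nat \<Rightarrow> nat \<Rightarrow> tprog \<Rightarrow> bool" where
  "wf_tprog K S (Write i s) \<longleftrightarrow> i < K \<and> s < S"
| "wf_tprog K S (Move i d) \<longleftrightarrow> i < K"
| "wf_tprog K S (TSeq p q) \<longleftrightarrow> wf_tprog K S p \<and> wf_tprog K S q"
| "wf_tprog K S (Branch i P p q) \<longleftrightarrow> i < K \<and> wf_tprog K S p \<and> wf_tprog K S q"
| "wf_tprog K S (While i P p) \<longleftrightarrow> i < K \<and> wf_tprog K S p"

primrec num_states :: "tprog \<Rightarrow> nat" where
  "num_states (Write i s) = 1"
| "num_states (Move i d) = 1"
| "num_states (TSeq p q) = num_states p + num_states q"
| "num_states (Branch i P p q) = 1 + num_states p + num_states q"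
| "num_states (While i P p) = 1 + num_states p"

abbreviation idle :: "nat list \<Rightarrow> (nat \<times> move) list" where
  "idle ss \<equiv> map (\<lambda>s. (s, Stay)) ss"

text \<open>The code of a program occupies the states from \<open>b\<close> on, and control leaves it to state \<open>e\<close>.\<close>

primrec code :: "tprog \<Rightarrow> nat \<Rightarrow> nat \<Rightarrow> nat \<Rightarrow> nat list \<Rightarrow> nat \<times> (nat \<times> move) list" where
  "code (Write i s) b e q ss = (e, (idle ss)[i := (s, Stay)])"
| "code (Move i d) b e q ss = (e, (idle ss)[i := (ss ! i, d)])"
| "code (TSeq p r) b e q ss =
    (if q < b + num_states p then code p b (b + num_states p) q ss
     else code r (b + num_states p) e q ss)"
| "code (Branch i P p r) b e q ss =
    (if q = b then (if P (ss ! i) then b + 1 else b + 1 + num_states p, idle ss)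
     else if q < b + 1 + num_states p then code p (b + 1) e q ss
     else code r (b + 1 + num_states p) e q ss)"
| "code (While i P p) b e q ss =
    (if q = b then (if P (ss ! i) then b + 1 else e, idle ss) else code p (b + 1) b q ss)"

lemma map2_act_idle: "map2 act (idle (map read_tape ts)) ts = ts"
proof (rule nth_equalityI, goal_cases)
  case (2 i)
  then show ?case by (cases "ts ! i") simp
qed simp

lemma map2_act_update:
  assumes "i < K"
  shows "map2 act ((idle (map read_tape (map \<tau> [0..<K])))[i := a]) (map \<tau> [0..<K])
    = map (\<tau>(i := act a (\<tau> i))) [0..<K]"
proof (rule nth_equalityI, goal_cases)
  case 1 then show ?case by simp
next
  case (2 j)
  then have "j < K" by simp
  then show ?case using assms
    by (cases "\<tau> j") (auto simp: nth_list_update)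
qed

text \<open>Induction on the execution, with \<open>b\<close> and \<open>e\<close> general: the exit
  of a subprogram is the entry of whatever follows it. The transition function is constrained on the
  states of \<open>p\<close> only, so the hypothesis passes to subprograms.\<close>

lemma run_code:
  assumes "run p \<tau> t \<tau>'" "wf_tprog K S p"
    and "\<And>q ss. b \<le> q \<Longrightarrow> q < b + num_states p \<Longrightarrow> delta M q ss = code p b e q ss"
    and "b + num_states p \<le> states M"
  shows "(step M ^^ t) (b, map \<tau> [0..<K]) = (e, map \<tau>' [0..<K])"
  using assms
proof (induction arbitrary: b e rule: run.induct)
  case (run_Write i s \<tau>)
  then show ?case by (simp add: map2_act_update del: map_map fun_upd_apply)
next
  case (run_Move i d \<tau>)
  then show ?case by (simp add: map2_act_update del: map_map fun_upd_apply)
next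
  case (run_TSeq p \<tau> t \<tau>' q t' \<tau>'')
  have 1: "(step M ^^ t) (b, map \<tau> [0..<K]) = (b + num_states p, map \<tau>' [0..<K])"
    using run_TSeq.prems by (intro run_TSeq.IH(1)) auto
  have 2: "(step M ^^ t') (b + num_states p, map \<tau>' [0..<K]) = (e, map \<tau>'' [0..<K])"
    using run_TSeq.prems by (intro run_TSeq.IH(2)) auto
  show ?case using 1 2 by (simp add: add.commute[of t t'] funpow_add)
next
  case (run_Branch P \<tau> i p q t \<tau>')
  let ?b' = "if P (under_head \<tau> i) then b + 1 else b + 1 + num_states p"
  have "step M (b, map \<tau> [0..<K]) = (?b', map \<tau> [0..<K])"
    using run_Branch.prems map2_act_idle[of "map \<tau> [0..<K]"] by simp
  moreover have "(step M ^^ t) (?b', map \<tau> [0..<K]) = (e, map \<tau>' [0..<K])"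
    using run_Branch.prems by (intro run_Branch.IH) (auto split: if_splits)
  ultimately show ?case by (simp only: funpow_Suc_right o_apply)
next
  case (run_While_end P \<tau> i p)
  then show ?case using map2_act_idle[of "map \<tau> [0..<K]"] by simp
next
  case (run_While_step P \<tau> i p t \<tau>' t' \<tau>'')
  have 0: "step M (b, map \<tau> [0..<K]) = (b + 1, map \<tau> [0..<K])"
    using run_While_step.prems run_While_step.hyps(1) map2_act_idle[of "map \<tau> [0..<K]"] by simp
  \<comment> \<open>The body of a loop exits to \<open>b\<close>, where the condition is tested
    again.\<close>
  have 1: "(step M ^^ t) (b + 1, map \<tau> [0..<K]) = (b, map \<tau>' [0..<K])"
    using run_While_step.prems by (intro run_While_step.IH(1)) auto
  have 2: "(step M ^^ t') (b, map \<tau>' [0..<K]) = (e, map \<tau>'' [0..<K])"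
    using run_While_step.prems by (intro run_While_step.IH(2)) auto
  show ?case using 0 1 2 by (simp add: add.commute[of t t'] funpow_add funpow_swap1)
qed

lemma code_wf:
  assumes "wf_tprog K S p" "b \<le> q" "q < b + num_states p" "b + num_states p \<le> Z" "e \<le> Z"
    and "length ss = K" "\<forall>s \<in> set ss. s < S"
  shows "case code p b e q ss of (q', acts) \<Rightarrow>
    q' \<le> Z \<and> length acts = K \<and> (\<forall>(s, d) \<in> set acts. s < S)"
  using assms(1-5)
proof (induction p arbitrary: b e)
  case (Write i s)
  then show ?case using assms(6,7) set_update_subset_insert[of "idle ss" i "(s, Stay)"] by auto
next
  case (Move i d)
  then show ?case using assms(6,7) set_update_subset_insert[of "idle ss" i "(ss ! i, d)"] by auto
next
  case (TSeq p1 p2)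
  then show ?case by auto
next
  case (Branch i P p1 p2)
  show ?case
  proof (cases "q = b")
    case True
    then show ?thesis using Branch assms(6,7) by auto
  next
    case False
    then show ?thesis using Branch.IH[of "b + 1" e] Branch.IH(2)[of "b + 1 + num_states p1" e] Branch.prems
      by auto
  qed
next
  case (While i P p)
  show ?case
  proof (cases "q = b")
    case True
    then show ?thesis using While assms(6,7) by auto
  next
    case False
    then show ?thesis using While.IH[of "b + 1" b] While.prems by auto
  qed
qed

text \<open>An upper bound on the time, not the exact time, so that costs can be rounded up when
  programs are composed.\<close>

definition runs :: "tprog \<Rightarrow> (nat \<Rightarrow> tape) \<Rightarrow> nat \<Rightarrow> (nat \<Rightarrow> tape) \<Rightarrow> bool" where
  "runs p \<tau> T \<tau>' \<longleftrightarrow> (\<exists>t \<le> T. run p \<tau> t \<tau>')"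

definition init_tapes :: "bool list \<Rightarrow> nat \<Rightarrow> tape" where
  "init_tapes w i = (contents (if i = 0 then w else []), 0)"

text \<open>The machine's states are those of the code, and control leaves the code to
  \<open>num_states p\<close>, which is the halting state. The initial tapes are prescribed only
  below \<open>K\<close>, so a program may be analysed over infinitely many tapes with convenient
  contents beyond \<open>K\<close>.\<close>

lemma polytime_computableI:
  assumes "wf_tprog K S p" "K \<ge> 2" "S \<ge> 3"
    and "\<And>w. \<exists>\<tau>\<^sub>0 \<tau>. (\<forall>i < K. \<tau>\<^sub>0 i = init_tapes w i) \<and>
      runs p \<tau>\<^sub>0 (poly T (length w)) \<tau> \<and> fst (\<tau> 1) = contents (f w)"
  shows "polytime_computable f"
proof -
  define M where "M = \<lparr>tapes = K, symbols = S, states = num_states p, delta = code p 0 (num_states p)\<rparr>"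
  have "wf_tm M"
    unfolding wf_tm_def using assms(2,3) code_wf[OF assms(1), of 0 _ "num_states p" "num_states p"]
    by (simp add: M_def)
  moreover have "computes_in_time M f (poly T)"
    unfolding computes_in_time_def
  proof
    fix w
    obtain \<tau>\<^sub>0 \<tau> t where \<tau>\<^sub>0: "\<And>i. i < K \<Longrightarrow> \<tau>\<^sub>0 i = init_tapes w i"
      and t: "t \<le> poly T (length w)" "run p \<tau>\<^sub>0 t \<tau>" "fst (\<tau> 1) = contents (f w)"
      using assms(4)[of w] unfolding runs_def by auto
    have init: "init_config M w = (0, map \<tau>\<^sub>0 [0..<K])"
      using assms(2) by (auto simp: \<tau>\<^sub>0 init_config_def M_def init_tapes_def nth_Cons' intro!: nth_equalityI)
    have "(step M ^^ t) (init_config M w) = (num_states p, map \<tau> [0..<K])"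
      unfolding init by (rule run_code[OF t(2) assms(1)]) (auto simp: M_def)
    then show "\<exists>t\<le>poly T (length w). \<exists>ts. (step M ^^ t) (init_config M w) = (states M, ts) \<and> fst (ts ! 1) = contents (f w)"
      using t assms(2) by (auto simp: M_def intro!: exI[of _ t])
  qed
  ultimately show ?thesis unfolding polytime_computable_def by blast
qed

lemma wf_tprog_mono: "wf_tprog K S p \<Longrightarrow> K \<le> K' \<Longrightarrow> S \<le> S' \<Longrightarrow> wf_tprog K' S' p"
  by (induction p) auto

lemma wf_tprog_ex: "\<exists>K S. wf_tprog K S p"
proof (induction p)
  case (Write i s)
  show ?case by (intro exI[of _ "Suc i"] exI[of _ "Suc s"]) simp
next
  case (Move i d)
  show ?case by (intro exI[of _ "Suc i"]) simp
next
  case (TSeq p q)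
  then obtain K S K' S' where "wf_tprog K S p" "wf_tprog K' S' q" by blast
  then have "wf_tprog (max K K') (max S S') (TSeq p q)"
    by (auto intro: wf_tprog_mono)
  then show ?case by blast
next
  case (Branch i P p q)
  then obtain K S K' S' where "wf_tprog K S p" "wf_tprog K' S' q" by blast
  then have "wf_tprog (max (Suc i) (max K K')) (max S S') (Branch i P p q)"
    by (auto intro: wf_tprog_mono)
  then show ?case by blast
next
  case (While i P p)
  then obtain K S where "wf_tprog K S p" by blast
  then have "wf_tprog (max (Suc i) K) S (While i P p)"
    by (auto intro: wf_tprog_mono)
  then show ?case by blast
qed

section \<open>Elementary routines with time bounds\<close>

lemma runs_mono: "runs p \<tau> T \<tau>' \<Longrightarrow> T \<le> T' \<Longrightarrow> runs p \<tau> T' \<tau>'"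
  unfolding runs_def by (meson le_trans)

lemma runs_Write: "runs (Write i s) \<tau> 1 (\<tau>(i := ((fst (\<tau> i))(snd (\<tau> i) := s), snd (\<tau> i))))"
  unfolding runs_def using run_Write[of i s \<tau>] by (cases "\<tau> i") auto

lemma runs_Move: "runs (Move i d) \<tau> 1 (\<tau>(i := (fst (\<tau> i), shift d (snd (\<tau> i)))))"
  unfolding runs_def using run_Move[of i d \<tau>] by (cases "\<tau> i") auto

lemma runs_TSeq: "runs p \<tau> T \<tau>' \<Longrightarrow> runs q \<tau>' T' \<tau>'' \<Longrightarrow> runs (TSeq p q) \<tau> (T + T') \<tau>''"
  unfolding runs_def by (meson run_TSeq add_mono)

lemma runs_Branch:
  "runs (if P (under_head \<tau> i) then p else q) \<tau> T \<tau>' \<Longrightarrow> runs (Branch i P p q) \<tau> (Suc T) \<tau>'"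
  unfolding runs_def by (meson run_Branch Suc_le_mono)

text \<open>The successive tape states are given in advance as a sequence. With at most
  \<open>T\<close> steps per round there are \<open>v\<close> rounds and \<open>v + 1\<close>
  tests.\<close>

lemma runs_While:
  assumes "\<And>j. j < v \<Longrightarrow> P (under_head (\<tau> j) i)"
    and "\<And>j. j < v \<Longrightarrow> runs p (\<tau> j) T (\<tau> (Suc j))"
    and "\<not> P (under_head (\<tau> v) i)"
  shows "runs (While i P p) (\<tau> 0) (v * (T + 1) + 1) (\<tau> v)"
  using assms
proof (induction v arbitrary: \<tau>)
  case 0
  then show ?case unfolding runs_def using run_While_end[of P "\<tau> 0" i p] by auto
next
  case (Suc v)
  have "runs (While i P p) (\<tau> (Suc 0)) (v * (T + 1) + 1) (\<tau> (Suc v))"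
    using Suc.IH[of "\<lambda>j. \<tau> (Suc j)"] Suc.prems by simp
  then obtain t' where t': "t' \<le> v * (T + 1) + 1" "run (While i P p) (\<tau> (Suc 0)) t' (\<tau> (Suc v))"
    unfolding runs_def by blast
  obtain t where t: "t \<le> T" "run p (\<tau> 0) t (\<tau> (Suc 0))"
    using Suc.prems(2)[of 0] unfolding runs_def by auto
  have "run (While i P p) (\<tau> 0) (Suc (t + t')) (\<tau> (Suc v))"
    using Suc.prems(1)[of 0] t(2) t'(2) by (intro run_While_step) auto
  then show ?case unfolding runs_def using t t' by (intro exI[of _ "Suc (t + t')"]) simp
qed

lemma runs_eq: "runs p \<tau> T \<tau>' \<Longrightarrow> \<tau> = \<sigma> \<Longrightarrow> \<tau>' = \<sigma>' \<Longrightarrow> T \<le> T' \<Longrightarrow> runs p \<sigma> T' \<sigma>'"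
  using runs_mono by blast

lemma runs_post: "runs p \<tau> T \<tau>' \<Longrightarrow> \<tau>' = \<sigma>' \<Longrightarrow> T \<le> T' \<Longrightarrow> runs p \<tau> T' \<sigma>'"
  using runs_mono by blast

text \<open>Symbol 3 marks the cell to the left of the used part of a tape.\<close>

definition rewind :: "nat \<Rightarrow> tprog" where
  "rewind i = TSeq (While i (\<lambda>s. s \<noteq> 3) (Move i MoveL)) (Move i MoveR)"

lemma runs_rewind:
  assumes "\<tau> i = (c, int h)" "c (-1) = 3" "\<And>j. j \<le> h \<Longrightarrow> c (int j) \<noteq> 3"
  shows "runs (rewind i) \<tau> (2 * h + 4) (\<tau>(i := (c, 0)))"
proof -
  let ?\<tau> = "\<lambda>j. \<tau>(i := (c, int h - int j))"
  \<comment> \<open>From cell \<open>h\<close> the head makes \<open>Suc h\<close> moves to reach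
    the mark in cell -1; the final move to the right puts it on cell 0.\<close>
  have "runs (While i (\<lambda>s. s \<noteq> 3) (Move i MoveL)) (?\<tau> 0) (Suc h * (1 + 1) + 1) (?\<tau> (Suc h))"
  proof (rule runs_While[where \<tau> = ?\<tau>])
    fix j assume "j < Suc h"
    then show "under_head (?\<tau> j) i \<noteq> 3" using assms(3)[of "h - j"] by (simp add: of_nat_diff)
    show "runs (Move i MoveL) (?\<tau> j) 1 (?\<tau> (Suc j))"
      by (rule runs_post[OF runs_Move]) (auto simp: fun_eq_iff)
  qed (use assms(2) in simp)
  moreover have "runs (Move i MoveR) (?\<tau> (Suc h)) 1 (\<tau>(i := (c, 0)))"
    by (rule runs_post[OF runs_Move]) (auto simp: fun_eq_iff)
  ultimately have "runs (rewind i) (?\<tau> 0) (Suc h * (1 + 1) + 1 + 1) (\<tau>(i := (c, 0)))"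
    unfolding rewind_def by (rule runs_TSeq)
  then show ?thesis
    by (rule runs_eq) (use assms(1) in \<open>auto simp: fun_eq_iff\<close>)
qed

definition unary :: "nat \<Rightarrow> int \<Rightarrow> nat" where
  "unary v j = (if j = -1 then 3 else if 0 \<le> j \<and> j < int v then 2 else 0)"

lemma unary_simps [simp]: "unary v (-1) = 3" "unary v (int j) = (if j < v then 2 else 0)"
  "unary v 0 = (if 0 < v then 2 else 0)"
  by (auto simp: unary_def)

lemma runs_rewind_unary:
  "\<tau> i = (unary v, int h) \<Longrightarrow> runs (rewind i) \<tau> (2 * h + 4) (\<tau>(i := (unary v, 0)))"
  by (rule runs_rewind) auto

definition along :: "nat \<Rightarrow> tprog \<Rightarrow> tprog" where
  "along r p = TSeq (While r (\<lambda>s. s = 2) (TSeq p (Move r MoveR))) (rewind r)"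

text \<open>The head of tape \<open>r\<close> itself counts the rounds. Overriding entry
  \<open>r\<close> on both sides of the second hypothesis says that the body leaves this head and
  the number on the tape alone.\<close>

lemma runs_along:
  assumes "\<And>j. j \<le> v \<Longrightarrow> \<tau> j r = (unary v, 0)"
    and "\<And>j. j < v \<Longrightarrow> runs p ((\<tau> j)(r := (unary v, int j))) T ((\<tau> (Suc j))(r := (unary v, int j)))"
  shows "runs (along r p) (\<tau> 0) (v * (T + 4) + 5) (\<tau> v)"
proof -
  let ?\<tau> = "\<lambda>j. (\<tau> j)(r := (unary v, int j))"
  have "runs (While r (\<lambda>s. s = 2) (TSeq p (Move r MoveR))) (?\<tau> 0) (v * (T + 1 + 1) + 1) (?\<tau> v)"
  proof (rule runs_While[where \<tau> = ?\<tau>])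
    fix j assume j: "j < v"
    then show "under_head (?\<tau> j) r = 2" by simp
    show "runs (TSeq p (Move r MoveR)) (?\<tau> j) (T + 1) (?\<tau> (Suc j))"
      by (rule runs_post[OF runs_TSeq[OF assms(2)[OF j] runs_Move]]) (auto simp: fun_eq_iff)
  qed simp
  moreover have "?\<tau> 0 = \<tau> 0" using assms(1)[of 0] by (auto simp: fun_eq_iff)
  ultimately have "runs (While r (\<lambda>s. s = 2) (TSeq p (Move r MoveR))) (\<tau> 0) (v * (T + 1 + 1) + 1) (?\<tau> v)"
    by simp
  then show ?thesis unfolding along_def
    by (rule runs_post[OF runs_TSeq[OF _ runs_rewind_unary]])
       (use assms(1)[of v] in \<open>auto simp: fun_eq_iff algebra_simps\<close>)
qed

lemma runs_walk:
  assumes "\<tau> r = (unary v, 0)" "\<tau> i = (c, int h)" "r \<noteq> i"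
  shows "runs (along r (Move i MoveR)) \<tau> (v * 5 + 5) (\<tau>(i := (c, int (h + v))))"
proof -
  let ?\<tau> = "\<lambda>j. \<tau>(i := (c, int (h + j)))"
  have "runs (along r (Move i MoveR)) (?\<tau> 0) (v * (1 + 4) + 5) (?\<tau> v)"
  proof (rule runs_along[where \<tau> = ?\<tau>])
    fix j
    show "runs (Move i MoveR) ((?\<tau> j)(r := (unary v, int j))) 1 ((?\<tau> (Suc j))(r := (unary v, int j)))"
      by (rule runs_post[OF runs_Move]) (use assms in \<open>auto simp: fun_eq_iff\<close>)
  qed (use assms in auto)
  then show ?thesis
    by (rule runs_eq) (use assms in \<open>auto simp: fun_eq_iff\<close>)
qed

definition erase :: "nat \<Rightarrow> tprog" where
  "erase i = TSeq (While i (\<lambda>s. s = 2) (TSeq (Write i 0) (Move i MoveR))) (rewind i)"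

lemma runs_erase:
  assumes "\<tau> i = (unary v, 0)"
  shows "runs (erase i) \<tau> (v * 5 + 5) (\<tau>(i := (unary 0, 0)))"
proof -
  \<comment> \<open>Cells are cleared from the left, so after \<open>j\<close> rounds the block of
    2s starts at \<open>j\<close> and the mark in cell -1 survives.\<close>
  let ?c = "\<lambda>j x. if x = -1 then 3 else if int j \<le> x \<and> x < int v then 2 else 0"
  let ?\<tau> = "\<lambda>j. \<tau>(i := (?c j, int j))"
  have "runs (While i (\<lambda>s. s = 2) (TSeq (Write i 0) (Move i MoveR))) (?\<tau> 0) (v * (1 + 1 + 1) + 1) (?\<tau> v)"
  proof (rule runs_While[where \<tau> = ?\<tau>])
    fix j assume j: "j < v"
    then show "under_head (?\<tau> j) i = 2" by simp
    show "runs (TSeq (Write i 0) (Move i MoveR)) (?\<tau> j) (1 + 1) (?\<tau> (Suc j))"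
      by (rule runs_post[OF runs_TSeq[OF runs_Write runs_Move]]) (auto simp: fun_eq_iff)
  qed simp
  moreover have "?\<tau> 0 = \<tau>" "?\<tau> v = \<tau>(i := (unary 0, int v))"
    using assms by (auto simp: fun_eq_iff unary_def)
  ultimately have "runs (While i (\<lambda>s. s = 2) (TSeq (Write i 0) (Move i MoveR))) \<tau> (v * (1 + 1 + 1) + 1)
      (\<tau>(i := (unary 0, int v)))" by simp
  then show ?thesis unfolding erase_def
    by (rule runs_post[OF runs_TSeq[OF _ runs_rewind_unary]]) auto
qed

definition duplicate :: "nat \<Rightarrow> nat \<Rightarrow> tprog" where
  "duplicate r i = TSeq (along r (TSeq (Write i 2) (Move i MoveR))) (rewind i)"

lemma runs_duplicate:
  assumes "\<tau> r = (unary v, 0)" "\<tau> i = (unary 0, 0)" "r \<noteq> i"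
  shows "runs (duplicate r i) \<tau> (v * 8 + 9) (\<tau>(i := (unary v, 0)))"
proof -
  let ?\<tau> = "\<lambda>j. \<tau>(i := (unary j, int j))"
  have "runs (along r (TSeq (Write i 2) (Move i MoveR))) (?\<tau> 0) (v * (1 + 1 + 4) + 5) (?\<tau> v)"
  proof (rule runs_along[where \<tau> = ?\<tau>])
    fix j assume j: "j < v"
    show "runs (TSeq (Write i 2) (Move i MoveR)) ((?\<tau> j)(r := (unary v, int j))) (1 + 1)
        ((?\<tau> (Suc j))(r := (unary v, int j)))"
      by (rule runs_post[OF runs_TSeq[OF runs_Write runs_Move]])
         (use assms in \<open>auto simp: fun_eq_iff unary_def\<close>)
  qed (use assms in auto)
  moreover have "?\<tau> 0 = \<tau>" using assms by (auto simp: fun_eq_iff)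
  ultimately have "runs (along r (TSeq (Write i 2) (Move i MoveR))) \<tau> (v * (1 + 1 + 4) + 5) (?\<tau> v)"
    by simp
  then show ?thesis unfolding duplicate_def
    by (rule runs_post[OF runs_TSeq[OF _ runs_rewind_unary]]) auto
qed

section \<open>A language of bounded loops\<close>

text \<open>
  Registers hold numbers up to \<open>bound w\<close>, where \<open>Inc\<close> saturates; loops are repeated as often as the value of
  a register says when the loop is entered. Hence every program runs in polynomial time, and
  correctness proofs need not mention running times at all.
\<close>

datatype test =
    Less nat nat
  | Pos nat
  | Bit nat nat nat
  | Input nat nat
  | TNot test
  | TAnd test test

datatype prog =
    Skip
  | Zero nat
  | Inc nat
  | Copy nat nat
  | Top nat
  | Put nat nat nat bool
  | Emit bool
  | Seq prog prog (infixr ";;" 60)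
  | Cond test prog prog
  | Repeat nat prog

record store =
  reg :: "nat \<Rightarrow> nat"
  arr :: "nat \<Rightarrow> nat \<Rightarrow> nat \<Rightarrow> bool"
  outp :: "bool list"

text \<open>The 8 makes room for the \<open>n + 5\<close> elements of an instance with
  \<open>n\<close> variables and for small constants, even if the input is empty.\<close>

definition bound :: "bool list \<Rightarrow> nat" where
  "bound w = length w + 8"

primrec eval :: "bool list \<Rightarrow> test \<Rightarrow> store \<Rightarrow> bool" where
  "eval w (Less r s) \<sigma> \<longleftrightarrow> reg \<sigma> r < reg \<sigma> s"
| "eval w (Pos r) \<sigma> \<longleftrightarrow> 0 < reg \<sigma> r"
| "eval w (Bit a r s) \<sigma> \<longleftrightarrow> arr \<sigma> a (reg \<sigma> r) (reg \<sigma> s)"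
| "eval w (Input r k) \<sigma> \<longleftrightarrow> contents w (int (reg \<sigma> r)) = k"
| "eval w (TNot t) \<sigma> \<longleftrightarrow> \<not> eval w t \<sigma>"
| "eval w (TAnd t u) \<sigma> \<longleftrightarrow> eval w t \<sigma> \<and> eval w u \<sigma>"

definition set_reg :: "nat \<Rightarrow> nat \<Rightarrow> store \<Rightarrow> store" where
  "set_reg r v \<sigma> = \<sigma>\<lparr>reg := (reg \<sigma>)(r := v)\<rparr>"

definition set_arr :: "nat \<Rightarrow> nat \<Rightarrow> nat \<Rightarrow> bool \<Rightarrow> store \<Rightarrow> store" where
  "set_arr a i j b \<sigma> = \<sigma>\<lparr>arr := (arr \<sigma>)(a := (arr \<sigma> a)(i := (arr \<sigma> a i)(j := b)))\<rparr>"

primrec exec :: "bool list \<Rightarrow> prog \<Rightarrow> store \<Rightarrow> store" where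
  "exec w Skip \<sigma> = \<sigma>"
| "exec w (Zero r) \<sigma> = set_reg r 0 \<sigma>"
| "exec w (Inc r) \<sigma> = set_reg r (min (bound w) (Suc (reg \<sigma> r))) \<sigma>"
| "exec w (Copy r s) \<sigma> = set_reg r (reg \<sigma> s) \<sigma>"
| "exec w (Top r) \<sigma> = set_reg r (bound w) \<sigma>"
| "exec w (Put a r s b) \<sigma> = set_arr a (reg \<sigma> r) (reg \<sigma> s) b \<sigma>"
| "exec w (Emit b) \<sigma> = \<sigma>\<lparr>outp := outp \<sigma> @ [b]\<rparr>"
| "exec w (p ;; q) \<sigma> = exec w q (exec w p \<sigma>)"
| "exec w (Cond t p q) \<sigma> = (if eval w t \<sigma> then exec w p \<sigma> else exec w q \<sigma>)"
| "exec w (Repeat r p) \<sigma> = (exec w p ^^ reg \<sigma> r) \<sigma>"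

definition bounded :: "bool list \<Rightarrow> store \<Rightarrow> bool" where
  "bounded w \<sigma> \<longleftrightarrow> (\<forall>r. reg \<sigma> r \<le> bound w)"

lemma bounded_funpow:
  "(\<And>\<sigma>. bounded w \<sigma> \<Longrightarrow> bounded w (f \<sigma>)) \<Longrightarrow> bounded w \<sigma> \<Longrightarrow> bounded w ((f ^^ n) \<sigma>)"
  by (induction n) auto

text \<open>\<open>Inc\<close> saturates, and the other assignments store 0, the bound or a value
  already present. Hence every loop count is at most \<open>bound w\<close>, which is the source of
  all polynomial time bounds.\<close>

lemma bounded_exec: "bounded w \<sigma> \<Longrightarrow> bounded w (exec w p \<sigma>)"
proof (induction p arbitrary: \<sigma>)
  case (Repeat r p)
  then show ?case by (simp add: bounded_funpow)
qed (auto simp: bounded_def set_reg_def set_arr_def)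

subsection \<open>Translation into tape programs\<close>

text \<open>Row-major order with rows of \<open>Suc B\<close> cells, since the indices held by
  registers run from 0 to \<open>B\<close> inclusive. A clear bit is the blank, so apart from the
  mark a fresh tape holds the empty array.\<close>

definition bits :: "nat \<Rightarrow> (nat \<Rightarrow> nat \<Rightarrow> bool) \<Rightarrow> int \<Rightarrow> nat" where
  "bits B A j = (if j = -1 then 3
     else if 0 \<le> j \<and> A (nat j div Suc B) (nat j mod Suc B) then 2 else 0)"

text \<open>
  Tape 0 is the input tape, tape 1 the output tape and tape 2 holds the bound in unary. The remaining
  tapes are shared among the registers, the arrays, which are stored row by row, and the auxiliary tapes
  \<open>\<rho>\<close> that count the iterations of nested loops.
\<close>

abbreviation "reg_tape r \<equiv> 3 * r + 3"
abbreviation "arr_tape a \<equiv> 3 * a + 4"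
abbreviation "aux_tape d \<equiv> 3 * d + 5"

definition tapes_of :: "bool list \<Rightarrow> store \<Rightarrow> (nat \<Rightarrow> tape) \<Rightarrow> nat \<Rightarrow> tape" where
  "tapes_of w \<sigma> \<rho> i =
     (if i = 0 then ((contents w)(-1 := 3), 0)
      else if i = 1 then (contents (outp \<sigma>), int (length (outp \<sigma>)))
      else if i = 2 then (unary (bound w), 0)
      else if i mod 3 = 0 then (unary (reg \<sigma> ((i - 3) div 3)), 0)
      else if i mod 3 = 1 then (bits (bound w) (arr \<sigma> ((i - 4) div 3)), 0)
      else \<rho> ((i - 5) div 3))"

lemma distinct_tapes [simp]: "3 * r + 3 \<noteq> 3 * a + (4::nat)" "3 * a + (4::nat) \<noteq> 3 * r + 3"
  "3 * r + 3 \<noteq> 3 * d + (5::nat)" "3 * d + (5::nat) \<noteq> 3 * r + 3"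
  "3 * a + 4 \<noteq> 3 * d + (5::nat)" "3 * d + (5::nat) \<noteq> 3 * a + 4"
  by presburger+

lemma mod_tapes [simp]: "(3 * r + 3) mod 3 = (0::nat)" "(3 * a + 4) mod 3 = (1::nat)" "(3 * d + 5) mod 3 = (2::nat)"
  by presburger+

lemma tapes_of_simps [simp]:
  "tapes_of w \<sigma> \<rho> 0 = ((contents w)(-1 := 3), 0)"
  "tapes_of w \<sigma> \<rho> (Suc 0) = (contents (outp \<sigma>), int (length (outp \<sigma>)))"
  "tapes_of w \<sigma> \<rho> 2 = (unary (bound w), 0)"
  "tapes_of w \<sigma> \<rho> (reg_tape r) = (unary (reg \<sigma> r), 0)"
  "tapes_of w \<sigma> \<rho> (arr_tape a) = (bits (bound w) (arr \<sigma> a), 0)"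
  "tapes_of w \<sigma> \<rho> (aux_tape d) = \<rho> d"
  by (simp_all add: tapes_of_def)

lemma tape_cases:
  fixes i :: nat
  obtains "i = 0" | "i = Suc 0" | "i = 2" | r where "i = reg_tape r" | a where "i = arr_tape a" | d where "i = aux_tape d"
proof -
  define k m where "k = i div 3" and "m = i mod 3"
  then have i: "i = 3 * k + m" "m = 0 \<or> m = 1 \<or> m = 2" by auto
  show ?thesis
  proof (cases k)
    case 0
    then show ?thesis using i that(1-3) by auto
  next
    case (Suc k')
    then have "i = reg_tape k' \<or> i = arr_tape k' \<or> i = aux_tape k'" using i by auto
    then show ?thesis using that(4-6) by blast
  qed
qed

lemma tapes_of_set_reg:
  "tapes_of w (set_reg r v \<sigma>) \<rho> = (tapes_of w \<sigma> \<rho>)(reg_tape r := (unary v, 0))"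
proof
  fix i
  show "tapes_of w (set_reg r v \<sigma>) \<rho> i = ((tapes_of w \<sigma> \<rho>)(reg_tape r := (unary v, 0))) i"
    by (cases i rule: tape_cases) (auto simp: set_reg_def simp del: One_nat_def)
qed

lemma tapes_of_set_arr:
  "tapes_of w (set_arr a x y b \<sigma>) \<rho> = (tapes_of w \<sigma> \<rho>)(arr_tape a :=
     (bits (bound w) ((arr \<sigma> a)(x := (arr \<sigma> a x)(y := b))), 0))"
proof
  fix i
  show "tapes_of w (set_arr a x y b \<sigma>) \<rho> i = ((tapes_of w \<sigma> \<rho>)(arr_tape a :=
     (bits (bound w) ((arr \<sigma> a)(x := (arr \<sigma> a x)(y := b))), 0))) i"
    by (cases i rule: tape_cases) (auto simp: set_arr_def)
qed

lemma tapes_of_outp: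
  "tapes_of w (\<sigma>\<lparr>outp := x\<rparr>) \<rho> = (tapes_of w \<sigma> \<rho>)(Suc 0 := (contents x, int (length x)))"
proof
  fix i
  show "tapes_of w (\<sigma>\<lparr>outp := x\<rparr>) \<rho> i = ((tapes_of w \<sigma> \<rho>)(Suc 0 := (contents x, int (length x)))) i"
    by (cases i rule: tape_cases) auto
qed

lemma tapes_of_aux: "tapes_of w \<sigma> (\<rho>(d := x)) = (tapes_of w \<sigma> \<rho>)(aux_tape d := x)"
proof
  fix i
  show "tapes_of w \<sigma> (\<rho>(d := x)) i = ((tapes_of w \<sigma> \<rho>)(aux_tape d := x)) i"
    by (cases i rule: tape_cases) auto
qed

text \<open>A row is skipped by walking along the \<open>B\<close> cells of tape 2 and making one
  further move, because a row has \<open>B + 1\<close> cells.\<close>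

definition seek :: "nat \<Rightarrow> nat \<Rightarrow> nat \<Rightarrow> tprog" where
  "seek a r s = TSeq (along r (TSeq (along 2 (Move a MoveR)) (Move a MoveR))) (along s (Move a MoveR))"

text \<open>One generous bound for all primitives. It is quadratic because an array access walks
  over whole rows.\<close>

definition prim_cost :: "nat \<Rightarrow> nat" where
  "prim_cost B = 100 * (B + 1) * (B + 1)"

lemma linear_le_prim_cost: "T \<le> 100 * B + 100 \<Longrightarrow> T \<le> prim_cost B"
  unfolding prim_cost_def by (simp add: algebra_simps)

lemma runs_seek:
  assumes "\<tau> 2 = (unary B, 0)" "\<tau> r = (unary x, 0)" "\<tau> s = (unary y, 0)" "\<tau> a = (c, 0)"
    and "a \<noteq> r" "a \<noteq> s" "a \<noteq> 2" "r \<noteq> 2" "s \<noteq> 2" "x \<le> B" "y \<le> B"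
  shows "runs (seek a r s) \<tau> (5 * (B + 1) * (B + 1) + 20 * B + 20) (\<tau>(a := (c, int (x * Suc B + y))))"
proof -
  let ?\<tau> = "\<lambda>j. \<tau>(a := (c, int (j * Suc B)))"
  have "runs (along r (TSeq (along 2 (Move a MoveR)) (Move a MoveR))) (?\<tau> 0) (x * ((B * 5 + 5 + 1) + 4) + 5) (?\<tau> x)"
  proof (rule runs_along[where \<tau> = ?\<tau>])
    fix j
    show "runs (TSeq (along 2 (Move a MoveR)) (Move a MoveR)) ((?\<tau> j)(r := (unary x, int j))) (B * 5 + 5 + 1)
        ((?\<tau> (Suc j))(r := (unary x, int j)))"
      by (rule runs_post[OF runs_TSeq[OF runs_walk[where v = B and c = c and h = "j * Suc B"] runs_Move]])
        (use assms in \<open>auto simp: fun_eq_iff\<close>)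
  qed (use assms in auto)
  moreover have "?\<tau> 0 = \<tau>" using assms by (auto simp: fun_eq_iff)
  ultimately have "runs (along r (TSeq (along 2 (Move a MoveR)) (Move a MoveR))) \<tau> (x * ((B * 5 + 5 + 1) + 4) + 5) (?\<tau> x)"
    by simp
  moreover have "runs (along s (Move a MoveR)) (?\<tau> x) (y * 5 + 5) (\<tau>(a := (c, int (x * Suc B + y))))"
    by (rule runs_post[OF runs_walk[where v = y and c = c and h = "x * Suc B"]])
      (use assms in \<open>auto simp: fun_eq_iff\<close>)
  ultimately have "runs (seek a r s) \<tau> (x * ((B * 5 + 5 + 1) + 4) + 5 + (y * 5 + 5)) (\<tau>(a := (c, int (x * Suc B + y))))"
    unfolding seek_def by (rule runs_TSeq)
  moreover have "x * ((B * 5 + 5 + 1) + 4) + 5 + (y * 5 + 5) \<le> 5 * (B + 1) * (B + 1) + 20 * B + 20"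
    using mult_right_mono[OF assms(10), of "B * 5 + 5 + 1 + 4"] assms(11) by (simp add: algebra_simps)
  ultimately show ?thesis by (rule runs_mono)
qed

lemma bits_int: "bits B A (int n) = (if A (n div Suc B) (n mod Suc B) then 2 else 0)"
  by (simp add: bits_def)

lemma div_mod_row:
  assumes "y \<le> B"
  shows "(x * Suc B + y) div Suc B = x" "(x * Suc B + y) mod Suc B = y"
proof -
  have y: "y div Suc B = 0" "y mod Suc B = y" using assms by simp_all
  show "(x * Suc B + y) div Suc B = x"
    by (simp only: div_mult_self3[OF Suc_not_Zero] y add_0_right)
  show "(x * Suc B + y) mod Suc B = y"
    by (simp only: mod_mult_self3 y)
qed

lemma bits_simps: "bits B A (-1) = 3" "y \<le> B \<Longrightarrow> bits B A (int (x * Suc B + y)) = (if A x y then 2 else 0)"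
  "bits B A (int j) \<noteq> 3"
proof -
  show "bits B A (-1) = 3" by (simp add: bits_def)
  show "bits B A (int (x * Suc B + y)) = (if A x y then 2 else 0)" if "y \<le> B"
    unfolding bits_int div_mod_row[OF that] ..
  show "bits B A (int j) \<noteq> 3" unfolding bits_int by simp
qed

lemma bits_upd:
  assumes "y \<le> B"
  shows "bits B (A(x := (A x)(y := b))) = (bits B A)(int (x * Suc B + y) := if b then 2 else 0)"
proof
  fix j
  show "bits B (A(x := (A x)(y := b))) j = ((bits B A)(int (x * Suc B + y) := if b then 2 else 0)) j"
  proof (cases "j < 0")
    case True
    then have "j \<noteq> int (x * Suc B + y)" by linarith
    with True show ?thesis by (simp add: bits_def)
  next
    case False
    then obtain n where j: "j = int n" using nonneg_int_cases[of j] by auto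
    \<comment> \<open>Uniqueness of quotient and remainder, which relies on
      \<open>y \<le> B\<close>: one cell belongs to exactly one entry.\<close>
    have "n = x * Suc B + y \<longleftrightarrow> n div Suc B = x \<and> n mod Suc B = y"
      using div_mod_row[OF assms] by (metis div_mult_mod_eq)
    then show ?thesis
      by (auto simp only: j fun_upd_apply bits_int of_nat_eq_iff split: if_split)
  qed
qed

text \<open>The code for both outcomes is passed as continuations, so no truth value is ever stored;
  negation swaps them. \<open>Less r r\<close> is separate because comparison moves two heads, which
  must be on different tapes.\<close>

primrec compile_test :: "test \<Rightarrow> tprog \<Rightarrow> tprog \<Rightarrow> tprog" where
  "compile_test (Less r s) p q = (if r = s then q else
     TSeq (While (reg_tape r) (\<lambda>x. x = 2) (TSeq (Move (reg_tape r) MoveR) (Move (reg_tape s) MoveR)))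
      (Branch (reg_tape s) (\<lambda>x. x = 2)
        (TSeq (rewind (reg_tape r)) (TSeq (rewind (reg_tape s)) p))
        (TSeq (rewind (reg_tape r)) (TSeq (rewind (reg_tape s)) q))))"
| "compile_test (Pos r) p q = Branch (reg_tape r) (\<lambda>x. x = 2) p q"
| "compile_test (Bit a r s) p q = TSeq (seek (arr_tape a) (reg_tape r) (reg_tape s))
     (Branch (arr_tape a) (\<lambda>x. x = 2) (TSeq (rewind (arr_tape a)) p) (TSeq (rewind (arr_tape a)) q))"
| "compile_test (Input r k) p q = TSeq (along (reg_tape r) (Move 0 MoveR))
     (Branch 0 (\<lambda>x. x = k) (TSeq (rewind 0) p) (TSeq (rewind 0) q))"
| "compile_test (TNot t) p q = compile_test t q p"
| "compile_test (TAnd t u) p q = compile_test t (compile_test u p q) q"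

primrec test_cost :: "test \<Rightarrow> nat \<Rightarrow> nat" where
  "test_cost (Less r s) B = prim_cost B"
| "test_cost (Pos r) B = prim_cost B"
| "test_cost (Bit a r s) B = prim_cost B"
| "test_cost (Input r k) B = prim_cost B"
| "test_cost (TNot t) B = test_cost t B"
| "test_cost (TAnd t u) B = test_cost t B + test_cost u B"

lemma runs_Branch_rewind:
  assumes "\<tau> i = (c, int h)" "c (-1) = 3" "\<And>j. j \<le> h \<Longrightarrow> c (int j) \<noteq> 3" "b = P (c (int h))"
    and "runs (if b then p else q) (\<tau>(i := (c, 0))) T \<tau>'"
  shows "runs (Branch i P (TSeq (rewind i) p) (TSeq (rewind i) q)) \<tau> (2 * h + 5 + T) \<tau>'"
proof -
  have "runs (TSeq (rewind i) (if b then p else q)) \<tau> (2 * h + 4 + T) \<tau>'"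
    by (rule runs_TSeq[OF runs_rewind[where c = c and h = h]]) (use assms in auto)
  then have "runs (Branch i P (TSeq (rewind i) p) (TSeq (rewind i) q)) \<tau> (Suc (2 * h + 4 + T)) \<tau>'"
    by (intro runs_Branch) (use assms in \<open>auto split: if_splits\<close>)
  then show ?thesis by (rule runs_mono) simp
qed

lemma runs_compile_test:
  assumes "bounded w \<sigma>" "runs (if eval w t \<sigma> then p else q) (tapes_of w \<sigma> \<rho>) T \<tau>'"
  shows "runs (compile_test t p q) (tapes_of w \<sigma> \<rho>) (test_cost t (bound w) + T) \<tau>'"
  using assms(2)
proof (induction t arbitrary: p q T)
  case (Less r s)
  define x y B where "x = reg \<sigma> r" and "y = reg \<sigma> s" and "B = bound w"
  have xy: "x \<le> B" "y \<le> B" using assms(1) by (auto simp: bounded_def x_def y_def B_def)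
  show ?case
  proof (cases "r = s")
    case True
    then show ?thesis using Less by (auto intro: runs_mono)
  next
    case False
    let ?r = "reg_tape r" and ?s = "reg_tape s"
    let ?\<tau> = "\<lambda>j. (tapes_of w \<sigma> \<rho>)(?r := (unary x, int j), ?s := (unary y, int j))"
    \<comment> \<open>Both heads advance together until the number on tape \<open>?r\<close> is
      exhausted; \<open>x < y\<close> holds iff the other head then still reads a 2.\<close>
    have "runs (While ?r (\<lambda>x. x = 2) (TSeq (Move ?r MoveR) (Move ?s MoveR))) (?\<tau> 0) (x * (2 + 1) + 1) (?\<tau> x)"
    proof (rule runs_While[where \<tau> = ?\<tau>])
      fix j assume j: "j < x"
      then show "under_head (?\<tau> j) ?r = 2" using False by simp
      show "runs (TSeq (Move ?r MoveR) (Move ?s MoveR)) (?\<tau> j) 2 (?\<tau> (Suc j))"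
        by (rule runs_post[OF runs_TSeq[OF runs_Move runs_Move]]) (use False in \<open>auto simp: fun_eq_iff\<close>)
    qed (use False in simp)
    moreover have "?\<tau> 0 = tapes_of w \<sigma> \<rho>"
      by (auto simp: fun_eq_iff x_def y_def)
    moreover have "runs (Branch ?s (\<lambda>x. x = 2) (TSeq (rewind ?r) (TSeq (rewind ?s) p)) (TSeq (rewind ?r) (TSeq (rewind ?s) q)))
       (?\<tau> x) (Suc ((2 * x + 4) + ((2 * x + 4) + T))) \<tau>'"
    proof (rule runs_Branch)
      have "(tapes_of w \<sigma> \<rho>)(?r := (unary x, 0), ?s := (unary y, 0)) = tapes_of w \<sigma> \<rho>"
        by (auto simp: fun_eq_iff x_def y_def)
      then have "runs (TSeq (rewind ?r) (TSeq (rewind ?s) (if x < y then p else q))) (?\<tau> x) ((2 * x + 4) + ((2 * x + 4) + T)) \<tau>'"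
        using Less False
        by (intro runs_TSeq[OF runs_rewind_unary[where v = x]] runs_TSeq[OF runs_rewind_unary[where v = y]])
           (auto simp: x_def y_def fun_upd_twist)
      then show "runs (if under_head (?\<tau> x) ?s = 2 then TSeq (rewind ?r) (TSeq (rewind ?s) p) else TSeq (rewind ?r) (TSeq (rewind ?s) q))
         (?\<tau> x) ((2 * x + 4) + ((2 * x + 4) + T)) \<tau>'"
        by (auto split: if_splits)
    qed
    ultimately have "runs (compile_test (Less r s) p q) (tapes_of w \<sigma> \<rho>) ((x * (2 + 1) + 1) + Suc ((2 * x + 4) + ((2 * x + 4) + T))) \<tau>'"
      using False runs_TSeq by fastforce
    moreover have "(x * (2 + 1) + 1) + Suc ((2 * x + 4) + ((2 * x + 4))) \<le> prim_cost B"
      using xy by (intro linear_le_prim_cost) simp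
    ultimately show ?thesis by (elim runs_mono) (simp add: B_def)
  qed
next
  case (Pos r)
  have "1 \<le> prim_cost (bound w)" by (rule linear_le_prim_cost) simp
  moreover have "runs (Branch (reg_tape r) (\<lambda>x. x = 2) p q) (tapes_of w \<sigma> \<rho>) (Suc T) \<tau>'"
    using Pos by (intro runs_Branch) (auto split: if_splits)
  ultimately show ?case unfolding compile_test.simps test_cost.simps by (elim runs_mono) simp
next
  case (Bit a r s)
  define x y B where "x = reg \<sigma> r" and "y = reg \<sigma> s" and "B = bound w"
  have xy: "x \<le> B" "y \<le> B" using assms(1) by (auto simp: bounded_def x_def y_def B_def)
  have "runs (compile_test (Bit a r s) p q) (tapes_of w \<sigma> \<rho>)
    ((5 * (B + 1) * (B + 1) + 20 * B + 20) + (2 * (x * Suc B + y) + 5 + T)) \<tau>'"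
    unfolding compile_test.simps
  proof (rule runs_TSeq)
    let ?a = "arr_tape a" and ?c = "bits B (arr \<sigma> a)"
    show "runs (seek ?a (reg_tape r) (reg_tape s)) (tapes_of w \<sigma> \<rho>) (5 * (B + 1) * (B + 1) + 20 * B + 20)
       ((tapes_of w \<sigma> \<rho>)(?a := (?c, int (x * Suc B + y))))"
      by (rule runs_seek) (use xy in \<open>auto simp: x_def y_def B_def\<close>)
    show "runs (Branch ?a (\<lambda>x. x = 2) (TSeq (rewind ?a) p) (TSeq (rewind ?a) q))
       ((tapes_of w \<sigma> \<rho>)(?a := (?c, int (x * Suc B + y)))) (2 * (x * Suc B + y) + 5 + T) \<tau>'"
    proof (rule runs_Branch_rewind)
      show "runs (if eval w (Bit a r s) \<sigma> then p else q)
         ((tapes_of w \<sigma> \<rho>)(?a := (?c, int (x * Suc B + y)), ?a := (?c, 0))) T \<tau>'"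
        by (rule runs_eq[OF Bit]) (auto simp: fun_eq_iff B_def)
      show "eval w (Bit a r s) \<sigma> = (?c (int (x * Suc B + y)) = 2)"
        unfolding bits_simps(2)[OF xy(2)] by (simp add: x_def y_def)
    qed (simp_all add: bits_simps(1,3))
  qed
  moreover have "(5 * (B + 1) * (B + 1) + 20 * B + 20) + (2 * (x * Suc B + y) + 5) \<le> prim_cost B"
    using mult_right_mono[OF xy(1), of "Suc B"] xy(2) by (simp add: prim_cost_def algebra_simps)
  ultimately show ?case by (elim runs_mono) (simp add: B_def)
next
  case (Input r k)
  define x B where "x = reg \<sigma> r" and "B = bound w"
  have x: "x \<le> B" using assms(1) by (auto simp: bounded_def x_def B_def)
  have "runs (compile_test (Input r k) p q) (tapes_of w \<sigma> \<rho>) ((x * 5 + 5) + (2 * x + 5 + T)) \<tau>'"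
    unfolding compile_test.simps
  proof (rule runs_TSeq)
    let ?c = "(contents w)(-1 := 3)"
    show "runs (along (reg_tape r) (Move 0 MoveR)) (tapes_of w \<sigma> \<rho>) (x * 5 + 5)
       ((tapes_of w \<sigma> \<rho>)(0 := (?c, int x)))"
      by (rule runs_post[OF runs_walk[where v = x and c = ?c and h = 0]]) (auto simp: x_def)
    show "runs (Branch 0 (\<lambda>x. x = k) (TSeq (rewind 0) p) (TSeq (rewind 0) q))
       ((tapes_of w \<sigma> \<rho>)(0 := (?c, int x))) (2 * x + 5 + T) \<tau>'"
    proof (rule runs_Branch_rewind)
      show "runs (if eval w (Input r k) \<sigma> then p else q)
         ((tapes_of w \<sigma> \<rho>)(0 := (?c, int x), 0 := (?c, 0))) T \<tau>'"
        by (rule runs_eq[OF Input]) (auto simp: fun_eq_iff)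
    qed (auto simp: x_def contents_def)
  qed
  moreover have "(x * 5 + 5) + (2 * x + 5) \<le> prim_cost B"
    using x by (intro linear_le_prim_cost) simp
  ultimately show ?case by (elim runs_mono) (simp add: B_def)
next
  case (TNot t)
  then show ?case by (auto split: if_splits)
next
  case (TAnd t u)
  have "runs (compile_test t (compile_test u p q) q) (tapes_of w \<sigma> \<rho>) (test_cost t (bound w) + (test_cost u (bound w) + T)) \<tau>'"
  proof (rule TAnd.IH(1))
    show "runs (if eval w t \<sigma> then compile_test u p q else q) (tapes_of w \<sigma> \<rho>) (test_cost u (bound w) + T) \<tau>'"
    proof (cases "eval w t \<sigma>")
      case True
      then show ?thesis using TAnd.IH(2) TAnd.prems by simp
    next
      case False
      then show ?thesis using TAnd.prems by (auto intro: runs_mono)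
    qed
  qed
  then show ?case by (simp add: add.assoc)
qed

text \<open>The parameter \<open>d\<close> is the nesting depth of loops. \<open>Repeat\<close>
  copies its count to the auxiliary tape \<open>d\<close>, so the body may change the register;
  \<open>Inc\<close> walks along the register and tape 2 simultaneously to notice
  saturation.\<close>

primrec compile :: "nat \<Rightarrow> prog \<Rightarrow> tprog" where
  "compile d Skip = Move 0 Stay"
| "compile d (Zero r) = erase (reg_tape r)"
| "compile d (Inc r) =
     TSeq (While (reg_tape r) (\<lambda>x. x = 2) (TSeq (Move (reg_tape r) MoveR) (Move 2 MoveR)))
     (TSeq (Branch 2 (\<lambda>x. x = 2) (Write (reg_tape r) 2) (Move 2 Stay))
     (TSeq (rewind (reg_tape r)) (rewind 2)))"
| "compile d (Copy r s) =
     (if r = s then Move 0 Stay else TSeq (erase (reg_tape r)) (duplicate (reg_tape s) (reg_tape r)))"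
| "compile d (Top r) = TSeq (erase (reg_tape r)) (duplicate 2 (reg_tape r))"
| "compile d (Put a r s b) = TSeq (seek (arr_tape a) (reg_tape r) (reg_tape s))
     (TSeq (Write (arr_tape a) (if b then 2 else 0)) (rewind (arr_tape a)))"
| "compile d (Emit b) = TSeq (Write (Suc 0) (if b then 2 else 1)) (Move (Suc 0) MoveR)"
| "compile d (p ;; q) = TSeq (compile d p) (compile d q)"
| "compile d (Cond t p q) = compile_test t (compile d p) (compile d q)"
| "compile d (Repeat r p) = TSeq (duplicate (reg_tape r) (aux_tape d))
     (TSeq (along (aux_tape d) (compile (Suc d) p)) (erase (aux_tape d)))"

text \<open>The input enters through the bound \<open>B\<close> only: both branches of
  \<open>Cond\<close> are paid for, and each loop is charged \<open>B\<close> rounds with 4 steps of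
  overhead from \<open>along\<close>.\<close>

primrec cost :: "prog \<Rightarrow> nat \<Rightarrow> nat" where
  "cost Skip B = prim_cost B"
| "cost (Zero r) B = prim_cost B"
| "cost (Inc r) B = prim_cost B"
| "cost (Copy r s) B = prim_cost B"
| "cost (Top r) B = prim_cost B"
| "cost (Put a r s b) B = prim_cost B"
| "cost (Emit b) B = prim_cost B"
| "cost (p ;; q) B = cost p B + cost q B"
| "cost (Cond t p q) B = test_cost t B + (cost p B + cost q B)"
| "cost (Repeat r p) B = B * (cost p B + 4) + prim_cost B"

lemma contents_snoc: "(contents x)(int (length x) := if b then 2 else 1) = contents (x @ [b])"
proof
  fix j
  show "((contents x)(int (length x) := if b then 2 else 1)) j = contents (x @ [b]) j"
  proof (cases "j < 0")
    case True
    then have "j \<noteq> int (length x)" by linarith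
    with True show ?thesis by (simp add: contents_def)
  next
    case False
    then obtain n where "j = int n" using nonneg_int_cases[of j] by auto
    then show ?thesis by (auto simp: contents_def nth_append)
  qed
qed

lemma runs_Inc:
  assumes "bounded w \<sigma>"
  shows "runs (compile d (Inc r)) (tapes_of w \<sigma> \<rho>) (prim_cost (bound w)) (tapes_of w (exec w (Inc r) \<sigma>) \<rho>)"
proof -
  define x B where "x = reg \<sigma> r" and "B = bound w"
  have x: "x \<le> B" using assms by (auto simp: bounded_def x_def B_def)
  let ?r = "reg_tape r"
  let ?\<tau> = "\<lambda>j. (tapes_of w \<sigma> \<rho>)(?r := (unary x, int j), 2 := (unary B, int j))"
  let ?\<tau>' = "(tapes_of w \<sigma> \<rho>)(?r := (unary (min B (Suc x)), int x), 2 := (unary B, int x))"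
  have "runs (While ?r (\<lambda>x. x = 2) (TSeq (Move ?r MoveR) (Move 2 MoveR))) (?\<tau> 0) (x * (2 + 1) + 1) (?\<tau> x)"
  proof (rule runs_While[where \<tau> = ?\<tau>])
    fix j assume j: "j < x"
    then show "under_head (?\<tau> j) ?r = 2" by simp
    show "runs (TSeq (Move ?r MoveR) (Move 2 MoveR)) (?\<tau> j) 2 (?\<tau> (Suc j))"
      by (rule runs_post[OF runs_TSeq[OF runs_Move runs_Move]]) (auto simp: fun_eq_iff)
  qed simp
  moreover have "?\<tau> 0 = tapes_of w \<sigma> \<rho>"
    by (auto simp: fun_eq_iff x_def B_def)
  ultimately have 1: "runs (While ?r (\<lambda>x. x = 2) (TSeq (Move ?r MoveR) (Move 2 MoveR)))
      (tapes_of w \<sigma> \<rho>) (x * (2 + 1) + 1) (?\<tau> x)"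
    by simp
  \<comment> \<open>The head of tape 2 stands on cell \<open>x\<close>, which carries a 2 iff
    \<open>x < B\<close>.\<close>
  have 2: "runs (Branch 2 (\<lambda>x. x = 2) (Write ?r 2) (Move 2 Stay)) (?\<tau> x) (Suc 1) ?\<tau>'"
  proof (rule runs_Branch, cases "x < B")
    case True
    then show "runs (if under_head (?\<tau> x) 2 = 2 then Write ?r 2 else Move 2 Stay) (?\<tau> x) 1 ?\<tau>'"
      by (auto intro!: runs_post[OF runs_Write] simp: fun_eq_iff unary_def)
  next
    case False
    with x have "x = B" by simp
    then show "runs (if under_head (?\<tau> x) 2 = 2 then Write ?r 2 else Move 2 Stay) (?\<tau> x) 1 ?\<tau>'"
      by (auto intro!: runs_post[OF runs_Move] simp: fun_eq_iff unary_def)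
  qed
  have 3: "runs (TSeq (rewind ?r) (rewind 2)) ?\<tau>' ((2 * x + 4) + (2 * x + 4)) (tapes_of w (exec w (Inc r) \<sigma>) \<rho>)"
    by (rule runs_post[OF runs_TSeq[OF runs_rewind_unary[where v = "min B (Suc x)"] runs_rewind_unary[where v = B]]])
      (auto simp: fun_eq_iff tapes_of_set_reg x_def B_def)
  have "(x * (2 + 1) + 1) + (Suc 1 + ((2 * x + 4) + (2 * x + 4))) \<le> prim_cost B"
    using x by (intro linear_le_prim_cost) simp
  then show ?thesis
    unfolding compile.simps B_def[symmetric] using runs_TSeq[OF 1 runs_TSeq[OF 2 3]] by (elim runs_mono)
qed

lemma runs_reset:
  assumes "\<tau> i = (unary u, 0)" "\<tau> j = (unary v, 0)" "i \<noteq> j" "u \<le> B" "v \<le> B"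
  shows "runs (TSeq (erase i) (duplicate j i)) \<tau> (prim_cost B) (\<tau>(i := (unary v, 0)))"
proof -
  have "runs (TSeq (erase i) (duplicate j i)) \<tau> ((u * 5 + 5) + (v * 8 + 9)) (\<tau>(i := (unary v, 0)))"
    by (rule runs_post[OF runs_TSeq[OF runs_erase[where v = u] runs_duplicate[where v = v]]]) (use assms in auto)
  moreover have "(u * 5 + 5) + (v * 8 + 9) \<le> prim_cost B"
    using assms by (intro linear_le_prim_cost) simp
  ultimately show ?thesis by (rule runs_mono)
qed

lemma runs_Put:
  assumes "bounded w \<sigma>"
  shows "runs (compile d (Put a r s b)) (tapes_of w \<sigma> \<rho>) (prim_cost (bound w)) (tapes_of w (exec w (Put a r s b) \<sigma>) \<rho>)"
proof -
  define x y B where "x = reg \<sigma> r" and "y = reg \<sigma> s" and "B = bound w"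
  have xy: "x \<le> B" "y \<le> B" using assms(1) by (auto simp: bounded_def x_def y_def B_def)
  let ?a = "arr_tape a" and ?c = "bits B (arr \<sigma> a)"
  let ?c' = "bits B ((arr \<sigma> a)(x := (arr \<sigma> a x)(y := b)))"
  have 1: "runs (seek ?a (reg_tape r) (reg_tape s)) (tapes_of w \<sigma> \<rho>) (5 * (B + 1) * (B + 1) + 20 * B + 20)
       ((tapes_of w \<sigma> \<rho>)(?a := (?c, int (x * Suc B + y))))"
    by (rule runs_seek) (use xy in \<open>auto simp: x_def y_def B_def\<close>)
  have 2: "runs (Write ?a (if b then 2 else 0)) ((tapes_of w \<sigma> \<rho>)(?a := (?c, int (x * Suc B + y)))) 1
       ((tapes_of w \<sigma> \<rho>)(?a := (?c', int (x * Suc B + y))))"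
    by (rule runs_post[OF runs_Write]) (simp_all add: bits_upd[OF xy(2)] del: mult_Suc_right of_nat_add)
  have 3: "runs (rewind ?a) ((tapes_of w \<sigma> \<rho>)(?a := (?c', int (x * Suc B + y)))) (2 * (x * Suc B + y) + 4)
       (tapes_of w (exec w (Put a r s b) \<sigma>) \<rho>)"
    by (rule runs_post[OF runs_rewind[where c = ?c' and h = "x * Suc B + y"]])
      (simp_all add: bits_simps(1,3) tapes_of_set_arr x_def y_def B_def)
  have "(5 * (B + 1) * (B + 1) + 20 * B + 20) + (1 + (2 * (x * Suc B + y) + 4)) \<le> prim_cost B"
    using mult_right_mono[OF xy(1), of "Suc B"] xy(2) by (simp add: prim_cost_def algebra_simps)
  then show ?thesis
    unfolding compile.simps B_def[symmetric] using runs_TSeq[OF 1 runs_TSeq[OF 2 3]] by (elim runs_mono)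
qed

text \<open>The auxiliary tapes from depth \<open>d\<close> on are empty before and after, so every
  loop finds a clean counter tape however often it is entered.\<close>

lemma runs_compile:
  assumes "bounded w \<sigma>" "\<And>k. d \<le> k \<Longrightarrow> \<rho> k = (unary 0, 0)"
  shows "runs (compile d p) (tapes_of w \<sigma> \<rho>) (cost p (bound w)) (tapes_of w (exec w p \<sigma>) \<rho>)"
  using assms
proof (induction p arbitrary: d \<sigma> \<rho>)
  case Skip
  have "1 \<le> prim_cost (bound w)" by (rule linear_le_prim_cost) simp
  then show ?case by (auto intro!: runs_post[OF runs_Move] simp: fun_eq_iff)
next
  case (Zero r)
  have "reg \<sigma> r * 5 + 5 \<le> prim_cost (bound w)"
    using Zero.prems(1)[unfolded bounded_def, THEN spec, of r] by (intro linear_le_prim_cost) simp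
  then show ?case by (auto intro!: runs_post[OF runs_erase] simp: tapes_of_set_reg)
next
  case (Inc r)
  then show ?case using runs_Inc by simp
next
  case (Copy r s)
  have "1 \<le> prim_cost (bound w)" by (rule linear_le_prim_cost) simp
  then have "runs (Move 0 Stay) (tapes_of w \<sigma> \<rho>) (prim_cost (bound w)) (tapes_of w (set_reg r (reg \<sigma> r) \<sigma>) \<rho>)"
    by (auto intro!: runs_post[OF runs_Move] simp: fun_eq_iff set_reg_def)
  moreover have "runs (TSeq (erase (reg_tape r)) (duplicate (reg_tape s) (reg_tape r))) (tapes_of w \<sigma> \<rho>)
      (prim_cost (bound w)) (tapes_of w (set_reg r (reg \<sigma> s) \<sigma>) \<rho>)" if "r \<noteq> s"
    unfolding tapes_of_set_reg
    by (rule runs_reset[where u = "reg \<sigma> r"]) (use Copy.prems(1) that in \<open>auto simp: bounded_def\<close>)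
  ultimately show ?case by (cases "r = s") simp_all
next
  case (Top r)
  have "runs (TSeq (erase (reg_tape r)) (duplicate 2 (reg_tape r))) (tapes_of w \<sigma> \<rho>)
      (prim_cost (bound w)) (tapes_of w (set_reg r (bound w) \<sigma>) \<rho>)"
    unfolding tapes_of_set_reg
    by (rule runs_reset[where u = "reg \<sigma> r"]) (use Top.prems(1) in \<open>auto simp: bounded_def\<close>)
  then show ?case by simp
next
  case (Put a r s b)
  then show ?case using runs_Put by simp
next
  case (Emit b)
  have "2 \<le> prim_cost (bound w)" by (rule linear_le_prim_cost) simp
  then show ?case
    by (auto intro!: runs_post[OF runs_TSeq[OF runs_Write runs_Move]] simp: tapes_of_outp contents_snoc[symmetric])
next
  case (Seq p q)
  then show ?case by (simp add: runs_TSeq[OF Seq.IH(1) Seq.IH(2)] bounded_exec)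
next
  case (Cond t p q)
  have "runs (if eval w t \<sigma> then compile d p else compile d q) (tapes_of w \<sigma> \<rho>)
      (cost p (bound w) + cost q (bound w)) (tapes_of w (exec w (Cond t p q) \<sigma>) \<rho>)"
  proof (cases "eval w t \<sigma>")
    case True
    have "runs (compile d p) (tapes_of w \<sigma> \<rho>) (cost p (bound w)) (tapes_of w (exec w p \<sigma>) \<rho>)"
      by (rule Cond.IH) (use Cond.prems in auto)
    with True show ?thesis by (auto elim: runs_mono)
  next
    case False
    have "runs (compile d q) (tapes_of w \<sigma> \<rho>) (cost q (bound w)) (tapes_of w (exec w q \<sigma>) \<rho>)"
      by (rule Cond.IH) (use Cond.prems in auto)
    with False show ?thesis by (auto elim: runs_mono)
  qed
  then show ?case using runs_compile_test[OF Cond.prems(1)] by simp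
next
  case (Repeat r p)
  define v where "v = reg \<sigma> r"
  have v: "v \<le> bound w" using Repeat.prems(1) by (simp add: bounded_def v_def)
  let ?\<rho> = "\<lambda>j. \<rho>(d := (unary v, int j))"
  let ?\<sigma> = "\<lambda>j. (exec w p ^^ j) \<sigma>"
  let ?\<tau> = "\<lambda>j. tapes_of w (?\<sigma> j) (?\<rho> 0)"
  have 1: "runs (duplicate (reg_tape r) (aux_tape d)) (tapes_of w \<sigma> \<rho>) (v * 8 + 9) (?\<tau> 0)"
    by (rule runs_post[OF runs_duplicate[where v = v]])
       (use Repeat.prems(2) in \<open>auto simp: v_def tapes_of_aux\<close>)
  have 2: "runs (along (aux_tape d) (compile (Suc d) p)) (?\<tau> 0) (v * (cost p (bound w) + 4) + 5) (?\<tau> v)"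
  proof (rule runs_along[where \<tau> = ?\<tau>])
    fix j assume "j < v"
    \<comment> \<open>The running counter is regarded as part of \<open>\<rho>\<close>. The body is
      compiled for depth \<open>Suc d\<close> and assumes emptiness only from there on.\<close>
    have upd: "(tapes_of w s (?\<rho> 0))(aux_tape d := (unary v, int j)) = tapes_of w s (?\<rho> j)" for s
      by (simp add: tapes_of_aux)
    show "runs (compile (Suc d) p) ((?\<tau> j)(aux_tape d := (unary v, int j))) (cost p (bound w))
       ((?\<tau> (Suc j))(aux_tape d := (unary v, int j)))"
      unfolding upd funpow.simps o_apply
      by (rule Repeat.IH) (use Repeat.prems in \<open>auto intro: bounded_funpow bounded_exec\<close>)
  qed simp
  have 3: "runs (erase (aux_tape d)) (?\<tau> v) (v * 5 + 5) (tapes_of w (exec w (Repeat r p) \<sigma>) \<rho>)"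
    by (rule runs_post[OF runs_erase[where v = v]])
       (use Repeat.prems(2)[of d] in \<open>auto simp: v_def tapes_of_aux fun_eq_iff\<close>)
  have "(v * 8 + 9) + ((v * (cost p (bound w) + 4) + 5) + (v * 5 + 5))
      \<le> bound w * (cost p (bound w) + 4) + prim_cost (bound w)"
    using mult_right_mono[OF v, of "cost p (bound w) + 4"]
      linear_le_prim_cost[of "13 * v + 19" "bound w"] v by linarith
  with runs_TSeq[OF 1 runs_TSeq[OF 2 3]] show ?case
    unfolding compile.simps cost.simps by (rule runs_mono)
qed

lemma cost_poly: "\<exists>T :: nat poly. \<forall>B. poly T B = cost p B"
proof -
  let ?P = "[:100, 200, 100:] :: nat poly"
  have P: "poly ?P B = prim_cost B" for B by (simp add: prim_cost_def algebra_simps)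
  then have ex: "\<exists>T :: nat poly. \<forall>B. poly T B = prim_cost B" by blast
  have test: "\<exists>T :: nat poly. \<forall>B. poly T B = test_cost t B" for t
  proof (induction t)
    case (TAnd t u)
    then obtain T U :: "nat poly" where "\<forall>B. poly T B = test_cost t B" "\<forall>B. poly U B = test_cost u B" by blast
    then show ?case by (intro exI[of _ "T + U"]) simp
  qed (use ex in auto)
  show ?thesis
  proof (induction p)
    case (Seq p q)
    then obtain T U :: "nat poly" where "\<forall>B. poly T B = cost p B" "\<forall>B. poly U B = cost q B" by blast
    then show ?case by (intro exI[of _ "T + U"]) simp
  next
    case (Cond t p q)
    then obtain T U :: "nat poly" where "\<forall>B. poly T B = cost p B" "\<forall>B. poly U B = cost q B" by blast
    moreover obtain V :: "nat poly" where "\<forall>B. poly V B = test_cost t B" using test by blast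
    ultimately show ?case by (intro exI[of _ "V + (T + U)"]) simp
  next
    case (Repeat r p)
    then obtain T :: "nat poly" where "\<forall>B. poly T B = cost p B" by blast
    then show ?case by (intro exI[of _ "[:0, 1:] * (T + [:4:]) + ?P"]) (simp add: P[symmetric] algebra_simps)
  qed (use ex in auto)
qed

text \<open>Tape 1 stays unmarked because its final contents must equal
  \<open>contents (f w)\<close> in every cell, including cell -1.\<close>

primrec mark_tapes :: "nat \<Rightarrow> tprog" where
  "mark_tapes 0 = Move 0 Stay"
| "mark_tapes (Suc k) = TSeq (mark_tapes k)
    (if k = 1 then Move 0 Stay else TSeq (Move k MoveL) (TSeq (Write k 3) (Move k MoveR)))"

lemma runs_mark_tapes:
  assumes "\<And>i. snd (\<tau> i) = 0"
  shows "runs (mark_tapes k) \<tau> (3 * k + 1)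
    (\<lambda>i. if i < k \<and> i \<noteq> 1 then ((fst (\<tau> i))(-1 := 3), 0) else \<tau> i)"
proof (induction k)
  case 0
  show ?case by (auto intro!: runs_post[OF runs_Move] simp: fun_eq_iff prod_eq_iff)
next
  case (Suc k)
  let ?\<tau> = "\<lambda>k i. if i < k \<and> i \<noteq> 1 then ((fst (\<tau> i))(-1 := 3), 0) else \<tau> i"
  have "runs (if k = 1 then Move 0 Stay else TSeq (Move k MoveL) (TSeq (Write k 3) (Move k MoveR))) (?\<tau> k) 3 (?\<tau> (Suc k))"
  proof (cases "k = 1")
    case True
    then show ?thesis
      by (auto intro!: runs_post[OF runs_Move] simp: fun_eq_iff prod_eq_iff less_Suc_eq)
  next
    case False
    have "runs (TSeq (Move k MoveL) (TSeq (Write k 3) (Move k MoveR))) (?\<tau> k) (1 + (1 + 1)) (?\<tau> (Suc k))"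
      by (rule runs_post[OF runs_TSeq[OF runs_Move runs_TSeq[OF runs_Write runs_Move]]])
        (use assms False in \<open>auto simp: fun_eq_iff prod_eq_iff less_Suc_eq\<close>)
    then show ?thesis using False by (simp add: numeral_3_eq_3)
  qed
  from runs_TSeq[OF Suc this] show ?case
    unfolding mark_tapes.simps by (rule runs_mono) simp
qed

definition extend_bound :: tprog where
  "extend_bound = TSeq (Write 2 2) (Move 2 MoveR)"

lemma runs_extend:
  "\<tau> 2 = (unary n, int n) \<Longrightarrow> runs extend_bound \<tau> 2 (\<tau>(2 := (unary (Suc n), int (Suc n))))"
  unfolding extend_bound_def
  by (rule runs_post[OF runs_TSeq[OF runs_Write runs_Move]]) (auto simp: fun_eq_iff unary_def)

lemma runs_extend_iter:
  "\<tau> 2 = (unary n, int n) \<Longrightarrow> runs ((TSeq extend_bound ^^ k) (Move 0 Stay)) \<tau> (2 * k + 1) (\<tau>(2 := (unary (n + k), int (n + k))))"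
proof (induction k arbitrary: \<tau> n)
  case 0
  then show ?case by (auto intro!: runs_post[OF runs_Move] simp: fun_eq_iff)
next
  case (Suc k)
  have "runs (TSeq extend_bound ((TSeq extend_bound ^^ k) (Move 0 Stay))) \<tau> (2 + (2 * k + 1))
     (\<tau>(2 := (unary (Suc n), int (Suc n)), 2 := (unary (Suc n + k), int (Suc n + k))))"
    using Suc.prems by (intro runs_TSeq[OF runs_extend Suc.IH]) auto
  then show ?case unfolding funpow.simps o_apply by (rule runs_post) (auto simp: fun_eq_iff)
qed

text \<open>Scanning the input up to its first blank writes \<open>length w\<close> in unary on tape
  2, and eight more cells complete \<open>bound w\<close>.\<close>

definition prepare :: "nat \<Rightarrow> tprog" where
  "prepare K = TSeq (mark_tapes K) (TSeq (While 0 (\<lambda>x. x \<noteq> 0) (TSeq extend_bound (Move 0 MoveR)))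
     (TSeq ((TSeq extend_bound ^^ 8) (Move 0 Stay)) (TSeq (rewind 0) (rewind 2))))"

definition init_store :: store where
  "init_store = \<lparr>reg = \<lambda>_. 0, arr = \<lambda>_ _ _. False, outp = []\<rparr>"

text \<open>The tapes from \<open>K\<close> on do not exist in the machine. They are given the mark
  here because \<open>mark_tapes K\<close> does not reach them.\<close>

definition blank_tapes :: "bool list \<Rightarrow> nat \<Rightarrow> nat \<Rightarrow> tape" where
  "blank_tapes w K i = (if i < K then init_tapes w i else (unary 0, 0))"

lemma unary_0: "(contents [])(-1 := 3) = unary 0"
  by (auto simp: fun_eq_iff contents_def unary_def)

lemma bits_empty: "bits B (\<lambda>_ _. False) = unary 0"
  by (auto simp: fun_eq_iff bits_def unary_def)

lemma runs_prepare:
  assumes "3 \<le> K"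
  shows "runs (prepare K) (blank_tapes w K) (3 * K + 8 * length w + 100)
    (tapes_of w init_store (\<lambda>_. (unary 0, 0)))"
proof -
  define N where "N = length w"
  let ?m = "\<lambda>i. if i < K \<and> i \<noteq> 1 then ((fst (blank_tapes w K i))(-1 := 3), 0) else blank_tapes w K i"
  let ?c = "(contents w)(-1 := 3)"
  let ?f = "tapes_of w init_store (\<lambda>_. (unary 0, 0))"
  let ?\<tau> = "\<lambda>j. ?f(0 := (?c, int j), 2 := (unary j, int j))"
  have m: "?m = ?\<tau> 0"
  proof
    fix i
    show "?m i = ?\<tau> 0 i"
      by (cases i rule: tape_cases)
        (use assms in \<open>auto simp: blank_tapes_def init_tapes_def unary_0 init_store_def bits_empty\<close>)
  qed
  have 1: "runs (mark_tapes K) (blank_tapes w K) (3 * K + 1) (?\<tau> 0)"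
    unfolding m[symmetric] by (rule runs_mark_tapes) (simp add: blank_tapes_def init_tapes_def)
  have 2: "runs (While 0 (\<lambda>x. x \<noteq> 0) (TSeq extend_bound (Move 0 MoveR))) (?\<tau> 0) (N * (3 + 1) + 1) (?\<tau> N)"
  proof (rule runs_While[where \<tau> = ?\<tau>])
    fix j assume "j < N"
    then show "under_head (?\<tau> j) 0 \<noteq> 0" by (simp add: contents_def N_def)
    show "runs (TSeq extend_bound (Move 0 MoveR)) (?\<tau> j) 3 (?\<tau> (Suc j))"
      by (rule runs_post[OF runs_TSeq[OF runs_extend[where n = j] runs_Move]]) (auto simp: fun_eq_iff)
  qed (simp add: contents_def N_def)
  let ?\<tau>' = "(?\<tau> N)(2 := (unary (N + 8), int (N + 8)))"
  have 3: "runs ((TSeq extend_bound ^^ 8) (Move 0 Stay)) (?\<tau> N) (2 * 8 + 1) ?\<tau>'"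
    by (rule runs_extend_iter) simp
  have 4: "runs (TSeq (rewind 0) (rewind 2)) ?\<tau>' ((2 * N + 4) + (2 * (N + 8) + 4)) ?f"
    by (rule runs_post[OF runs_TSeq[OF runs_rewind[where c = ?c and h = N] runs_rewind_unary[where v = "N + 8" and h = "N + 8"]]])
      (auto simp: fun_eq_iff contents_def N_def bound_def)
  show ?thesis unfolding prepare_def
    by (rule runs_mono[OF runs_TSeq[OF 1 runs_TSeq[OF 2 runs_TSeq[OF 3 4]]]]) (simp add: N_def)
qed

theorem polytime_exec: "polytime_computable (\<lambda>w. outp (exec w p init_store))"
proof -
  define K\<^sub>0 S\<^sub>0 where "K\<^sub>0 = (SOME K. \<exists>S. wf_tprog K S (compile 0 p))" and "S\<^sub>0 = (SOME S. wf_tprog K\<^sub>0 S (compile 0 p))"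
  have wf0: "wf_tprog K\<^sub>0 S\<^sub>0 (compile 0 p)"
    unfolding S\<^sub>0_def by (rule someI_ex, unfold K\<^sub>0_def, rule someI_ex, rule wf_tprog_ex)
  \<comment> \<open>Whatever \<open>p\<close> is, the tapes 0, 1, 2 and the symbols 0 to 3 must be
    available to \<open>prepare\<close>.\<close>
  define K S where "K = max 3 K\<^sub>0" and "S = max 4 S\<^sub>0"
  have marks: "wf_tprog K S (mark_tapes k)" if "k \<le> K" for k
    using that by (induction k) (auto simp: K_def S_def)
  have "wf_tprog K S ((TSeq extend_bound ^^ k) (Move 0 Stay))" for k
    by (induction k) (auto simp: K_def S_def extend_bound_def)
  then have wf: "wf_tprog K S (TSeq (prepare K) (compile 0 p))"
    using wf_tprog_mono[OF wf0, of K S] marks[of K]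
    by (auto simp: prepare_def K_def S_def extend_bound_def rewind_def)
  obtain T :: "nat poly" where T: "\<And>B. poly T B = cost p B" using cost_poly by blast
  show ?thesis
  proof (rule polytime_computableI[OF wf, where T = "[:3 * K + 100, 8:] + pcompose T [:8, 1:]"])
    fix w
    let ?\<tau> = "tapes_of w (exec w p init_store) (\<lambda>_. (unary 0, 0))"
    have "runs (compile 0 p) (tapes_of w init_store (\<lambda>_. (unary 0, 0))) (cost p (bound w)) ?\<tau>"
      by (rule runs_compile) (auto simp: bounded_def init_store_def)
    with runs_prepare have "runs (TSeq (prepare K) (compile 0 p)) (blank_tapes w K)
       ((3 * K + 8 * length w + 100) + cost p (bound w)) ?\<tau>"
      by (rule runs_TSeq) (simp add: K_def)
    then have "runs (TSeq (prepare K) (compile 0 p)) (blank_tapes w K)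
       (poly ([:3 * K + 100, 8:] + pcompose T [:8, 1:]) (length w)) ?\<tau>"
      by (rule runs_mono) (simp add: poly_pcompose T bound_def add.commute)
    then show "\<exists>\<tau>\<^sub>0 \<tau>. (\<forall>i<K. \<tau>\<^sub>0 i = init_tapes w i) \<and>
         runs (TSeq (prepare K) (compile 0 p)) \<tau>\<^sub>0 (poly ([:3 * K + 100, 8:] + pcompose T [:8, 1:]) (length w)) \<tau> \<and>
         fst (\<tau> 1) = contents (outp (exec w p init_store))"
      by (intro exI[of _ "blank_tapes w K"] exI[of _ ?\<tau>]) (simp add: blank_tapes_def)
  qed (auto simp: K_def S_def)
qed

subsection \<open>Reasoning about programs\<close>

lemma set_reg_simps [simp]:
  "reg (set_reg r v \<sigma>) = (reg \<sigma>)(r := v)" "arr (set_reg r v \<sigma>) = arr \<sigma>" "outp (set_reg r v \<sigma>) = outp \<sigma>"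
  by (simp_all add: set_reg_def)

lemma set_arr_simps [simp]:
  "reg (set_arr a x y b \<sigma>) = reg \<sigma>" "outp (set_arr a x y b \<sigma>) = outp \<sigma>"
  "arr (set_arr a x y b \<sigma>) = (arr \<sigma>)(a := (arr \<sigma> a)(x := (arr \<sigma> a x)(y := b)))"
  by (simp_all add: set_arr_def)

primrec mod_regs :: "prog \<Rightarrow> nat set" where
  "mod_regs Skip = {}"
| "mod_regs (Zero r) = {r}"
| "mod_regs (Inc r) = {r}"
| "mod_regs (Copy r s) = {r}"
| "mod_regs (Top r) = {r}"
| "mod_regs (Put a r s b) = {}"
| "mod_regs (Emit b) = {}"
| "mod_regs (p ;; q) = mod_regs p \<union> mod_regs q"
| "mod_regs (Cond t p q) = mod_regs p \<union> mod_regs q"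
| "mod_regs (Repeat r p) = mod_regs p"

primrec mod_arrs :: "prog \<Rightarrow> nat set" where
  "mod_arrs Skip = {}"
| "mod_arrs (Zero r) = {}"
| "mod_arrs (Inc r) = {}"
| "mod_arrs (Copy r s) = {}"
| "mod_arrs (Top r) = {}"
| "mod_arrs (Put a r s b) = {a}"
| "mod_arrs (Emit b) = {}"
| "mod_arrs (p ;; q) = mod_arrs p \<union> mod_arrs q"
| "mod_arrs (Cond t p q) = mod_arrs p \<union> mod_arrs q"
| "mod_arrs (Repeat r p) = mod_arrs p"

primrec silent :: "prog \<Rightarrow> bool" where
  "silent Skip = True"
| "silent (Zero r) = True"
| "silent (Inc r) = True"
| "silent (Copy r s) = True"
| "silent (Top r) = True"
| "silent (Put a r s b) = True"
| "silent (Emit b) = False"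
| "silent (p ;; q) = (silent p \<and> silent q)"
| "silent (Cond t p q) = (silent p \<and> silent q)"
| "silent (Repeat r p) = silent p"

lemma funpow_invariant: "(\<And>x. P x \<Longrightarrow> P (f x)) \<Longrightarrow> P x \<Longrightarrow> P ((f ^^ n) x)"
  by (induction n) auto

lemma exec_reg_frame: "r \<notin> mod_regs p \<Longrightarrow> reg (exec w p \<sigma>) r = reg \<sigma> r"
proof (induction p arbitrary: \<sigma>)
  case (Repeat s p)
  then show ?case
    using funpow_invariant[of "\<lambda>\<tau>. reg \<tau> r = reg \<sigma> r" "exec w p"] by simp
qed auto

lemma exec_arr_frame: "a \<notin> mod_arrs p \<Longrightarrow> arr (exec w p \<sigma>) a = arr \<sigma> a"
proof (induction p arbitrary: \<sigma>)
  case (Repeat s p)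
  then show ?case
    using funpow_invariant[of "\<lambda>\<tau>. arr \<tau> a = arr \<sigma> a" "exec w p"] by simp
qed auto

lemma exec_outp_frame: "silent p \<Longrightarrow> outp (exec w p \<sigma>) = outp \<sigma>"
proof (induction p arbitrary: \<sigma>)
  case (Repeat s p)
  then show ?case
    using funpow_invariant[of "\<lambda>\<tau>. outp \<tau> = outp \<sigma>" "exec w p"] by simp
qed auto

section \<open>Counting loops and unary output\<close>

definition For :: "nat \<Rightarrow> nat \<Rightarrow> prog \<Rightarrow> prog" where
  "For i r p = Zero i ;; Repeat r (p ;; Inc i)"

lemma For_simps [simp]: "mod_regs (For i r p) = insert i (mod_regs p)" "mod_arrs (For i r p) = mod_arrs p"
  "silent (For i r p) = silent p"
  by (auto simp: For_def)

text \<open>The frame facts about registers and arrays that the body does not touch are supplied by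
  the rule, so the invariant \<open>J\<close> needs to speak of modified data only. As
  \<open>k \<le> bound w\<close>, the counter never saturates.\<close>

lemma For_rule:
  assumes "reg \<sigma> r = k" "k \<le> bound w" "i \<noteq> r" "i \<notin> mod_regs p"
    and "J 0 (set_reg i 0 \<sigma>)"
    and "\<And>j \<tau>. j < k \<Longrightarrow> J j \<tau> \<Longrightarrow> reg \<tau> i = j \<Longrightarrow>
      (\<And>x. x \<notin> mod_regs p \<Longrightarrow> x \<noteq> i \<Longrightarrow> reg \<tau> x = reg \<sigma> x) \<Longrightarrow>
      (\<And>a. a \<notin> mod_arrs p \<Longrightarrow> arr \<tau> a = arr \<sigma> a) \<Longrightarrow>
      J (Suc j) (set_reg i (Suc j) (exec w p \<tau>))"
  shows "J k (exec w (For i r p) \<sigma>)"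
proof -
  define f where "f = exec w (p ;; Inc i)"
  have f: "f \<tau> = set_reg i (min (bound w) (Suc (reg (exec w p \<tau>) i))) (exec w p \<tau>)" for \<tau>
    by (simp add: f_def)
  have "j \<le> k \<Longrightarrow> J j ((f ^^ j) (set_reg i 0 \<sigma>)) \<and> reg ((f ^^ j) (set_reg i 0 \<sigma>)) i = j" for j
  proof (induction j)
    case 0
    then show ?case using assms(5) by simp
  next
    case (Suc j)
    let ?\<tau> = "(f ^^ j) (set_reg i 0 \<sigma>)"
    have "\<And>x. x \<notin> mod_regs p \<Longrightarrow> x \<noteq> i \<Longrightarrow> reg ?\<tau> x = reg \<sigma> x"
    proof -
      fix x assume "x \<notin> mod_regs p" "x \<noteq> i"
      then show "reg ?\<tau> x = reg \<sigma> x"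
        by (intro funpow_invariant[of "\<lambda>\<tau>. reg \<tau> x = reg \<sigma> x" f]) (auto simp: f exec_reg_frame)
    qed
    moreover have "\<And>a. a \<notin> mod_arrs p \<Longrightarrow> arr ?\<tau> a = arr \<sigma> a"
    proof -
      fix a assume "a \<notin> mod_arrs p"
      then show "arr ?\<tau> a = arr \<sigma> a"
        by (intro funpow_invariant[of "\<lambda>\<tau>. arr \<tau> a = arr \<sigma> a" f]) (auto simp: f exec_arr_frame)
    qed
    ultimately have "J (Suc j) (set_reg i (Suc j) (exec w p ?\<tau>))"
      using Suc by (intro assms(6)) auto
    moreover have "f ?\<tau> = set_reg i (Suc j) (exec w p ?\<tau>)"
      using Suc assms(2,4) by (simp add: f[of ?\<tau>] exec_reg_frame)
    ultimately show ?case by simp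
  qed
  from this[of k] show ?thesis using assms(1,3) by (simp add: For_def f_def)
qed

text \<open>For bodies whose output depends on the counter and on unmodified data alone; scratch
  registers may be left in any state.\<close>

lemma For_outp:
  assumes "reg \<sigma> r = k" "k \<le> bound w" "i \<noteq> r" "i \<notin> mod_regs p"
    and "\<And>j \<tau>. j < k \<Longrightarrow> reg \<tau> i = j \<Longrightarrow>
      (\<And>x. x \<notin> mod_regs p \<Longrightarrow> x \<noteq> i \<Longrightarrow> reg \<tau> x = reg \<sigma> x) \<Longrightarrow>
      (\<And>a. a \<notin> mod_arrs p \<Longrightarrow> arr \<tau> a = arr \<sigma> a) \<Longrightarrow>
      outp (exec w p \<tau>) = outp \<tau> @ f j"
  shows "outp (exec w (For i r p) \<sigma>) = outp \<sigma> @ concat (map f [0..<k])"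
  using assms(1-4) by (rule For_rule) (use assms(5) in auto)

definition emit_list :: "bool list \<Rightarrow> prog" where
  "emit_list bs = foldr (\<lambda>b p. Emit b ;; p) bs Skip"

lemma emit_list_simps [simp]: "mod_regs (emit_list bs) = {}" "mod_arrs (emit_list bs) = {}"
  "exec w (emit_list bs) \<sigma> = \<sigma>\<lparr>outp := outp \<sigma> @ bs\<rparr>"
  by (induction bs arbitrary: \<sigma>) (auto simp: emit_list_def)

definition emit_unary :: "nat \<Rightarrow> prog" where
  "emit_unary r = Repeat r (Emit True)"

lemma emit_unary_simps [simp]: "mod_regs (emit_unary r) = {}" "mod_arrs (emit_unary r) = {}"
  "exec w (emit_unary r) \<sigma> = \<sigma>\<lparr>outp := outp \<sigma> @ replicate (reg \<sigma> r) True\<rparr>"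
proof -
  have "(exec w (Emit True) ^^ n) \<sigma> = \<sigma>\<lparr>outp := outp \<sigma> @ replicate n True\<rparr>" for n
    by (induction n) (auto simp: replicate_append_same)
  then show "exec w (emit_unary r) \<sigma> = \<sigma>\<lparr>outp := outp \<sigma> @ replicate (reg \<sigma> r) True\<rparr>"
    by (simp add: emit_unary_def)
qed (auto simp: emit_unary_def)

text \<open>A product may exceed \<open>bound w\<close>, so it cannot be held in a register. Nested
  loops write it directly in unary.\<close>

definition emit_product :: "nat \<Rightarrow> nat \<Rightarrow> prog" where
  "emit_product r s = Repeat r (emit_unary s)"

lemma emit_product_simps [simp]: "mod_regs (emit_product r s) = {}" "mod_arrs (emit_product r s) = {}"
  "exec w (emit_product r s) \<sigma> = \<sigma>\<lparr>outp := outp \<sigma> @ replicate (reg \<sigma> r * reg \<sigma> s) True\<rparr>"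
proof -
  have "(exec w (emit_unary s) ^^ n) \<sigma> = \<sigma>\<lparr>outp := outp \<sigma> @ replicate (n * reg \<sigma> s) True\<rparr>" for n
    by (induction n) (auto simp: replicate_add[symmetric] add.commute)
  then show "exec w (emit_product r s) \<sigma> = \<sigma>\<lparr>outp := outp \<sigma> @ replicate (reg \<sigma> r * reg \<sigma> s) True\<rparr>"
    by (simp add: emit_product_def)
qed (auto simp: emit_product_def)

definition emit_product3 :: "nat \<Rightarrow> nat \<Rightarrow> nat \<Rightarrow> prog" where
  "emit_product3 r s t = Repeat r (emit_product s t)"

lemma emit_product3_simps [simp]: "mod_regs (emit_product3 r s t) = {}" "mod_arrs (emit_product3 r s t) = {}"
  "exec w (emit_product3 r s t) \<sigma> = \<sigma>\<lparr>outp := outp \<sigma> @ replicate (reg \<sigma> r * (reg \<sigma> s * reg \<sigma> t)) True\<rparr>"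
proof -
  have "(exec w (emit_product s t) ^^ n) \<sigma> = \<sigma>\<lparr>outp := outp \<sigma> @ replicate (n * (reg \<sigma> s * reg \<sigma> t)) True\<rparr>" for n
    by (induction n) (auto simp: replicate_add[symmetric] add.commute)
  then show "exec w (emit_product3 r s t) \<sigma> = \<sigma>\<lparr>outp := outp \<sigma> @ replicate (reg \<sigma> r * (reg \<sigma> s * reg \<sigma> t)) True\<rparr>"
    by (simp add: emit_product3_def)
qed (auto simp: emit_product3_def)

subsection \<open>Parsing\<close>

text \<open>Register 0 is the position in the input, and register 1 becomes positive when parsing fails.\<close>

abbreviation (input) "pos_reg \<equiv> 0 :: nat"
abbreviation (input) "fail_reg \<equiv> Suc 0"

abbreviation rest :: "bool list \<Rightarrow> store \<Rightarrow> bool list" where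
  "rest w \<sigma> \<equiv> drop (reg \<sigma> pos_reg) w"

definition good :: "bool list \<Rightarrow> store \<Rightarrow> bool" where
  "good w \<sigma> \<longleftrightarrow> reg \<sigma> fail_reg = 0 \<and> reg \<sigma> pos_reg \<le> length w"

text \<open>The failure register is never cleared, so a failure survives whatever runs afterwards
  and need not be tested for after each parser.\<close>

primrec sticky :: "prog \<Rightarrow> bool" where
  "sticky Skip = True"
| "sticky (Zero r) = (r \<noteq> fail_reg)"
| "sticky (Inc r) = True"
| "sticky (Copy r s) = (r \<noteq> fail_reg)"
| "sticky (Top r) = (r \<noteq> fail_reg)"
| "sticky (Put a r s b) = True"
| "sticky (Emit b) = True"
| "sticky (p ;; q) = (sticky p \<and> sticky q)"
| "sticky (Cond t p q) = (sticky p \<and> sticky q)"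
| "sticky (Repeat r p) = sticky p"

lemma sticky_exec: "sticky p \<Longrightarrow> 0 < reg \<sigma> fail_reg \<Longrightarrow> 0 < reg (exec w p \<sigma>) fail_reg"
proof (induction p arbitrary: \<sigma>)
  case (Repeat s p)
  then show ?case
    using funpow_invariant[of "\<lambda>\<tau>. 0 < reg \<tau> fail_reg" "exec w p"] by simp
qed (auto simp: bound_def)

text \<open>
  From a store satisfying \<open>I\<close>, the program \<open>p\<close> consumes the code of an object satisfying \<open>V\<close>,
  whereupon \<open>Q\<close> holds, or it fails if the rest of the input does not start with such a code.
\<close>

definition parses ::
  "bool list \<Rightarrow> (store \<Rightarrow> bool) \<Rightarrow> prog \<Rightarrow> ('a \<Rightarrow> bool list) \<Rightarrow> ('a \<Rightarrow> bool) \<Rightarrow> ('a \<Rightarrow> store \<Rightarrow> store \<Rightarrow> bool) \<Rightarrow> bool" where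
  "parses w I p e V Q \<longleftrightarrow> sticky p \<and> (\<forall>\<sigma>. I \<sigma> \<longrightarrow> good w \<sigma> \<longrightarrow>
     (\<exists>x ys. V x \<and> rest w \<sigma> = e x @ ys \<and> good w (exec w p \<sigma>) \<and> rest w (exec w p \<sigma>) = ys \<and> Q x \<sigma> (exec w p \<sigma>)) \<or>
     (0 < reg (exec w p \<sigma>) fail_reg \<and> (\<nexists>x ys. V x \<and> rest w \<sigma> = e x @ ys)))"

lemma parses_cases:
  assumes "parses w I p e V Q" "I \<sigma>" "good w \<sigma>"
  obtains x ys where "V x" "rest w \<sigma> = e x @ ys" "good w (exec w p \<sigma>)" "rest w (exec w p \<sigma>) = ys" "Q x \<sigma> (exec w p \<sigma>)"
  | "0 < reg (exec w p \<sigma>) fail_reg" "\<And>x ys. V x \<Longrightarrow> rest w \<sigma> \<noteq> e x @ ys"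
  using assms unfolding parses_def by metis

lemma parses_conv:
  assumes "parses w I p e V Q"
    and "\<And>\<sigma>. I' \<sigma> \<Longrightarrow> I \<sigma>"
    and "\<And>x \<sigma>. I' \<sigma> \<Longrightarrow> V x \<Longrightarrow> Q x \<sigma> (exec w p \<sigma>) \<Longrightarrow> \<exists>z. V' z \<and> e' z = e x \<and> Q' z \<sigma> (exec w p \<sigma>)"
    and "\<And>z. V' z \<Longrightarrow> \<exists>x. V x \<and> e x = e' z"
  shows "parses w I' p e' V' Q'"
  unfolding parses_def
proof (intro conjI allI impI)
  show "sticky p" using assms(1) by (simp add: parses_def)
  fix \<sigma> assume \<sigma>: "I' \<sigma>" "good w \<sigma>"
  from assms(1) assms(2)[OF \<sigma>(1)] \<sigma>(2)
  show "(\<exists>x ys. V' x \<and> rest w \<sigma> = e' x @ ys \<and> good w (exec w p \<sigma>) \<and> rest w (exec w p \<sigma>) = ys \<and> Q' x \<sigma> (exec w p \<sigma>)) \<or>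
     (0 < reg (exec w p \<sigma>) fail_reg \<and> (\<nexists>x ys. V' x \<and> rest w \<sigma> = e' x @ ys))"
  proof (cases rule: parses_cases)
    case (1 x ys)
    then show ?thesis using assms(3)[OF \<sigma>(1)] by metis
  next
    case 2
    then show ?thesis using assms(4) by metis
  qed
qed

text \<open>Failure of \<open>q\<close> excludes all codes only because the decomposition of the
  input after \<open>p\<close> is unique; this is where \<open>e\<close> being prefix-free on
  \<open>V\<close> enters.\<close>

lemma parses_seq:
  assumes "parses w I p e V Q" "\<And>x. V x \<Longrightarrow> parses w (I' x) q e' (V' x) Q'"
    and "\<And>x \<sigma>. I \<sigma> \<Longrightarrow> V x \<Longrightarrow> Q x \<sigma> (exec w p \<sigma>) \<Longrightarrow> I' x (exec w p \<sigma>)"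
    and "\<And>x y xs ys. V x \<Longrightarrow> V y \<Longrightarrow> e x @ xs = e y @ ys \<Longrightarrow> x = y \<and> xs = ys"
    and q: "sticky q"
  shows "parses w I (p ;; q) (\<lambda>(x, y). e x @ e' y) (\<lambda>(x, y). V x \<and> V' x y)
    (\<lambda>(x, y) \<sigma> \<sigma>'. Q x \<sigma> (exec w p \<sigma>) \<and> Q' y (exec w p \<sigma>) \<sigma>')"
  unfolding parses_def
proof (intro conjI allI impI)
  show "sticky (p ;; q)" using assms(1) q by (simp add: parses_def)
  fix \<sigma> assume \<sigma>: "I \<sigma>" "good w \<sigma>"
  let ?\<sigma> = "exec w p \<sigma>" and ?\<sigma>' = "exec w (p ;; q) \<sigma>"
  let ?succ = "\<exists>z ys. (case z of (x, y) \<Rightarrow> V x \<and> V' x y) \<and> rest w \<sigma> = (case z of (x, y) \<Rightarrow> e x @ e' y) @ ys \<and>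
      good w ?\<sigma>' \<and> rest w ?\<sigma>' = ys \<and> (case z of (x, y) \<Rightarrow> \<lambda>\<sigma> \<sigma>'. Q x \<sigma> (exec w p \<sigma>) \<and> Q' y (exec w p \<sigma>) \<sigma>') \<sigma> ?\<sigma>'"
  let ?code = "\<exists>z ys. (case z of (x, y) \<Rightarrow> V x \<and> V' x y) \<and> rest w \<sigma> = (case z of (x, y) \<Rightarrow> e x @ e' y) @ ys"
  from assms(1) \<sigma> show "?succ \<or> 0 < reg ?\<sigma>' fail_reg \<and> \<not> ?code"
  proof (cases rule: parses_cases)
    case (1 x ys)
    from assms(2)[OF 1(1)] assms(3)[OF \<sigma>(1) 1(1,5)] 1(3) show ?thesis
    proof (cases rule: parses_cases)
      case (1 y zs)
      have ?succ
        using \<open>V x\<close> \<open>rest w \<sigma> = e x @ ys\<close> \<open>rest w ?\<sigma> = ys\<close> \<open>Q x \<sigma> ?\<sigma>\<close> 1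
        by (intro exI[of _ "(x, y)"] exI[of _ zs]) simp
      then show ?thesis ..
    next
      case 2
      have "\<not> ?code"
      proof
        assume ?code
        then obtain x' y' zs where *: "V x'" "V' x' y'" "rest w \<sigma> = e x' @ (e' y' @ zs)" by auto
        then have "x = x' \<and> ys = e' y' @ zs"
          using assms(4)[OF \<open>V x\<close> *(1), of ys "e' y' @ zs"] \<open>rest w \<sigma> = e x @ ys\<close> by simp
        then show False using 2(2)[of y' zs] *(2) \<open>rest w ?\<sigma> = ys\<close> by simp
      qed
      then show ?thesis using 2 by simp
    qed
  next
    case 2
    then show ?thesis using sticky_exec[OF q] by auto
  qed
qed

lemma parses_check:
  assumes "parses w I p e V Q"
    and "\<And>x \<sigma>. I \<sigma> \<Longrightarrow> V x \<Longrightarrow> Q x \<sigma> (exec w p \<sigma>) \<Longrightarrow> eval w t (exec w p \<sigma>) \<longleftrightarrow> C x"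
    and "\<And>x y xs ys. V x \<Longrightarrow> V y \<Longrightarrow> e x @ xs = e y @ ys \<Longrightarrow> x = y \<and> xs = ys"
  shows "parses w I (p ;; Cond t Skip (Inc fail_reg)) e (\<lambda>x. V x \<and> C x) Q"
  unfolding parses_def
proof (intro conjI allI impI)
  show "sticky (p ;; Cond t Skip (Inc fail_reg))" using assms(1) by (simp add: parses_def)
  fix \<sigma> assume \<sigma>: "I \<sigma>" "good w \<sigma>"
  let ?\<sigma> = "exec w (p ;; Cond t Skip (Inc fail_reg)) \<sigma>"
  from assms(1) \<sigma>
  show "(\<exists>x ys. (V x \<and> C x) \<and> rest w \<sigma> = e x @ ys \<and> good w ?\<sigma> \<and> rest w ?\<sigma> = ys \<and> Q x \<sigma> ?\<sigma>) \<or>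
     (0 < reg ?\<sigma> fail_reg \<and> (\<nexists>x ys. (V x \<and> C x) \<and> rest w \<sigma> = e x @ ys))"
  proof (cases rule: parses_cases)
    case (1 x ys)
    show ?thesis
    proof (cases "C x")
      case True
      then show ?thesis using 1 assms(2)[OF \<sigma>(1) 1(1,5)] by auto
    next
      case False
      have "\<nexists>y zs. (V y \<and> C y) \<and> rest w \<sigma> = e y @ zs"
        using assms(3)[OF 1(1)] 1(2) False by metis
      then show ?thesis using False assms(2)[OF \<sigma>(1) 1(1,5)] by (simp add: bound_def)
    qed
  next
    case 2
    then show ?thesis by (auto simp: bound_def)
  qed
qed

definition eat :: "bool \<Rightarrow> prog" where
  "eat b = Cond (Input pos_reg (if b then 2 else 1)) (Inc pos_reg) (Inc fail_reg)"

lemma contents_nth: "i \<le> length w \<Longrightarrow>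
    contents w (int i) = (case drop i w of [] \<Rightarrow> 0 | b # _ \<Rightarrow> if b then 2 else 1)"
  by (cases "i < length w") (auto simp: contents_def Cons_nth_drop_Suc[symmetric])

lemma eval_Input:
  assumes "good w \<sigma>"
  shows "eval w (Input pos_reg (Suc 0)) \<sigma> \<longleftrightarrow> (\<exists>ys. rest w \<sigma> = False # ys)"
    "eval w (Input pos_reg 2) \<sigma> \<longleftrightarrow> (\<exists>ys. rest w \<sigma> = True # ys)"
    "eval w (Input pos_reg 0) \<sigma> \<longleftrightarrow> rest w \<sigma> = []"
  using assms by (auto simp: good_def contents_nth split: list.splits)

lemma exec_Inc_pos:
  assumes "good w \<sigma>" "rest w \<sigma> = b # ys"
  shows "exec w (Inc pos_reg) \<sigma> = set_reg pos_reg (Suc (reg \<sigma> pos_reg)) \<sigma>"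
    "good w (exec w (Inc pos_reg) \<sigma>)" "rest w (exec w (Inc pos_reg) \<sigma>) = ys"
proof -
  have l: "reg \<sigma> pos_reg < length w"
    using assms(2) by (metis drop_all list.distinct(1) not_le)
  then show 1: "exec w (Inc pos_reg) \<sigma> = set_reg pos_reg (Suc (reg \<sigma> pos_reg)) \<sigma>"
    by (simp add: bound_def)
  show "good w (exec w (Inc pos_reg) \<sigma>)" using assms(1) l unfolding 1 by (simp add: good_def)
  show "rest w (exec w (Inc pos_reg) \<sigma>) = ys"
    unfolding 1 using assms(2) by (metis drop_Suc list.sel(3) set_reg_simps(1) tl_drop fun_upd_same)
qed

lemma parses_eat: "parses w I (eat b) (\<lambda>_ :: unit. [b]) (\<lambda>_. True) (\<lambda>_ \<sigma> \<sigma>'. \<exists>v. \<sigma>' = set_reg pos_reg v \<sigma>)"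
  unfolding parses_def
proof (intro conjI allI impI)
  fix \<sigma> assume \<sigma>: "I \<sigma>" "good w \<sigma>"
  have t: "eval w (Input pos_reg (if b then 2 else 1)) \<sigma> \<longleftrightarrow> (\<exists>ys. rest w \<sigma> = b # ys)"
    using eval_Input(1,2)[OF \<sigma>(2)] by (cases b) (simp_all del: eval.simps)
  show "(\<exists>x ys. True \<and> rest w \<sigma> = [b] @ ys \<and> good w (exec w (eat b) \<sigma>) \<and> rest w (exec w (eat b) \<sigma>) = ys \<and> 
       (\<exists>v. exec w (eat b) \<sigma> = set_reg pos_reg v \<sigma>)) \<or>
     (0 < reg (exec w (eat b) \<sigma>) fail_reg \<and> (\<nexists>x ys. True \<and> rest w \<sigma> = [b] @ ys))"
  proof (cases "\<exists>ys. rest w \<sigma> = b # ys")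
    case True
    then obtain ys where ys: "rest w \<sigma> = b # ys" by blast
    have "exec w (eat b) \<sigma> = exec w (Inc pos_reg) \<sigma>" using t True by (simp add: eat_def del: eval.simps)
    then show ?thesis using exec_Inc_pos[OF \<sigma>(2) ys] ys by auto
  next
    case False
    then have "exec w (eat b) \<sigma> = exec w (Inc fail_reg) \<sigma>" using t by (simp add: eat_def del: eval.simps)
    then show ?thesis using False by (simp add: bound_def)
  qed
qed (simp add: eat_def)

lemma not_mod_sticky: "fail_reg \<notin> mod_regs p \<Longrightarrow> sticky p"
  by (induction p) auto

lemma good_frame:
  "pos_reg \<notin> mod_regs p \<Longrightarrow> fail_reg \<notin> mod_regs p \<Longrightarrow> good w (exec w p \<sigma>) = good w \<sigma>"
  by (simp add: good_def exec_reg_frame)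

text \<open>Actions that spare the position and the failure register may be interleaved with
  parsing, which is how arrays are filled while reading.\<close>

lemma parses_act:
  assumes "parses w I p e V Q" "pos_reg \<notin> mod_regs q" "fail_reg \<notin> mod_regs q"
    and "\<And>x \<sigma>. I \<sigma> \<Longrightarrow> V x \<Longrightarrow> Q x \<sigma> (exec w p \<sigma>) \<Longrightarrow> Q' x \<sigma> (exec w q (exec w p \<sigma>))"
  shows "parses w I (p ;; q) e V Q'"
  unfolding parses_def
proof (intro conjI allI impI)
  show "sticky (p ;; q)" using assms(1,3) not_mod_sticky by (simp add: parses_def)
  fix \<sigma> assume \<sigma>: "I \<sigma>" "good w \<sigma>"
  let ?\<sigma> = "exec w (p ;; q) \<sigma>"
  from assms(1) \<sigma>
  show "(\<exists>x ys. V x \<and> rest w \<sigma> = e x @ ys \<and> good w ?\<sigma> \<and> rest w ?\<sigma> = ys \<and> Q' x \<sigma> ?\<sigma>) \<or>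
     (0 < reg ?\<sigma> fail_reg \<and> (\<nexists>x ys. V x \<and> rest w \<sigma> = e x @ ys))"
  proof (cases rule: parses_cases)
    case (1 x ys)
    have "Q' x \<sigma> ?\<sigma>" using assms(4)[OF \<sigma>(1) 1(1,5)] by simp
    moreover have "good w ?\<sigma>" "rest w ?\<sigma> = ys"
      using 1 assms(2,3) by (simp_all add: good_frame exec_reg_frame)
    ultimately show ?thesis using 1 by blast
  next
    case 2
    then show ?thesis using assms(3) by (simp add: exec_reg_frame)
  qed
qed

lemma parses_pre:
  assumes "parses w I' p e V Q" "pos_reg \<notin> mod_regs q" "fail_reg \<notin> mod_regs q"
    and "\<And>\<sigma>. I \<sigma> \<Longrightarrow> I' (exec w q \<sigma>)"
  shows "parses w I (q ;; p) e V (\<lambda>x \<sigma>. Q x (exec w q \<sigma>))"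
  unfolding parses_def
proof (intro conjI allI impI)
  show "sticky (q ;; p)" using assms(1,3) not_mod_sticky by (simp add: parses_def)
  fix \<sigma> assume \<sigma>: "I \<sigma>" "good w \<sigma>"
  let ?\<sigma> = "exec w (q ;; p) \<sigma>"
  have "good w (exec w q \<sigma>)" using \<sigma>(2) assms(2,3) by (simp add: good_frame)
  with assms(1) assms(4)[OF \<sigma>(1)]
  show "(\<exists>x ys. V x \<and> rest w \<sigma> = e x @ ys \<and> good w ?\<sigma> \<and> rest w ?\<sigma> = ys \<and> Q x (exec w q \<sigma>) ?\<sigma>) \<or>
     (0 < reg ?\<sigma> fail_reg \<and> (\<nexists>x ys. V x \<and> rest w \<sigma> = e x @ ys))"
    by (cases rule: parses_cases) (use assms(2) in \<open>auto simp: exec_reg_frame\<close>)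
qed

section \<open>Parsing unary numbers and lists\<close>

lemma funpow_fixed: "f x = x \<Longrightarrow> (f ^^ n) x = x"
  by (induction n) auto

lemma enc_nat_prefix: "enc_nat x @ xs = enc_nat y @ ys \<Longrightarrow> x = y \<and> xs = ys"
proof (induction x arbitrary: y)
  case 0
  then show ?case by (cases y) (auto simp: enc_nat_def)
next
  case (Suc x)
  then show ?case by (cases y) (auto simp: enc_nat_def)
qed

text \<open>In the absence of unbounded loops, \<open>bound w\<close> rounds are made, each reading
  a one if there is one; the surplus rounds change nothing.\<close>

definition parse_nat :: "nat \<Rightarrow> nat \<Rightarrow> prog" where
  "parse_nat r t = (Zero r ;; Top t ;; Repeat t (Cond (Input pos_reg 2) (Inc pos_reg ;; Inc r) Skip)) ;; eat False"

lemma eat_simps [simp]: "mod_regs (eat b) = {pos_reg, fail_reg}" "mod_arrs (eat b) = {}" "silent (eat b)" "sticky (eat b)"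
  by (auto simp: eat_def)

lemma parse_nat_simps [simp]: "mod_regs (parse_nat r t) = {r, t, pos_reg, fail_reg}" "mod_arrs (parse_nat r t) = {}"
  "silent (parse_nat r t)"
  by (auto simp: parse_nat_def)

lemma exec_parse_ones:
  assumes "r \<noteq> pos_reg" "r \<noteq> fail_reg" "\<And>zs. ys \<noteq> True # zs"
    and "good w \<sigma>" "rest w \<sigma> = replicate j True @ ys" "j \<le> k" "reg \<sigma> r + j \<le> bound w"
  defines "f \<equiv> exec w (Cond (Input pos_reg 2) (Inc pos_reg ;; Inc r) Skip)"
  shows "good w ((f ^^ k) \<sigma>) \<and> rest w ((f ^^ k) \<sigma>) = ys \<and> reg ((f ^^ k) \<sigma>) r = reg \<sigma> r + j"
  using assms(4-7)
proof (induction k arbitrary: \<sigma> j)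
  case 0
  then show ?case by simp
next
  case (Suc k)
  note t = eval_Input(2)[OF Suc.prems(1)]
  show ?case
  proof (cases j)
    case 0
    then have "\<not> eval w (Input pos_reg 2) \<sigma>" using t Suc.prems(2) assms(3) by simp
    then have "f \<sigma> = \<sigma>" by (simp add: f_def del: eval.simps)
    then show ?thesis using funpow_fixed[of f \<sigma> "Suc k"] Suc.prems 0 by simp
  next
    case (Suc j')
    then have rest: "rest w \<sigma> = True # (replicate j' True @ ys)" using Suc.prems(2) by simp
    note inc = exec_Inc_pos[OF Suc.prems(1) rest]
    have f: "f \<sigma> = exec w (Inc r) (exec w (Inc pos_reg) \<sigma>)"
      using t rest by (simp add: f_def del: eval.simps)
    have r: "reg (f \<sigma>) r = Suc (reg \<sigma> r)"
      using Suc.prems(4) Suc assms(1) unfolding f inc(1) by simp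
    have "good w (f \<sigma>)" "rest w (f \<sigma>) = replicate j' True @ ys"
      unfolding f using inc(2,3) assms(1,2) by (simp_all add: good_frame exec_reg_frame del: exec.simps)
    then have "good w ((f ^^ k) (f \<sigma>)) \<and> rest w ((f ^^ k) (f \<sigma>)) = ys \<and> reg ((f ^^ k) (f \<sigma>)) r = reg (f \<sigma>) r + j'"
      using Suc.prems(3,4) Suc r by (intro Suc.IH) auto
    then show ?thesis using r Suc by (simp add: funpow_swap1)
  qed
qed

lemma dropWhile_ones: "dropWhile id (replicate j True @ ys) = dropWhile id ys"
  by (induction j) simp_all

lemma leading_ones: "\<exists>j ys. xs = replicate j True @ ys \<and> (\<forall>zs. ys \<noteq> True # zs)"
proof (induction xs)
  case (Cons x xs)
  show ?case
  proof (cases x)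
    case True
    with Cons obtain j ys where "x # xs = replicate (Suc j) True @ ys" "\<forall>zs. ys \<noteq> True # zs" by auto
    then show ?thesis by blast
  next
    case False
    then show ?thesis by (intro exI[of _ 0] exI[of _ "x # xs"]) simp
  qed
qed simp

lemma parses_nat:
  assumes "r \<noteq> pos_reg" "r \<noteq> fail_reg" "t \<noteq> pos_reg" "t \<noteq> fail_reg" "r \<noteq> t"
  shows "parses w I (parse_nat r t) enc_nat (\<lambda>_. True) (\<lambda>x \<sigma> \<sigma>'. reg \<sigma>' r = x)"
  unfolding parses_def
proof (intro conjI allI impI)
  show "sticky (parse_nat r t)" using assms by (auto simp: parse_nat_def)
  fix \<sigma> assume \<sigma>: "good w \<sigma>"
  define \<sigma>\<^sub>1 where "\<sigma>\<^sub>1 = exec w (Zero r ;; Top t ;; Repeat t (Cond (Input pos_reg 2) (Inc pos_reg ;; Inc r) Skip)) \<sigma>"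
  obtain j ys where ones: "rest w \<sigma> = replicate j True @ ys" and ys: "\<And>zs. ys \<noteq> True # zs"
    using leading_ones[of "rest w \<sigma>"] by blast
  \<comment> \<open>\<open>dropWhile\<close> names the part after the leading ones uniquely, so an
    assumed code of a number can be compared with the split that was found.\<close>
  have dw: "dropWhile id (rest w \<sigma>) = ys"
  proof -
    have "dropWhile id ys = ys" using ys by (cases ys) fastforce+
    then show ?thesis unfolding ones dropWhile_ones .
  qed
  have "length (rest w \<sigma>) \<le> length w" by simp
  then have "j \<le> bound w" unfolding ones bound_def by simp
  then have \<sigma>\<^sub>1: "good w \<sigma>\<^sub>1 \<and> rest w \<sigma>\<^sub>1 = ys \<and> reg \<sigma>\<^sub>1 r = j"
    using exec_parse_ones[OF assms(1,2) ys, of w "set_reg t (bound w) (set_reg r 0 \<sigma>)" j "bound w"] \<sigma> ones assms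
    by (simp add: \<sigma>\<^sub>1_def good_def)
  have e: "exec w (parse_nat r t) \<sigma> = exec w (eat False) \<sigma>\<^sub>1"
    by (simp add: parse_nat_def \<sigma>\<^sub>1_def)
  have "parses w (\<lambda>_. True) (eat False) (\<lambda>_ :: unit. [False]) (\<lambda>_. True) (\<lambda>_ \<sigma> \<sigma>'. \<exists>v. \<sigma>' = set_reg pos_reg v \<sigma>)"
    by (rule parses_eat)
  from this TrueI \<sigma>\<^sub>1[THEN conjunct1] show "(\<exists>x zs. True \<and> rest w \<sigma> = enc_nat x @ zs \<and> good w (exec w (parse_nat r t) \<sigma>) \<and>
       rest w (exec w (parse_nat r t) \<sigma>) = zs \<and> reg (exec w (parse_nat r t) \<sigma>) r = x) \<or>
     (0 < reg (exec w (parse_nat r t) \<sigma>) fail_reg \<and> (\<nexists>x zs. True \<and> rest w \<sigma> = enc_nat x @ zs))"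
  proof (cases rule: parses_cases)
    case (1 x zs)
    then have "reg (exec w (eat False) \<sigma>\<^sub>1) r = j" using \<sigma>\<^sub>1 assms by (auto simp: exec_reg_frame)
    moreover have "rest w \<sigma> = enc_nat j @ zs" using 1 \<sigma>\<^sub>1 ones by (simp add: enc_nat_def)
    ultimately show ?thesis using 1 unfolding e by blast
  next
    case 2
    have False if "rest w \<sigma> = enc_nat x @ zs" for x zs
    proof -
      have "ys = False # zs" unfolding dw[symmetric] that enc_nat_def by (simp add: dropWhile_ones)
      then show False using 2(2) \<sigma>\<^sub>1 by auto
    qed
    with 2 show ?thesis unfolding e by blast
  qed
qed

definition parse_list :: "prog \<Rightarrow> nat \<Rightarrow> prog" where
  "parse_list p t = (Top t ;; Repeat t (Cond (Input pos_reg 2) (Inc pos_reg ;; p) Skip)) ;; eat False"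

lemma parse_list_simps [simp]: "mod_regs (parse_list p t) = {t, pos_reg, fail_reg} \<union> mod_regs p"
  "mod_arrs (parse_list p t) = mod_arrs p" "silent (parse_list p t) = silent p"
  by (auto simp: parse_list_def)

abbreviation enc_items :: "('a \<Rightarrow> bool list) \<Rightarrow> 'a list \<Rightarrow> bool list" where
  "enc_items e xs \<equiv> concat (map (\<lambda>x. True # e x) xs)"

lemma enc_list_prefix:
  assumes "\<And>x y xs ys. V x \<Longrightarrow> V y \<Longrightarrow> e x @ xs = e y @ ys \<Longrightarrow> x = y \<and> xs = ys"
    and "\<forall>x \<in> set l. V x" "\<forall>x \<in> set l'. V x" "enc_list e l @ xs = enc_list e l' @ ys"
  shows "l = l' \<and> xs = ys"
  using assms(2-4)
proof (induction l arbitrary: l')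
  case Nil
  then show ?case by (cases l') (auto simp: enc_list_def)
next
  case (Cons x l)
  then obtain y m where l': "l' = y # m" by (cases l') (auto simp: enc_list_def)
  then have "e x @ (enc_list e l @ xs) = e y @ (enc_list e m @ ys)"
    using Cons.prems(3) by (simp add: enc_list_def)
  then have xy: "x = y \<and> enc_list e l @ xs = enc_list e m @ ys"
    by (intro assms(1)) (use Cons.prems(1,2) l' in simp_all)
  then have "l = m \<and> xs = ys"
    by (intro Cons.IH) (use Cons.prems(1,2) l' in simp_all)
  then show ?case using xy l' by simp
qed

text \<open>\<open>J xs\<close> describes the store after the items \<open>xs\<close> have been
  read. After \<open>k\<close> rounds, either \<open>k\<close> items or all items present have been
  read, or an item was broken, and then no code of a list can start here.\<close>

lemma exec_parse_items:
  assumes "\<And>xs. parses w (J xs) p e V (\<lambda>x \<sigma> \<sigma>'. J (xs @ [x]) \<sigma>')"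
    and "\<And>xs \<sigma> v. J xs \<sigma> \<Longrightarrow> J xs (set_reg pos_reg v \<sigma>)"
    and "\<And>x y xs ys. V x \<Longrightarrow> V y \<Longrightarrow> e x @ xs = e y @ ys \<Longrightarrow> x = y \<and> xs = ys"
    and "good w \<sigma>" "J us \<sigma>"
  defines "f \<equiv> exec w (Cond (Input pos_reg 2) (Inc pos_reg ;; p) Skip)"
  shows "(\<exists>zs ys. (\<forall>z \<in> set zs. V z) \<and> rest w \<sigma> = enc_items e zs @ ys \<and> good w ((f ^^ k) \<sigma>) \<and>
      rest w ((f ^^ k) \<sigma>) = ys \<and> J (us @ zs) ((f ^^ k) \<sigma>) \<and> (length zs = k \<or> (\<forall>y. ys \<noteq> True # y))) \<or>
    (0 < reg ((f ^^ k) \<sigma>) fail_reg \<and> (\<nexists>zs ys. (\<forall>z \<in> set zs. V z) \<and> rest w \<sigma> = enc_list e zs @ ys))"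
  using assms(4,5)
proof (induction k arbitrary: \<sigma> us)
  case 0
  then show ?case by (intro disjI1 exI[of _ "[]"] exI[of _ "rest w \<sigma>"]) simp
next
  case (Suc k)
  note t = eval_Input(2)[OF Suc.prems(1)]
  have p: "sticky p" using assms(1) by (simp add: parses_def)
  show ?case
  proof (cases "\<exists>ys. rest w \<sigma> = True # ys")
    case False
    then have "f \<sigma> = \<sigma>" using t by (simp add: f_def del: eval.simps)
    then have "(f ^^ Suc k) \<sigma> = \<sigma>" by (rule funpow_fixed)
    then show ?thesis using Suc.prems False by (intro disjI1 exI[of _ "[]"] exI[of _ "rest w \<sigma>"]) simp
  next
    case True
    then obtain rs where rs: "rest w \<sigma> = True # rs" by blast
    define \<sigma>\<^sub>1 where "\<sigma>\<^sub>1 = exec w (Inc pos_reg) \<sigma>"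
    note inc = exec_Inc_pos[OF Suc.prems(1) rs, folded \<sigma>\<^sub>1_def]
    have f: "f \<sigma> = exec w p \<sigma>\<^sub>1" using t True by (simp add: f_def \<sigma>\<^sub>1_def del: eval.simps)
    have J1: "J us \<sigma>\<^sub>1" unfolding inc(1) using Suc.prems(2) assms(2) by blast
    from assms(1)[of us] J1 inc(2) show ?thesis
    proof (cases rule: parses_cases)
      case (1 x ys)
      let ?\<tau> = "(f ^^ Suc k) \<sigma>"
      have \<tau>: "?\<tau> = (f ^^ k) (f \<sigma>)" by (simp add: funpow_swap1)
      have rest: "rest w \<sigma> = True # e x @ ys" using rs inc(3) 1(2) by simp
      consider zs ys' where "\<forall>z \<in> set zs. V z" "ys = enc_items e zs @ ys'" "good w ?\<tau>"
          "rest w ?\<tau> = ys'" "J ((us @ [x]) @ zs) ?\<tau>" "length zs = k \<or> (\<forall>y. ys' \<noteq> True # y)"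
        | "0 < reg ?\<tau> fail_reg" "\<nexists>zs ys'. (\<forall>z \<in> set zs. V z) \<and> ys = enc_list e zs @ ys'"
        using Suc.IH[of "f \<sigma>" "us @ [x]"] 1(3-5) unfolding \<tau> f by metis
      then show ?thesis
      proof cases
        case (1 zs ys')
        then show ?thesis using rest \<open>V x\<close>
          by (intro disjI1 exI[of _ "x # zs"] exI[of _ ys']) auto
      next
        case 2
        have False if "\<forall>z \<in> set zs. V z" "rest w \<sigma> = enc_list e zs @ zs'" for zs zs'
        proof (cases zs)
          case Nil
          then show False using that rest by (simp add: enc_list_def)
        next
          case (Cons z l)
          then have "e x @ ys = e z @ (enc_list e l @ zs')"
            using that rest by (simp add: enc_list_def)
          then have "ys = enc_list e l @ zs'"
            using assms(3)[OF \<open>V x\<close>, of z ys "enc_list e l @ zs'"] that(1) Cons by simp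
          then show False using 2(2) that(1) Cons by auto
        qed
        then show ?thesis using 2(1) by blast
      qed
    next
      case 2
      have "0 < reg ((f ^^ Suc k) \<sigma>) fail_reg"
        unfolding funpow_Suc_right o_apply f
        by (rule funpow_invariant[where P = "\<lambda>\<tau>. 0 < reg \<tau> fail_reg"])
           (use p 2(1) in \<open>auto simp: f_def intro!: sticky_exec\<close>)
      moreover have False if "\<forall>z \<in> set zs. V z" "rest w \<sigma> = enc_list e zs @ zs'" for zs zs'
      proof (cases zs)
        case Nil
        then show False using that rs by (simp add: enc_list_def)
      next
        case (Cons z l)
        then have "rest w \<sigma>\<^sub>1 = e z @ (enc_list e l @ zs')"
          using that rs inc(3) by (simp add: enc_list_def)
        then show False using 2(2) that(1) Cons by auto
      qed
      ultimately show ?thesis by blast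
    qed
  qed
qed

lemma parses_list:
  assumes "\<And>xs. parses w (J xs) p e V (\<lambda>x \<sigma> \<sigma>'. J (xs @ [x]) \<sigma>')"
    and "\<And>xs \<sigma> v. J xs \<sigma> \<Longrightarrow> J xs (set_reg pos_reg v \<sigma>)"
    and "\<And>xs \<sigma> v. J xs \<sigma> \<Longrightarrow> J xs (set_reg t v \<sigma>)"
    and pfree: "\<And>x y xs ys. V x \<Longrightarrow> V y \<Longrightarrow> e x @ xs = e y @ ys \<Longrightarrow> x = y \<and> xs = ys"
    and t: "t \<noteq> pos_reg" "t \<noteq> fail_reg"
  shows "parses w (J []) (parse_list p t) (enc_list e) (\<lambda>l. \<forall>x \<in> set l. V x) (\<lambda>l \<sigma> \<sigma>'. J l \<sigma>')"
  unfolding parses_def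
proof (intro conjI allI impI)
  show "sticky (parse_list p t)" using assms(1) t by (simp add: parse_list_def parses_def)
  fix \<sigma> assume \<sigma>: "J [] \<sigma>" "good w \<sigma>"
  let ?f = "exec w (Cond (Input pos_reg 2) (Inc pos_reg ;; p) Skip)"
  define \<sigma>\<^sub>0 where "\<sigma>\<^sub>0 = set_reg t (bound w) \<sigma>"
  define \<sigma>\<^sub>1 where "\<sigma>\<^sub>1 = (?f ^^ bound w) \<sigma>\<^sub>0"
  have e: "exec w (parse_list p t) \<sigma> = exec w (eat False) \<sigma>\<^sub>1"
    by (simp add: parse_list_def \<sigma>\<^sub>1_def \<sigma>\<^sub>0_def)
  have \<sigma>\<^sub>0: "good w \<sigma>\<^sub>0" "J [] \<sigma>\<^sub>0" "rest w \<sigma>\<^sub>0 = rest w \<sigma>"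
    using \<sigma> assms(3) t by (auto simp: \<sigma>\<^sub>0_def good_def)
  have items: "(\<exists>zs ys. (\<forall>z \<in> set zs. V z) \<and> rest w \<sigma>\<^sub>0 = enc_items e zs @ ys \<and> good w \<sigma>\<^sub>1 \<and>
      rest w \<sigma>\<^sub>1 = ys \<and> J ([] @ zs) \<sigma>\<^sub>1 \<and> (length zs = bound w \<or> (\<forall>y. ys \<noteq> True # y))) \<or>
    (0 < reg \<sigma>\<^sub>1 fail_reg \<and> (\<nexists>zs ys. (\<forall>z \<in> set zs. V z) \<and> rest w \<sigma>\<^sub>0 = enc_list e zs @ ys))"
    unfolding \<sigma>\<^sub>1_def
    by (rule exec_parse_items[OF assms(1) _ _ \<sigma>\<^sub>0(1,2)]) (assumption | erule assms(2) | erule (2) pfree)+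
  from items[unfolded append_Nil \<sigma>\<^sub>0(3)] have "(\<exists>x ys. (\<forall>x \<in> set x. V x) \<and> rest w \<sigma> = enc_list e x @ ys \<and> good w (exec w (eat False) \<sigma>\<^sub>1) \<and>
       rest w (exec w (eat False) \<sigma>\<^sub>1) = ys \<and> J x (exec w (eat False) \<sigma>\<^sub>1)) \<or>
     (0 < reg (exec w (eat False) \<sigma>\<^sub>1) fail_reg \<and> (\<nexists>x ys. (\<forall>x \<in> set x. V x) \<and> rest w \<sigma> = enc_list e x @ ys))"
  proof (rule disjE, elim exE conjE, goal_cases)
    case one: (1 zs ys)
    have "length zs \<le> length (enc_items e zs)" by (induction zs) auto
    moreover have "length (rest w \<sigma>) = length (enc_items e zs) + length ys"
      using arg_cong[OF one(3), of length] unfolding length_append .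
    moreover have "length (rest w \<sigma>) \<le> length w" by simp
    ultimately have "length zs \<le> length w" by linarith
    \<comment> \<open>Each item takes at least its leading bit, so fewer than \<open>bound w\<close>
      items were read and the loop did not stop for lack of rounds.\<close>
    then have ys: "ys \<noteq> True # y" for y using one(7) by (auto simp: bound_def)
    have "parses w (\<lambda>_. True) (eat False) (\<lambda>_ :: unit. [False]) (\<lambda>_. True) (\<lambda>_ \<sigma> \<sigma>'. \<exists>v. \<sigma>' = set_reg pos_reg v \<sigma>)"
      by (rule parses_eat)
    from this TrueI one(4) show ?case
    proof (cases rule: parses_cases)
      case (1 x ys')
      then have "J zs (exec w (eat False) \<sigma>\<^sub>1)" using one(6) assms(2) by auto
      moreover have "rest w \<sigma> = enc_list e zs @ ys'" using 1 one by (simp add: enc_list_def)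
      ultimately show ?thesis using 1 one by blast
    next
      case 2
      then have Nil: "ys = []"
        using one(5) ys 2(2) by (metis (full_types) append_Cons append_Nil list.exhaust)
      have False if "\<forall>z \<in> set xs. V z" "rest w \<sigma> = enc_list e xs @ xs'" for xs xs'
      proof -
        \<comment> \<open>The input ended where the closing bit was due. Appending that bit to both
          readings gives two codes of lists, and prefix-freeness would make
          \<open>xs' @ [False]\<close> empty.\<close>
        have "enc_list e zs @ [] = enc_list e xs @ (xs' @ [False])"
          using that(2) one(3) Nil by (simp add: enc_list_def)
        then show False using enc_list_prefix[OF pfree one(2) that(1)] by blast
      qed
      with 2 show ?thesis by blast
    qed
  next
    case 2
    then have "0 < reg (exec w (eat False) \<sigma>\<^sub>1) fail_reg" by (intro sticky_exec) simp_all
    then show ?case using 2 by blast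
  qed
  then show "(\<exists>x ys. (\<forall>x \<in> set x. V x) \<and> rest w \<sigma> = enc_list e x @ ys \<and> good w (exec w (parse_list p t) \<sigma>) \<and>
       rest w (exec w (parse_list p t) \<sigma>) = ys \<and> J x (exec w (parse_list p t) \<sigma>)) \<or>
     (0 < reg (exec w (parse_list p t) \<sigma>) fail_reg \<and> (\<nexists>x ys. (\<forall>x \<in> set x. V x) \<and> rest w \<sigma> = enc_list e x @ ys))"
    unfolding e .
qed

lemma parses_start:
  assumes "parses w I p e V Q" "I init_store"
  obtains x ys where "V x" "w = e x @ ys" "good w (exec w p init_store)" "rest w (exec w p init_store) = ys"
      "Q x init_store (exec w p init_store)"
    | "0 < reg (exec w p init_store) fail_reg" "\<And>x ys. V x \<Longrightarrow> w \<noteq> e x @ ys"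
proof -
  have "good w init_store" "rest w init_store = w" by (simp_all add: good_def init_store_def)
  then show ?thesis using parses_cases[OF assms, of thesis] that by metis
qed

text \<open>The output is left empty unless the whole input is the code of an object.\<close>

definition parse_then :: "prog \<Rightarrow> prog \<Rightarrow> prog" where
  "parse_then p q = p ;; Cond (TNot (Pos fail_reg)) (Cond (Input pos_reg 0) q Skip) Skip"

lemma outp_parse_then:
  assumes "parses w I p e V Q" "I init_store" "silent p"
  obtains x where "V x" "w = e x" "Q x init_store (exec w p init_store)" "good w (exec w p init_store)"
      "outp (exec w (parse_then p q) init_store) = outp (exec w q (exec w p init_store))"
      "outp (exec w p init_store) = []"
    | x y ys where "V x" "w = e x @ y # ys" "outp (exec w (parse_then p q) init_store) = []"
    | "\<And>x ys. V x \<Longrightarrow> w \<noteq> e x @ ys" "outp (exec w (parse_then p q) init_store) = []"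
proof -
  let ?\<sigma> = "exec w p init_store"
  have out: "outp ?\<sigma> = []" using assms(3) by (simp add: exec_outp_frame init_store_def)
  from assms(1,2) show ?thesis
  proof (cases rule: parses_start)
    case (1 x ys)
    note t = eval_Input(3)[OF 1(3)]
    have nf: "reg ?\<sigma> fail_reg = 0" using 1(3) by (simp add: good_def)
    show ?thesis
    proof (cases ys)
      case Nil
      then have "exec w (parse_then p q) init_store = exec w q ?\<sigma>"
        using t nf 1(4) by (simp add: parse_then_def del: eval.simps(4))
      then show ?thesis using that(1)[of x] 1 Nil out by simp
    next
      case (Cons y zs)
      then have "exec w (parse_then p q) init_store = ?\<sigma>"
        using t nf 1(4) by (simp add: parse_then_def del: eval.simps(4))
      then show ?thesis using that(2)[of x y zs] 1 Cons out by simp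
    qed
  next
    case 2
    then have "exec w (parse_then p q) init_store = ?\<sigma>" by (simp add: parse_then_def)
    then show ?thesis using that(3) 2(2) out by simp
  qed
qed

section \<open>From graphs to constraints\<close>

lemma xor3_iff: "[a, b, c] \<in> xor3 \<longleftrightarrow> ((a \<noteq> b) \<noteq> c)"
  by (auto simp: xor3_def)

lemma arg_value_map: "arg_value \<alpha> (map_arg \<pi> a) = arg_value (\<alpha> \<circ> \<pi>) a"
  by (cases a) auto

lemma satisfies_rename: "satisfies \<alpha> (rename \<pi> S) \<longleftrightarrow> satisfies (\<alpha> \<circ> \<pi>) S"
  by (auto simp: satisfies_def rename_def arg_value_map comp_def split_def cong: map_cong)

lemma isomorphic_iff:
  "isomorphic X S U \<longleftrightarrow> (\<exists>\<pi>. \<pi> permutes X \<and> (\<forall>\<alpha>. satisfies (\<alpha> \<circ> \<pi>) S \<longleftrightarrow> satisfies \<alpha> U))"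
  by (simp add: isomorphic_def equivalent_def satisfies_rename)

text \<open>
  A graph on \<open>{..<n}\<close> with adjacency \<open>A\<close> gives equations in the vertices \<open>u\<close> and in one further variable
  for every ordered pair of vertices: \<open>x\<^sub>u + x\<^sub>v + y\<^sub>u\<^sub>v = 1\<close> for adjacent and \<open>y\<^sub>u\<^sub>v = 1\<close> for nonadjacent pairs.
  The vertices are the variables that are neither constant nor equal to another variable, as
  \<open>y\<^sub>u\<^sub>v = y\<^sub>v\<^sub>u\<close>.
\<close>

definition pair_var :: "nat \<Rightarrow> nat \<Rightarrow> nat \<Rightarrow> nat" where
  "pair_var n u v = n + (u * n + v)"

definition pair_app :: "nat \<Rightarrow> (nat \<Rightarrow> nat \<Rightarrow> bool) \<Rightarrow> nat \<Rightarrow> nat \<Rightarrow> nat application" where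
  "pair_app n A u v = (let y = Var (pair_var n u v) in (xor3, if A u v then [Var u, Var v, y] else [y, y, y]))"

definition graph_apps :: "nat \<Rightarrow> (nat \<Rightarrow> nat \<Rightarrow> bool) \<Rightarrow> nat application list" where
  "graph_apps n A = concat (map (\<lambda>u. map (pair_app n A u) [0..<n]) [0..<n])"

abbreviation "num_vars n \<equiv> n + n * (n::nat)"

lemma pair_var_less: "u < n \<Longrightarrow> v < n \<Longrightarrow> pair_var n u v < num_vars n"
proof -
  assume "u < n" "v < n"
  then have "u * n + v < Suc u * n" by simp
  also have "\<dots> \<le> n * n" using \<open>u < n\<close> by (intro mult_right_mono) auto
  finally show ?thesis by (simp add: pair_var_def)
qed

lemma pair_var_div_mod:
  "v < n \<Longrightarrow> (pair_var n u v - n) div n = u" "v < n \<Longrightarrow> (pair_var n u v - n) mod n = v"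
  by (simp_all add: pair_var_def)

lemma var_cases:
  assumes "x < num_vars n"
  obtains "x < n" | u v where "u < n" "v < n" "x = pair_var n u v"
proof (cases "x < n")
  case False
  moreover have "0 < n" using assms False by (cases n) auto
  ultimately have "(x - n) div n < n" "(x - n) mod n < n" "x = pair_var n ((x - n) div n) ((x - n) mod n)"
    using assms by (auto simp: pair_var_def less_mult_imp_div_less intro!: mod_less_divisor)
  then show ?thesis using that(2) by blast
qed (use that in auto)

lemma set_graph_apps: "set (graph_apps n A) = (\<Union>u\<in>{..<n}. pair_app n A u ` {..<n})"
  by (simp add: graph_apps_def lessThan_atLeast0)

lemma satisfies_graph_apps:
  "satisfies \<alpha> (set (graph_apps n A)) \<longleftrightarrow>
     (\<forall>u<n. \<forall>v<n. \<alpha> (pair_var n u v) \<longleftrightarrow> (A u v \<longrightarrow> \<alpha> u = \<alpha> v))"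
proof -
  have "satisfies \<alpha> (set (graph_apps n A)) \<longleftrightarrow>
      (\<forall>u<n. \<forall>v<n. case pair_app n A u v of (C, as) \<Rightarrow> map (arg_value \<alpha>) as \<in> C)"
    unfolding satisfies_def set_graph_apps by (simp add: Ball_def[of "{..<n}"])
  moreover have "(case pair_app n A u v of (C, as) \<Rightarrow> map (arg_value \<alpha>) as \<in> C) \<longleftrightarrow>
      (\<alpha> (pair_var n u v) \<longleftrightarrow> (A u v \<longrightarrow> \<alpha> u = \<alpha> v))" for u v
    by (auto simp: pair_app_def Let_def xor3_iff)
  ultimately show ?thesis by simp
qed

lemmas satisfies_graph_appsD = iffD1[OF satisfies_graph_apps, rule_format]

definition extend_sol :: "nat \<Rightarrow> (nat \<Rightarrow> nat \<Rightarrow> bool) \<Rightarrow> (nat \<Rightarrow> bool) \<Rightarrow> nat \<Rightarrow> bool" where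
  "extend_sol n A \<beta> x = (if x < n then \<beta> x
     else A ((x - n) div n) ((x - n) mod n) \<longrightarrow> \<beta> ((x - n) div n) = \<beta> ((x - n) mod n))"

lemma extend_sol_simps:
  "x < n \<Longrightarrow> extend_sol n A \<beta> x = \<beta> x"
  "v < n \<Longrightarrow> extend_sol n A \<beta> (pair_var n u v) \<longleftrightarrow> (A u v \<longrightarrow> \<beta> u = \<beta> v)"
  unfolding extend_sol_def by (simp_all add: pair_var_div_mod) (simp add: pair_var_def)

lemma satisfies_extend_sol: "satisfies (extend_sol n A \<beta>) (set (graph_apps n A))"
  by (simp add: satisfies_graph_apps extend_sol_simps)

text \<open>Stated for an arbitrary predicate on assignments, so that invariance under renaming does
  not depend on how the solutions are presented.\<close>

definition twin_free :: "((nat \<Rightarrow> bool) \<Rightarrow> bool) \<Rightarrow> nat \<Rightarrow> nat \<Rightarrow> bool" where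
  "twin_free P N a \<longleftrightarrow> (\<exists>\<alpha>. P \<alpha> \<and> \<not> \<alpha> a) \<and> (\<forall>b<N. b \<noteq> a \<longrightarrow> (\<exists>\<alpha>. P \<alpha> \<and> \<alpha> a \<noteq> \<alpha> b))"

definition linked :: "((nat \<Rightarrow> bool) \<Rightarrow> bool) \<Rightarrow> nat \<Rightarrow> nat \<Rightarrow> nat \<Rightarrow> bool" where
  "linked P N a b \<longleftrightarrow> (\<exists>c<N. \<forall>\<alpha>. P \<alpha> \<longrightarrow> ((\<alpha> a \<noteq> \<alpha> b) \<noteq> \<alpha> c))"

text \<open>Vertex values can be prescribed freely, which separates a vertex from everything else. A
  pair variable of an edge has the twin for the opposite order, and one of a nonedge is constantly
  true.\<close>

lemma twin_free_graph_apps: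
  assumes "\<And>u v. A u v \<Longrightarrow> A v u" "\<And>u. \<not> A u u" "a < num_vars n"
  shows "twin_free (\<lambda>\<alpha>. satisfies \<alpha> (set (graph_apps n A))) (num_vars n) a \<longleftrightarrow> a < n"
  using assms(3)
proof (cases rule: var_cases)
  case 1
  have "\<exists>\<alpha>. satisfies \<alpha> (set (graph_apps n A)) \<and> \<not> \<alpha> a"
    using satisfies_extend_sol[of n A "\<lambda>_. False"] extend_sol_simps(1)[OF 1, of A "\<lambda>_. False"] by blast
  moreover have "\<exists>\<alpha>. satisfies \<alpha> (set (graph_apps n A)) \<and> \<alpha> a \<noteq> \<alpha> b" if "b < num_vars n" "b \<noteq> a" for b
    using that(1)
  proof (cases rule: var_cases)
    case 1
    then show ?thesis
      using satisfies_extend_sol[of n A "\<lambda>x. x = a"] that \<open>a < n\<close>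
      by (intro exI[of _ "extend_sol n A (\<lambda>x. x = a)"]) (simp add: extend_sol_simps)
  next
    case (2 u v)
    \<comment> \<open>If all vertices are false, all pair variables are true.\<close>
    then show ?thesis
      using satisfies_extend_sol[of n A "\<lambda>x. False"] \<open>a < n\<close>
      by (intro exI[of _ "extend_sol n A (\<lambda>x. False)"]) (simp add: extend_sol_simps)
  qed
  ultimately show ?thesis using 1 by (simp add: twin_free_def)
next
  case (2 u v)
  have "\<not> twin_free (\<lambda>\<alpha>. satisfies \<alpha> (set (graph_apps n A))) (num_vars n) a"
  proof (cases "A u v")
    case True
    then have "u \<noteq> v" using assms(2) by auto
    moreover have "v = u" if "pair_var n v u = pair_var n u v"
      using pair_var_div_mod(1)[OF 2(1), of v] pair_var_div_mod(1)[OF 2(2), of u] that by simp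
    ultimately have "pair_var n v u \<noteq> a" using 2(3) by metis
    moreover have "\<alpha> a = \<alpha> (pair_var n v u)" if "satisfies \<alpha> (set (graph_apps n A))" for \<alpha>
      using satisfies_graph_appsD[OF that 2(1,2)] satisfies_graph_appsD[OF that 2(2,1)] True assms(1)[OF True] 2(3)
      by auto
    ultimately show ?thesis using pair_var_less[OF 2(2,1)] unfolding twin_free_def by blast
  next
    case False
    then have "\<alpha> a" if "satisfies \<alpha> (set (graph_apps n A))" for \<alpha>
      using satisfies_graph_appsD[OF that 2(1,2)] False 2(3) by simp
    then show ?thesis unfolding twin_free_def by blast
  qed
  then show ?thesis using 2 by (simp add: pair_var_def)
qed

text \<open>Linking \<open>a\<close> and \<open>b\<close> means that some variable equals
  \<open>1 + x_a + x_b\<close> on all solutions. As vertex values are free, no vertex does, and a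
  pair variable does only if it belongs to the edge between \<open>a\<close> and
  \<open>b\<close>.\<close>

lemma linked_graph_apps:
  assumes "\<And>u v. A u v \<Longrightarrow> A v u" "a < n" "b < n" "a \<noteq> b"
  shows "linked (\<lambda>\<alpha>. satisfies \<alpha> (set (graph_apps n A))) (num_vars n) a b \<longleftrightarrow> A a b"
proof
  assume "A a b"
  then have "(\<alpha> a \<noteq> \<alpha> b) \<noteq> \<alpha> (pair_var n a b)" if "satisfies \<alpha> (set (graph_apps n A))" for \<alpha>
    using satisfies_graph_appsD[OF that assms(2,3)] by auto
  then show "linked (\<lambda>\<alpha>. satisfies \<alpha> (set (graph_apps n A))) (num_vars n) a b"
    using pair_var_less[OF assms(2,3)] unfolding linked_def by blast
next
  assume "linked (\<lambda>\<alpha>. satisfies \<alpha> (set (graph_apps n A))) (num_vars n) a b"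
  then obtain c where c: "c < num_vars n"
    "\<And>\<alpha>. satisfies \<alpha> (set (graph_apps n A)) \<Longrightarrow> (\<alpha> a \<noteq> \<alpha> b) \<noteq> \<alpha> c"
    unfolding linked_def by blast
  have odd: "(\<beta> a \<noteq> \<beta> b) \<noteq> extend_sol n A \<beta> c" for \<beta> :: "nat \<Rightarrow> bool"
    using c(2)[OF satisfies_extend_sol[of n A \<beta>]] assms(2,3) by (simp add: extend_sol_simps)
  show "A a b"
    using c(1)
  proof (cases rule: var_cases)
    case 1
    then show ?thesis using odd[of "\<lambda>_. False"] by (simp add: extend_sol_simps)
  next
    case (2 u v)
    have *: "(\<beta> a \<noteq> \<beta> b) \<noteq> (A u v \<longrightarrow> \<beta> u = \<beta> v)" for \<beta> :: "nat \<Rightarrow> bool"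
      using odd[of \<beta>] 2 by (simp add: extend_sol_simps)
    \<comment> \<open>The assignment true at \<open>a\<close> alone forces the pair variable to be
      false, so \<open>u\<close>, \<open>v\<close> are adjacent and exactly one of them is
      \<open>a\<close>; likewise for \<open>b\<close>.\<close>
    have "A u v" using *[of "\<lambda>x. x = a"] assms(4) by auto
    moreover have "{a, b} = {u, v}"
      using *[of "\<lambda>x. x = a"] *[of "\<lambda>x. x = b"] assms(4) by auto
    ultimately show ?thesis using assms(1) by (auto simp: doubleton_eq_iff)
  qed
qed

text \<open>Composition with \<pi> is a bijection between the two solution sets, and \<pi> permutes
  the variables, so all quantifiers in both notions can be reindexed.\<close>

lemma transport_sol:
  assumes "\<pi> permutes {..<N}" "\<And>\<alpha>. P (\<alpha> \<circ> \<pi>) \<longleftrightarrow> P' \<alpha>"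
  shows "twin_free P' N (\<pi> a) \<longleftrightarrow> twin_free P N a" "linked P' N (\<pi> a) (\<pi> b) \<longleftrightarrow> linked P N a b"
proof -
  let ?\<rho> = "inv \<pi>"
  have inv: "?\<rho> (\<pi> x) = x" "\<pi> (?\<rho> x) = x" for x using permutes_inverses[OF assms(1)] by auto
  have P: "P \<beta> \<longleftrightarrow> P' (\<beta> \<circ> ?\<rho>)" for \<beta>
    using assms(2)[of "\<beta> \<circ> ?\<rho>"] by (simp add: comp_assoc comp_def inv)
  have less: "\<pi> x < N \<longleftrightarrow> x < N" for x using permutes_in_image[OF assms(1), of x] by simp
  have ex: "(\<exists>\<alpha>. P' \<alpha> \<and> R (\<alpha> \<circ> \<pi>)) \<longleftrightarrow> (\<exists>\<beta>. P \<beta> \<and> R \<beta>)" for R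
  proof
    assume "\<exists>\<beta>. P \<beta> \<and> R \<beta>"
    then obtain \<beta> where "P \<beta>" "R \<beta>" by blast
    moreover have "\<beta> \<circ> ?\<rho> \<circ> \<pi> = \<beta>" by (simp add: fun_eq_iff inv)
    ultimately show "\<exists>\<alpha>. P' \<alpha> \<and> R (\<alpha> \<circ> \<pi>)" using P by (intro exI[of _ "\<beta> \<circ> ?\<rho>"]) simp
  qed (use assms(2) in blast)
  have ex1: "(\<exists>\<alpha>. P' \<alpha> \<and> \<not> \<alpha> (\<pi> x)) \<longleftrightarrow> (\<exists>\<beta>. P \<beta> \<and> \<not> \<beta> x)" for x
    using ex[of "\<lambda>\<beta>. \<not> \<beta> x"] by simp
  have ex2: "(\<exists>\<alpha>. P' \<alpha> \<and> \<alpha> (\<pi> x) \<noteq> \<alpha> (\<pi> y)) \<longleftrightarrow> (\<exists>\<beta>. P \<beta> \<and> \<beta> x \<noteq> \<beta> y)" for x y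
    using ex[of "\<lambda>\<beta>. \<beta> x \<noteq> \<beta> y"] by simp
  have ex3: "(\<forall>\<alpha>. P' \<alpha> \<longrightarrow> ((\<alpha> (\<pi> x) \<noteq> \<alpha> (\<pi> y)) \<noteq> \<alpha> (\<pi> z))) \<longleftrightarrow> (\<forall>\<beta>. P \<beta> \<longrightarrow> ((\<beta> x \<noteq> \<beta> y) \<noteq> \<beta> z))" for x y z
    using ex[of "\<lambda>\<beta>. \<not> ((\<beta> x \<noteq> \<beta> y) \<noteq> \<beta> z)"] by auto
  have all: "(\<forall>b<N. R b) \<longleftrightarrow> (\<forall>b<N. R (\<pi> b))" for R
    using less inv(2) by metis
  have eq: "\<pi> x = \<pi> y \<longleftrightarrow> x = y" for x y using inv by metis
  show "twin_free P' N (\<pi> a) \<longleftrightarrow> twin_free P N a"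
    unfolding twin_free_def all[of "\<lambda>b. b \<noteq> \<pi> a \<longrightarrow> (\<exists>\<alpha>. P' \<alpha> \<and> \<alpha> (\<pi> a) \<noteq> \<alpha> b)"] ex1 ex2 eq ..
  have all': "(\<exists>b<N. R b) \<longleftrightarrow> (\<exists>b<N. R (\<pi> b))" for R
    using less inv(2) by metis
  show "linked P' N (\<pi> a) (\<pi> b) \<longleftrightarrow> linked P N a b"
    unfolding linked_def all'[of "\<lambda>c. \<forall>\<alpha>. P' \<alpha> \<longrightarrow> ((\<alpha> (\<pi> a) \<noteq> \<alpha> (\<pi> b)) \<noteq> \<alpha> c)"] ex3 ..
qed

text \<open>A constraint isomorphism preserves being twin-free, hence restricts to the vertices, and
  preserves being linked, hence adjacency. Conversely a graph isomorphism is extended to pair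
  variables componentwise.\<close>

lemma graph_isomorphic_iff_graph_apps:
  assumes "\<And>u v. A u v \<Longrightarrow> A v u" "\<And>u. \<not> A u u" "\<And>u v. A' u v \<Longrightarrow> A' v u" "\<And>u. \<not> A' u u"
  shows "isomorphic {..<num_vars n} (set (graph_apps n A)) (set (graph_apps n A')) \<longleftrightarrow>
    (\<exists>\<phi>. bij_betw \<phi> {..<n} {..<n} \<and> (\<forall>u<n. \<forall>v<n. A u v \<longleftrightarrow> A' (\<phi> u) (\<phi> v)))"
  (is "?iso \<longleftrightarrow> (\<exists>\<phi>. ?graph \<phi>)")
proof
  assume ?iso
  then obtain \<pi> where \<pi>: "\<pi> permutes {..<num_vars n}"
    "\<And>\<alpha>. satisfies (\<alpha> \<circ> \<pi>) (set (graph_apps n A)) \<longleftrightarrow> satisfies \<alpha> (set (graph_apps n A'))"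
    unfolding isomorphic_iff by blast
  note tr = transport_sol[of \<pi> "num_vars n" "\<lambda>\<alpha>. satisfies \<alpha> (set (graph_apps n A))"
      "\<lambda>\<alpha>. satisfies \<alpha> (set (graph_apps n A'))", OF \<pi>]
  have less: "\<pi> a < n \<longleftrightarrow> a < n" if "a < num_vars n" for a
  proof -
    have "\<pi> a < num_vars n" using permutes_in_image[OF \<pi>(1), of a] that by simp
    then show ?thesis
      using tr(1)[of a] twin_free_graph_apps[of A a n] twin_free_graph_apps[of A' "\<pi> a" n] that assms by blast
  qed
  have inj: "inj \<pi>" using \<pi>(1) by (rule permutes_inj)
  have "\<pi> ` {..<n} \<subseteq> {..<n}" using less by auto
  then have bij: "bij_betw \<pi> {..<n} {..<n}"
    using endo_inj_surj[OF finite_lessThan] inj_on_subset[OF inj subset_UNIV, of "{..<n}"]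
    by (simp add: bij_betw_def)
  have "A u v \<longleftrightarrow> A' (\<pi> u) (\<pi> v)" if "u < n" "v < n" for u v
  \<comment> \<open>\<open>linked\<close> captures adjacency of distinct vertices only; for equal
    ones both sides are false by irreflexivity.\<close>
  proof (cases "u = v")
    case False
    then have "\<pi> u \<noteq> \<pi> v" using inj by (auto dest: injD)
    moreover have "\<pi> u < n" "\<pi> v < n" using less that by auto
    ultimately show ?thesis
      using tr(2)[of u v] linked_graph_apps[of A u n v] linked_graph_apps[of A' "\<pi> u" n "\<pi> v"] that False assms
      by blast
  qed (use assms in auto)
  then show "\<exists>\<phi>. ?graph \<phi>" using bij by blast
next
  assume "\<exists>\<phi>. ?graph \<phi>"
  then obtain \<phi> where bij: "bij_betw \<phi> {..<n} {..<n}" and \<phi>: "\<And>u v. u < n \<Longrightarrow> v < n \<Longrightarrow> A u v \<longleftrightarrow> A' (\<phi> u) (\<phi> v)"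
    by blast
  have less: "\<phi> u < n" if "u < n" for u using bij that by (auto simp: bij_betw_def)
  define \<pi> where "\<pi> x = (if x < n then \<phi> x else if x < num_vars n then
     pair_var n (\<phi> ((x - n) div n)) (\<phi> ((x - n) mod n)) else x)" for x
  have \<pi>1: "\<pi> u = \<phi> u" if "u < n" for u using that by (simp add: \<pi>_def)
  have \<pi>2: "\<pi> (pair_var n u v) = pair_var n (\<phi> u) (\<phi> v)" if "u < n" "v < n" for u v
    using that pair_var_less[OF that] by (simp add: \<pi>_def pair_var_div_mod) (simp add: pair_var_def)
  have inj\<phi>: "\<phi> u = \<phi> v \<longleftrightarrow> u = v" if "u < n" "v < n" for u v
    using bij that by (auto simp: bij_betw_def inj_on_def)
  have inj2: "u = u' \<and> v = v'" if "pair_var n u v = pair_var n u' v'" "v < n" "v' < n" for u v u' v'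
    using that pair_var_div_mod by metis
  have "inj_on \<pi> {..<num_vars n}"
  proof (rule inj_onI)
    fix x y assume "x \<in> {..<num_vars n}" "y \<in> {..<num_vars n}" and eq: "\<pi> x = \<pi> y"
    then have x: "x < num_vars n" and y: "y < num_vars n" by auto
    from x show "x = y"
    proof (cases rule: var_cases)
      case 1
      note x1 = 1
      from y show ?thesis
      proof (cases rule: var_cases)
        case 1
        then show ?thesis using x1 eq \<pi>1 inj\<phi> by simp
      next
        case (2 u v)
        then show ?thesis using x1 eq \<pi>1 \<pi>2 less[of x] by (simp add: pair_var_def)
      qed
    next
      case (2 u v)
      note x2 = 2
      from y show ?thesis
      proof (cases rule: var_cases)
        case 1
        then show ?thesis using x2 eq \<pi>1 \<pi>2 less[of y] by (simp add: pair_var_def)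
      next
        case (2 u' v')
        then show ?thesis using x2 eq \<pi>2 inj\<phi> less inj2[of "\<phi> u" "\<phi> v" "\<phi> u'" "\<phi> v'"] by simp
      qed
    qed
  qed
  moreover have "\<pi> ` {..<num_vars n} \<subseteq> {..<num_vars n}"
  proof
    fix y assume "y \<in> \<pi> ` {..<num_vars n}"
    then obtain x where x: "x < num_vars n" "y = \<pi> x" by auto
    from x(1) show "y \<in> {..<num_vars n}"
    proof (cases rule: var_cases)
      case 1
      then show ?thesis using \<pi>1 less x(2) by (simp add: trans_less_add1)
    next
      case (2 u v)
      then show ?thesis using \<pi>2 less x(2) pair_var_less by simp
    qed
  qed
  ultimately have "bij_betw \<pi> {..<num_vars n} {..<num_vars n}"
    by (simp add: bij_betw_def endo_inj_surj)
  moreover have "\<pi> x = x" if "x \<notin> {..<num_vars n}" for x using that by (simp add: \<pi>_def)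
  ultimately have perm: "\<pi> permutes {..<num_vars n}" by (rule bij_imp_permutes)
  have "satisfies (\<alpha> \<circ> \<pi>) (set (graph_apps n A)) \<longleftrightarrow> satisfies \<alpha> (set (graph_apps n A'))" for \<alpha>
  proof -
    have all: "(\<forall>u<n. R u) \<longleftrightarrow> (\<forall>u<n. R (\<phi> u))" for R :: "nat \<Rightarrow> bool"
      using bij unfolding bij_betw_def by (metis image_eqI image_iff lessThan_iff)
    have "satisfies \<alpha> (set (graph_apps n A')) \<longleftrightarrow>
        (\<forall>u<n. \<forall>v<n. \<alpha> (pair_var n (\<phi> u) (\<phi> v)) \<longleftrightarrow> (A' (\<phi> u) (\<phi> v) \<longrightarrow> \<alpha> (\<phi> u) = \<alpha> (\<phi> v)))"
      unfolding satisfies_graph_apps by (subst all, subst (2) all) (rule refl)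
    then show ?thesis unfolding satisfies_graph_apps using \<pi>1 \<pi>2 \<phi> by simp
  qed
  with perm show ?iso unfolding isomorphic_iff by blast
qed

section \<open>Reading a pair of graphs\<close>

definition equal_regs :: "nat \<Rightarrow> nat \<Rightarrow> test" where
  "equal_regs r s = TAnd (TNot (Less r s)) (TNot (Less s r))"

lemma eval_equal_regs [simp]: "eval w (equal_regs r s) \<sigma> \<longleftrightarrow> reg \<sigma> r = reg \<sigma> s"
  by (auto simp: equal_regs_def)

definition enc_edge :: "nat \<times> nat \<Rightarrow> bool list" where
  "enc_edge = (\<lambda>(u, v). enc_nat u @ enc_nat v)"

definition valid_edge :: "nat \<Rightarrow> nat \<times> nat \<Rightarrow> bool" where
  "valid_edge n = (\<lambda>(u, v). u < n \<and> v < n \<and> u \<noteq> v)"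

lemma enc_edge_prefix: "enc_edge x @ xs = enc_edge y @ ys \<Longrightarrow> x = y \<and> xs = ys"
  by (auto simp: enc_edge_def split: prod.splits dest!: enc_nat_prefix)

lemma simple_graph_edges: "simple_graph {..<n} (edge_set es) \<longleftrightarrow> (\<forall>x \<in> set es. valid_edge n x)"
  by (fastforce simp: simple_graph_def edge_set_def valid_edge_def card_2_iff')

definition adj :: "(nat \<times> nat) list \<Rightarrow> nat \<Rightarrow> nat \<Rightarrow> bool" where
  "adj es u v \<longleftrightarrow> {u, v} \<in> edge_set es"

lemma adj_iff: "adj es u v \<longleftrightarrow> (u, v) \<in> set es \<or> (v, u) \<in> set es"
  by (force simp: adj_def edge_set_def doubleton_eq_iff)

lemma adj_Nil [simp]: "\<not> adj [] u v"
  by (simp add: adj_iff)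

text \<open>
  Register 3 holds the number of vertices of the first graph, register 6 that of the second, and
  array \<open>a\<close> the adjacency matrix.
\<close>

lemma parses_sticky: "parses w I p e V Q \<Longrightarrow> sticky p"
  by (simp add: parses_def)

definition parse_edge :: "nat \<Rightarrow> prog" where
  "parse_edge a = ((parse_nat 4 2 ;; parse_nat 5 2) ;;
     Cond (TAnd (Less 4 3) (TAnd (Less 5 3) (TNot (equal_regs 4 5)))) Skip (Inc fail_reg)) ;;
     (Put a 4 5 True ;; Put a 5 4 True)"

definition edges_read :: "nat \<Rightarrow> nat \<Rightarrow> (nat \<times> nat) list \<Rightarrow> store \<Rightarrow> bool" where
  "edges_read n a es \<sigma> \<longleftrightarrow> reg \<sigma> 3 = n \<and> (\<forall>u v. arr \<sigma> a u v \<longleftrightarrow> adj es u v)"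

lemma parse_edge_simps [simp]: "mod_regs (parse_edge a) = {0, 1, 2, 4, 5}" "mod_arrs (parse_edge a) = {a}"
    "silent (parse_edge a)"
  by (auto simp: parse_edge_def)

lemma parses_nat_pair:
  "parses w I (parse_nat 4 2 ;; parse_nat 5 2) enc_edge (\<lambda>_. True)
    (\<lambda>(u, v) \<sigma> \<sigma>'. reg \<sigma>' 4 = u \<and> reg \<sigma>' 5 = v)"
  by (rule parses_conv[OF parses_seq[OF parses_nat parses_nat, where I' = "\<lambda>_ _. True"]])
     (auto simp: enc_edge_def exec_reg_frame parses_sticky[OF parses_nat] dest: enc_nat_prefix)

lemma parses_edge:
  "parses w (edges_read n a es) (parse_edge a) enc_edge (valid_edge n)
    (\<lambda>x \<sigma> \<sigma>'. edges_read n a (es @ [x]) \<sigma>')"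
proof -
  let ?p = "(parse_nat 4 2 ;; parse_nat 5 2) ;;
     Cond (TAnd (Less 4 3) (TAnd (Less 5 3) (TNot (equal_regs 4 5)))) Skip (Inc fail_reg)"
  let ?Q = "\<lambda>x \<sigma> \<sigma>'. case x of (u, v) \<Rightarrow> reg \<sigma>' 4 = u \<and> reg \<sigma>' 5 = v"
  have "parses w (edges_read n a es) ?p enc_edge (\<lambda>x. True \<and> valid_edge n x) ?Q"
    by (rule parses_check[OF parses_conv[OF parses_nat_pair]])
       (auto simp: valid_edge_def edges_read_def exec_reg_frame dest: enc_edge_prefix)
  then have "parses w (edges_read n a es) (parse_edge a) enc_edge (\<lambda>x. True \<and> valid_edge n x)
      (\<lambda>x \<sigma> \<sigma>'. edges_read n a (es @ [x]) \<sigma>')"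
    unfolding parse_edge_def
    by (rule parses_act) (auto simp: edges_read_def exec_reg_frame exec_arr_frame adj_iff)
  then show ?thesis by simp
qed

lemma parses_edges:
  "parses w (edges_read n a []) (parse_list (parse_edge a) 2) (enc_list enc_edge)
    (\<lambda>es. \<forall>x \<in> set es. valid_edge n x) (\<lambda>es \<sigma> \<sigma>'. edges_read n a es \<sigma>')"
  by (rule parses_list[OF parses_edge])
     (auto simp: edges_read_def dest: enc_edge_prefix)

definition enc_graphs :: "(nat \<times> (nat \<times> nat) list) \<times> (nat \<times> (nat \<times> nat) list) \<Rightarrow> bool list" where
  "enc_graphs = (\<lambda>((n, es), (m, fs)). enc_graph n es @ enc_graph m fs)"

text \<open>Graphs of different sizes are never isomorphic, so they may be rejected like malformed
  input. The remaining pairs can share one variable set, as an instance requires.\<close>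

definition valid_graphs :: "(nat \<times> (nat \<times> nat) list) \<times> (nat \<times> (nat \<times> nat) list) \<Rightarrow> bool" where
  "valid_graphs = (\<lambda>((n, es), (m, fs)). m = n \<and> (\<forall>x \<in> set es. valid_edge n x) \<and> (\<forall>x \<in> set fs. valid_edge n x))"

lemma enc_graph_alt: "enc_graph n es = enc_nat n @ enc_list enc_edge es"
  by (simp add: enc_graph_def enc_edge_def)

lemma enc_edges_prefix: "enc_list enc_edge es @ xs = enc_list enc_edge fs @ ys \<Longrightarrow> es = fs \<and> xs = ys"
  by (rule enc_list_prefix[where V = "\<lambda>_. True"]) (auto dest: enc_edge_prefix)

lemma enc_graph_prefix: "enc_graph n es @ xs = enc_graph m fs @ ys \<Longrightarrow> (n, es) = (m, fs) \<and> xs = ys"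
  by (auto simp: enc_graph_alt dest!: enc_nat_prefix enc_edges_prefix)

lemma enc_graphs_prefix: "enc_graphs x @ xs = enc_graphs y @ ys \<Longrightarrow> x = y \<and> xs = ys"
  by (auto simp: enc_graphs_def split: prod.splits dest!: enc_graph_prefix)

lemma GI_enc_graphs:
  "enc_graphs ((n, es), (m, fs)) \<in> GI \<longleftrightarrow> valid_graphs ((n, es), (m, fs)) \<and>
    (\<exists>\<phi>. bij_betw \<phi> {..<n} {..<n} \<and> (\<forall>u<n. \<forall>v<n. adj es u v \<longleftrightarrow> adj fs (\<phi> u) (\<phi> v)))"
proof -
  have "enc_graphs ((n, es), (m, fs)) \<in> GI \<longleftrightarrow> simple_graph {..<n} (edge_set es) \<and> simple_graph {..<m} (edge_set fs) \<and>
     graph_isomorphic {..<n} (edge_set es) {..<m} (edge_set fs)"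
  proof
    assume "enc_graphs ((n, es), (m, fs)) \<in> GI"
    then obtain n' es' m' fs' where *: "enc_graphs ((n, es), (m, fs)) = enc_graphs ((n', es'), (m', fs'))"
      "simple_graph {..<n'} (edge_set es') \<and> simple_graph {..<m'} (edge_set fs') \<and>
       graph_isomorphic {..<n'} (edge_set es') {..<m'} (edge_set fs')"
      unfolding GI_def enc_graphs_def by auto
    then show "simple_graph {..<n} (edge_set es) \<and> simple_graph {..<m} (edge_set fs) \<and>
       graph_isomorphic {..<n} (edge_set es) {..<m} (edge_set fs)"
      using enc_graphs_prefix[of "((n, es), (m, fs))" "[]" "((n', es'), (m', fs'))" "[]"] by simp
  qed (auto simp: GI_def enc_graphs_def)
  moreover have "m = n" if "graph_isomorphic {..<n} (edge_set es) {..<m} (edge_set fs)"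
    using that unfolding graph_isomorphic_def by (metis bij_betw_same_card card_lessThan)
  ultimately show ?thesis
    unfolding simple_graph_edges
    by (cases "m = n") (simp_all add: valid_graphs_def graph_isomorphic_def adj_def Ball_def[of "{..<n}"], blast)
qed

definition parse_graphs :: prog where
  "parse_graphs = parse_nat 3 2 ;; parse_list (parse_edge 0) 2 ;;
     (parse_nat 6 2 ;; Cond (equal_regs 3 6) Skip (Inc fail_reg)) ;; parse_list (parse_edge 1) 2"

definition graphs_read :: "(nat \<times> (nat \<times> nat) list) \<times> (nat \<times> (nat \<times> nat) list) \<Rightarrow> store \<Rightarrow> bool" where
  "graphs_read = (\<lambda>((n, es), (m, fs)) \<sigma>. reg \<sigma> 3 = n \<and> arr \<sigma> 0 = adj es \<and> arr \<sigma> 1 = adj fs)"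

lemma parses_map:
  assumes "parses w I p e V Q"
    and "\<And>\<sigma>. I' \<sigma> \<Longrightarrow> I \<sigma>"
    and "\<And>x. V x \<Longrightarrow> V' (g x) \<and> e' (g x) = e x"
    and "\<And>x \<sigma>. I' \<sigma> \<Longrightarrow> V x \<Longrightarrow> Q x \<sigma> (exec w p \<sigma>) \<Longrightarrow> Q' (g x) \<sigma> (exec w p \<sigma>)"
    and "\<And>z. V' z \<Longrightarrow> \<exists>x. V x \<and> g x = z"
  shows "parses w I' p e' V' Q'"
proof (rule parses_conv[OF assms(1)])
  show "\<exists>z. V' z \<and> e' z = e x \<and> Q' z \<sigma> (exec w p \<sigma>)" if "I' \<sigma>" "V x" "Q x \<sigma> (exec w p \<sigma>)" for x \<sigma>
    using assms(3,4) that by blast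
  show "\<exists>x. V x \<and> e x = e' z" if "V' z" for z
    using assms(3,5) that by metis
qed (rule assms(2))

lemma parses_graphs:
  "parses w (\<lambda>\<sigma>. arr \<sigma> = (\<lambda>_ _ _. False)) parse_graphs enc_graphs valid_graphs (\<lambda>x \<sigma> \<sigma>'. graphs_read x \<sigma>')"
proof -
  let ?l = "\<lambda>a. parse_list (parse_edge a) 2"
  let ?m = "parse_nat 6 2 ;; Cond (equal_regs 3 6) Skip (Inc fail_reg)"
  let ?V = "\<lambda>n es. \<forall>x \<in> set es. valid_edge n x"
  have sticky: "sticky (?l a)" for a using parses_sticky[OF parses_edges] .
  have sticky': "sticky (parse_nat 6 2)" by (simp add: parse_nat_def)
  have "parses w (\<lambda>\<sigma>. reg \<sigma> 3 = n) ?m enc_nat (\<lambda>m. True \<and> m = n) (\<lambda>x \<sigma> \<sigma>'. reg \<sigma>' 6 = x)" for n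
    by (rule parses_check[OF parses_nat]) (auto simp: exec_reg_frame dest: enc_nat_prefix)
  then have "parses w (\<lambda>\<sigma>. reg \<sigma> 3 = n \<and> arr \<sigma> 1 = (\<lambda>_ _. False)) ?m enc_nat (\<lambda>m. m = n)
      (\<lambda>m \<sigma> \<sigma>'. edges_read n 1 [] \<sigma>')" for n
    by (rule parses_map[where g = "\<lambda>x. x"]) (auto simp: edges_read_def exec_reg_frame exec_arr_frame)
  from parses_seq[OF this parses_edges]
  have 1: "parses w (\<lambda>\<sigma>. reg \<sigma> 3 = n \<and> arr \<sigma> 1 = (\<lambda>_ _. False)) (?m ;; ?l 1)
     (\<lambda>(m, fs). enc_nat m @ enc_list enc_edge fs) (\<lambda>(m, fs). m = n \<and> ?V n fs)
     (\<lambda>(m, fs) \<sigma> \<sigma>'. edges_read n 1 [] (exec w ?m \<sigma>) \<and> edges_read n 1 fs \<sigma>')" for n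
    by (rule parses_map[where g = "\<lambda>x. x"]) (auto dest: enc_nat_prefix intro: sticky)
  have "parses w (\<lambda>\<sigma>. reg \<sigma> 3 = n \<and> arr \<sigma> = (\<lambda>_ _ _. False)) (?l 0) (enc_list enc_edge) (?V n)
     (\<lambda>es \<sigma> \<sigma>'. reg \<sigma>' 3 = n \<and> arr \<sigma>' 0 = adj es \<and> arr \<sigma>' 1 = (\<lambda>_ _. False))" for n
    by (rule parses_map[OF parses_edges[where n = n], where g = "\<lambda>x. x"])
       (auto simp: edges_read_def exec_arr_frame fun_eq_iff)
  from parses_seq[OF this 1]
  have "parses w (\<lambda>\<sigma>. reg \<sigma> 3 = n \<and> arr \<sigma> = (\<lambda>_ _ _. False)) (?l 0 ;; ?m ;; ?l 1)
     (\<lambda>(es, (m, fs)). enc_list enc_edge es @ enc_nat m @ enc_list enc_edge fs)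
     (\<lambda>(es, (m, fs)). ?V n es \<and> m = n \<and> ?V n fs)
     (\<lambda>(es, (m, fs)) \<sigma> \<sigma>'. reg \<sigma>' 3 = reg \<sigma> 3 \<and> arr \<sigma>' 0 = adj es \<and> arr \<sigma>' 1 = adj fs)" for n
    by (rule parses_map[where g = "\<lambda>x. x"])
       (auto simp: edges_read_def exec_reg_frame exec_arr_frame fun_eq_iff dest: enc_edges_prefix intro: sticky sticky')
  note 2 = this
  have "parses w (\<lambda>\<sigma>. arr \<sigma> = (\<lambda>_ _ _. False)) (parse_nat 3 2) enc_nat (\<lambda>_. True)
     (\<lambda>n \<sigma> \<sigma>'. reg \<sigma>' 3 = n \<and> arr \<sigma>' = (\<lambda>_ _ _. False))"
    by (rule parses_map[OF parses_nat, where g = "\<lambda>x. x"]) (auto simp: exec_arr_frame fun_eq_iff)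
  from parses_seq[OF this 2]
  have 3: "parses w (\<lambda>\<sigma>. arr \<sigma> = (\<lambda>_ _ _. False)) parse_graphs
     (\<lambda>(n, (es, (m, fs))). enc_nat n @ enc_list enc_edge es @ enc_nat m @ enc_list enc_edge fs)
     (\<lambda>(n, (es, (m, fs))). ?V n es \<and> m = n \<and> ?V n fs)
     (\<lambda>(n, (es, (m, fs))) \<sigma> \<sigma>'. graphs_read ((n, es), (m, fs)) \<sigma>')" unfolding parse_graphs_def
    by (rule parses_map[where g = "\<lambda>x. x"])
       (auto simp: graphs_read_def dest: enc_nat_prefix intro: sticky sticky')
  show ?thesis
    by (rule parses_map[OF 3, where g = "\<lambda>(n, (es, (m, fs))). ((n, es), (m, fs))"])
       (auto simp: enc_graphs_def enc_graph_alt valid_graphs_def)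
qed

section \<open>Writing the equations of a graph\<close>

definition xor3_table :: "bool list" where
  "xor3_table = [False, True, True, False, True, False, False, True]"

lemma enc_application_xor3:
  "enc_application (xor3, [a, b, c]) =
     (True # enc_arg a) @ (True # enc_arg b) @ (True # enc_arg c) @ False # xor3_table"
proof -
  have "map (\<lambda>t. t \<in> xor3) (List.n_lists 3 [False, True]) = xor3_table"
    by (simp add: numeral_3_eq_3 xor3_iff xor3_table_def)
  then show ?thesis by (simp add: enc_application_def enc_list_def numeral_3_eq_3)
qed

text \<open>The fixed bits are list marks and tags: \<open>True, True\<close> opens an item that is
  a variable, a leading \<open>False\<close> ends the preceding unary number, and the second
  \<open>False\<close> at the end closes the argument list.\<close>

definition emit_vars :: "prog \<Rightarrow> prog \<Rightarrow> prog \<Rightarrow> prog" where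
  "emit_vars p q r = emit_list [True, True] ;; p ;; emit_list [False, True, True] ;; q ;;
     emit_list [False, True, True] ;; r ;; emit_list ([False, False] @ xor3_table)"

definition emit_pair_var :: prog where
  "emit_pair_var = emit_unary 3 ;; emit_product 7 3 ;; emit_unary 8"

definition emit_equations :: "nat \<Rightarrow> prog" where
  "emit_equations a = For 7 3 (For 8 3 (Emit True ;;
     Cond (Bit a 7 8) (emit_vars (emit_unary 7) (emit_unary 8) emit_pair_var)
       (emit_vars emit_pair_var emit_pair_var emit_pair_var)))"

lemma emit_vars_simps [simp]: "mod_regs (emit_vars p q r) = mod_regs p \<union> mod_regs q \<union> mod_regs r"
    "mod_arrs (emit_vars p q r) = mod_arrs p \<union> mod_arrs q \<union> mod_arrs r"
  by (auto simp: emit_vars_def)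

lemma emit_pair_var_simps [simp]: "mod_regs emit_pair_var = {}" "mod_arrs emit_pair_var = {}"
  "exec w emit_pair_var \<sigma> = \<sigma>\<lparr>outp := outp \<sigma> @ replicate (pair_var (reg \<sigma> 3) (reg \<sigma> 7) (reg \<sigma> 8)) True\<rparr>"
  by (auto simp: emit_pair_var_def pair_var_def replicate_add[symmetric])

lemma emit_equations_simps [simp]: "mod_regs (emit_equations a) = {7, 8}" "mod_arrs (emit_equations a) = {}"
  by (auto simp: emit_equations_def)

lemma concat_concat_map: "concat (concat (map f xs)) = concat (map (\<lambda>x. concat (f x)) xs)"
  by (induction xs) auto

lemma outp_emit_equations:
  assumes "reg \<sigma> 3 = n" "n \<le> bound w"
  shows "outp (exec w (emit_equations a) \<sigma>) = outp \<sigma> @ enc_items enc_application (graph_apps n (arr \<sigma> a))"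
proof -
  let ?f = "\<lambda>u v. True # enc_application (pair_app n (arr \<sigma> a) u v)"
  have "outp (exec w (emit_equations a) \<sigma>) = outp \<sigma> @ concat (map (\<lambda>u. concat (map (?f u) [0..<n])) [0..<n])"
    unfolding emit_equations_def
  proof (rule For_outp[OF assms(1,2)], goal_cases)
    case (3 u \<tau>)
    have "reg \<tau> 3 = n" using 3 assms(1) by simp
    then show ?case
    proof (rule For_outp[OF _ assms(2)], goal_cases)
      case (3 v \<upsilon>)
      then show ?case using assms(2) \<open>reg \<tau> 7 = u\<close> \<open>reg \<tau> 3 = n\<close> \<open>\<And>a. _ \<Longrightarrow> arr \<tau> a = arr \<sigma> a\<close>
        by (auto simp: emit_vars_def pair_app_def Let_def enc_application_xor3 enc_nat_def)
    qed auto
  qed auto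
  then show ?thesis by (simp add: graph_apps_def map_concat comp_def concat_concat_map)
qed

definition graph_program :: prog where
  "graph_program = parse_then parse_graphs
     (emit_unary 3 ;; emit_product 3 3 ;; Emit False ;; emit_equations 0 ;; Emit False ;; emit_equations 1 ;; Emit False)"

lemma parses_graphs_bound: "w = enc_graphs ((n, es), (m, fs)) \<Longrightarrow> n \<le> bound w"
  by (simp add: enc_graphs_def enc_graph_def enc_nat_def bound_def)

lemma silent_parse_graphs: "silent parse_graphs"
  by (simp add: parse_graphs_def)

lemma graph_program_cases:
  obtains n es fs where "w = enc_graphs ((n, es), (n, fs))" "valid_graphs ((n, es), (n, fs))"
      "outp (exec w graph_program init_store) =
        enc_instance (num_vars n) (graph_apps n (adj es)) (graph_apps n (adj fs))"
    | "w \<notin> GI" "outp (exec w graph_program init_store) = []"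
proof -
  let ?q = "emit_unary 3 ;; emit_product 3 3 ;; Emit False ;; emit_equations 0 ;; Emit False ;; emit_equations 1 ;; Emit False"
  have GI: "\<exists>n es m fs. w = enc_graphs ((n, es), (m, fs)) \<and> valid_graphs ((n, es), (m, fs))" if "w \<in> GI"
  proof -
    obtain n es m fs where w: "w = enc_graphs ((n, es), (m, fs))"
      using \<open>w \<in> GI\<close> unfolding GI_def enc_graphs_def prod.case by blast
    then show ?thesis using that GI_enc_graphs by blast
  qed
  have init: "arr init_store = (\<lambda>_ _ _. False)" by (simp add: init_store_def)
  show ?thesis
    using parses_graphs init silent_parse_graphs
  proof (cases rule: outp_parse_then[where q = ?q and w = w])
    case (1 x)
    obtain n es m fs where x: "x = ((n, es), (m, fs))" by (cases x) auto
    have m: "m = n" using 1(1) x by (simp add: valid_graphs_def)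
    let ?\<sigma> = "exec w parse_graphs init_store"
    have "n \<le> bound w" using 1(2) x parses_graphs_bound by simp
    moreover have "reg ?\<sigma> 3 = n" "arr ?\<sigma> 0 = adj es" "arr ?\<sigma> 1 = adj fs"
      using 1(3) x by (simp_all add: graphs_read_def)
    ultimately have "outp (exec w ?q ?\<sigma>) = enc_instance (num_vars n) (graph_apps n (adj es)) (graph_apps n (adj fs))"
      using 1(6)
      by (simp add: outp_emit_equations exec_reg_frame exec_arr_frame enc_instance_def enc_nat_def enc_list_def replicate_add)
    then show ?thesis using that(1) 1 x m by (simp add: graph_program_def)
  next
    case (2 x y ys)
    have "w \<notin> GI"
    proof
      assume "w \<in> GI"
      then obtain z where "w = enc_graphs z" using GI by blast
      then show False using 2(2) enc_graphs_prefix[of z "[]" x "y # ys"] by simp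
    qed
    then show ?thesis using that(2) 2(3) by (simp add: graph_program_def)
  next
    case 3
    have "w \<notin> GI" using GI 3(1)[where ys = "[]"] by auto
    then show ?thesis using that(2) 3(2) by (simp add: graph_program_def)
  qed
qed

lemma application_of_pair_app:
  assumes "u < n" "v < n"
  shows "application_of {xor3} {..<num_vars n} (pair_app n A u v)" "constant_free (pair_app n A u v)"
proof -
  have "u < num_vars n" "v < num_vars n" "pair_var n u v < num_vars n"
    using assms pair_var_less by (auto intro: trans_less_add1)
  then show "application_of {xor3} {..<num_vars n} (pair_app n A u v)" "constant_free (pair_app n A u v)"
    by (auto simp: application_of_def constant_free_def pair_app_def Let_def xor3_def)
qed

lemma application_of_graph_apps:
  assumes "a \<in> set (graph_apps n A)"
  shows "application_of {xor3} {..<num_vars n} a \<and> constant_free a"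
proof -
  obtain u v where "u < n" "v < n" "a = pair_app n A u v"
    using assms unfolding set_graph_apps UN_iff image_iff lessThan_iff by blast
  then show ?thesis using application_of_pair_app by simp
qed

section \<open>From constraints to graphs\<close>

subsection \<open>Reading an instance\<close>

text \<open>The flag \<open>cf\<close> says whether constants are forbidden.\<close>

fun valid_arg :: "bool \<Rightarrow> nat \<Rightarrow> nat arg \<Rightarrow> bool" where
  "valid_arg cf n (Var x) \<longleftrightarrow> x < n"
| "valid_arg cf n (Const b) \<longleftrightarrow> \<not> cf"

definition valid_app :: "bool \<Rightarrow> nat \<Rightarrow> nat application \<Rightarrow> bool" where
  "valid_app cf n A \<longleftrightarrow> (\<exists>a b c. A = (xor3, [a, b, c]) \<and> valid_arg cf n a \<and> valid_arg cf n b \<and> valid_arg cf n c)"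

lemma length_3_iff: "length as = 3 \<longleftrightarrow> (\<exists>a b c. as = [a, b, c])"
  by (auto simp: numeral_3_eq_3 length_Suc_conv)

text \<open>As \<open>xor3\<close> is nonempty and consists of triples, being an application of it
  forces exactly three arguments.\<close>

lemma valid_app_iff:
  "valid_app cf n A \<longleftrightarrow> application_of {xor3} {..<n} A \<and> (cf \<longrightarrow> constant_free A)"
proof -
  have arg: "valid_arg cf n a \<longleftrightarrow> set_arg a \<subseteq> {..<n} \<and> (cf \<longrightarrow> (\<exists>x. a = Var x))" for a
    by (cases a) auto
  have len: "(\<forall>t \<in> xor3. length t = length as) \<longleftrightarrow> length as = 3" for as :: "nat arg list"
    by (auto simp: xor3_def)
  obtain C as where A: "A = (C, as)" by (cases A)
  have l3: "length t = 3" if "t \<in> xor3" for t using that by (auto simp: xor3_def)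
  have ne: "xor3 \<noteq> {}" by (simp add: xor3_def)
  have "valid_app cf n (C, as) \<longleftrightarrow> C = xor3 \<and> length as = 3 \<and> (\<forall>a \<in> set as. valid_arg cf n a)"
    unfolding valid_app_def length_3_iff by auto
  then show ?thesis
    unfolding application_of_def constant_free_def arg A by (auto simp: len l3 ne)
qed

lemma enc_arg_prefix: "enc_arg a @ xs = enc_arg b @ ys \<Longrightarrow> a = b \<and> xs = ys"
  by (cases a; cases b) (auto dest: enc_nat_prefix)

text \<open>Validity fixes the constraint, which its truth table alone would not do: the table only
  shows the tuples of the right length.\<close>

lemma enc_app_prefix:
  assumes "valid_app cf n A" "valid_app cf n B" "enc_application A @ xs = enc_application B @ ys"
  shows "A = B \<and> xs = ys"
proof -
  obtain a b c where A: "A = (xor3, [a, b, c])" using assms(1) unfolding valid_app_def by blast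
  obtain a' b' c' where B: "B = (xor3, [a', b', c'])" using assms(2) unfolding valid_app_def by blast
  show ?thesis
    using assms(3) unfolding A B enc_application_xor3 by (auto dest!: enc_arg_prefix)
qed

lemma enc_apps_prefix:
  assumes "\<forall>A \<in> set S. valid_app cf n A" "\<forall>A \<in> set S'. valid_app cf n A"
    "enc_list enc_application S @ xs = enc_list enc_application S' @ ys"
  shows "S = S' \<and> xs = ys"
  by (rule enc_list_prefix[OF enc_app_prefix assms])

section \<open>Instances as strings\<close>

type_synonym inst = "nat \<times> nat application list \<times> nat application list"

definition enc_inst :: "inst \<Rightarrow> bool list" where
  "enc_inst = (\<lambda>(n, S, U). enc_instance n S U)"

definition valid_inst :: "bool \<Rightarrow> inst \<Rightarrow> bool" where
  "valid_inst cf = (\<lambda>(n, S, U). (\<forall>A \<in> set S. valid_app cf n A) \<and> (\<forall>A \<in> set U. valid_app cf n A))"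

lemma enc_inst_prefix:
  assumes "valid_inst cf x" "valid_inst cf y" "enc_inst x @ xs = enc_inst y @ ys"
  shows "x = y \<and> xs = ys"
proof -
  obtain n S U where x: "x = (n, S, U)" by (cases x)
  obtain m T V where y: "y = (m, T, V)" by (cases y)
  have 1: "n = m" "enc_list enc_application S @ enc_list enc_application U @ xs =
      enc_list enc_application T @ enc_list enc_application V @ ys"
    using assms(3) enc_nat_prefix[of n _ m] by (simp_all add: x y enc_inst_def enc_instance_def)
  have valid: "\<forall>A \<in> set S. valid_app cf n A" "\<forall>A \<in> set T. valid_app cf n A"
      "\<forall>A \<in> set U. valid_app cf n A" "\<forall>A \<in> set V. valid_app cf n A"
    using assms(1,2) 1(1) by (simp_all add: x y valid_inst_def)
  have 2: "S = T \<and> enc_list enc_application U @ xs = enc_list enc_application V @ ys"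
    using enc_apps_prefix[OF valid(1,2) 1(2)] .
  have "U = V \<and> xs = ys"
    using enc_apps_prefix[OF valid(3,4) conjunct2[OF 2]] .
  then show ?thesis using 1 2 x y by simp
qed

definition ISO_lang :: "bool \<Rightarrow> language" where
  "ISO_lang cf = (if cf then ISO {xor3} else ISO_c {xor3})"

lemma ISO_lang_alt:
  "ISO_lang cf = {enc_inst (n, S, U) | n S U. valid_inst cf (n, S, U) \<and> isomorphic {..<n} (set S) (set U)}"
  unfolding ISO_lang_def ISO_def ISO_c_def enc_inst_def valid_inst_def valid_app_iff prod.case
  by (cases cf) (simp_all add: ball_Un)

lemma enc_inst_ISO_lang:
  assumes "valid_inst cf (n, S, U)"
  shows "enc_inst (n, S, U) \<in> ISO_lang cf \<longleftrightarrow> isomorphic {..<n} (set S) (set U)"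
proof
  assume "enc_inst (n, S, U) \<in> ISO_lang cf"
  then obtain m T V where *: "enc_inst (n, S, U) = enc_inst (m, T, V)" "valid_inst cf (m, T, V)"
      "isomorphic {..<m} (set T) (set V)"
    unfolding ISO_lang_alt by blast
  then show "isomorphic {..<n} (set S) (set U)"
    using enc_inst_prefix[OF assms *(2), of "[]" "[]"] by simp
next
  assume "isomorphic {..<n} (set S) (set U)"
  then show "enc_inst (n, S, U) \<in> ISO_lang cf" unfolding ISO_lang_alt using assms by blast
qed

text \<open>The applications written contain no constants, so the same map serves for both values of
  \<open>cf\<close>.\<close>

theorem GI_reduces_ISO_lang: "poly_many_one_reducible GI (ISO_lang cf)"
  unfolding poly_many_one_reducible_def
proof (intro exI conjI allI)
  show "polytime_computable (\<lambda>w. outp (exec w graph_program init_store))" by (rule polytime_exec)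
  fix w
  \<comment> \<open>Every code contains at least the bit that ends its first number.\<close>
  have Nil: "[] \<notin> ISO_lang cf"
    by (auto simp: ISO_lang_alt enc_inst_def enc_instance_def enc_nat_def)
  show "w \<in> GI \<longleftrightarrow> outp (exec w graph_program init_store) \<in> ISO_lang cf"
  proof (cases rule: graph_program_cases[of w])
    case (1 n es fs)
    have sym: "adj ds u v \<Longrightarrow> adj ds v u" for ds u v by (auto simp: adj_iff)
    have irrefl: "\<not> adj es u u" "\<not> adj fs u u" for u
      using 1(2) by (auto simp: adj_iff valid_graphs_def valid_edge_def)
    have valid: "valid_inst cf (num_vars n, graph_apps n (adj es), graph_apps n (adj fs))"
      using application_of_graph_apps by (auto simp: valid_inst_def valid_app_iff)
    have "isomorphic {..<num_vars n} (set (graph_apps n (adj es))) (set (graph_apps n (adj fs))) \<longleftrightarrow>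
        (\<exists>\<phi>. bij_betw \<phi> {..<n} {..<n} \<and> (\<forall>u<n. \<forall>v<n. adj es u v \<longleftrightarrow> adj fs (\<phi> u) (\<phi> v)))"
      by (rule graph_isomorphic_iff_graph_apps) (use sym irrefl in auto)
    then have "w \<in> GI \<longleftrightarrow> isomorphic {..<num_vars n} (set (graph_apps n (adj es))) (set (graph_apps n (adj fs)))"
      unfolding 1(1) GI_enc_graphs using 1(2) by simp
    then show ?thesis
      unfolding 1(3) using enc_inst_ISO_lang[OF valid] by (simp add: enc_inst_def)
  next
    case 2
    then show ?thesis using Nil by simp
  qed
qed

subsection \<open>Parsing constraint applications\<close>

text \<open>Numbers are in unary, so this bounds the number \<open>n\<close> of variables by the
  input length and keeps \<open>n + 5\<close> within the registers.\<close>

lemma parses_length: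
  assumes "parses w I p e V Q"
  shows "parses w I p e V (\<lambda>x \<sigma> \<sigma>'. Q x \<sigma> \<sigma>' \<and> length (e x) \<le> length w)"
proof -
  have "length (e x) \<le> length w" if "rest w \<sigma> = e x @ ys" for x ys and \<sigma> :: store
    using arg_cong[OF that, of length] by simp
  then show ?thesis
    using assms unfolding parses_def by blast
qed

lemma parses_branch:
  assumes "parses w I p e V Q" "parses w I q e V' Q"
    and "\<And>x. V x \<Longrightarrow> \<exists>ys. e x = True # ys" "\<And>x. V' x \<Longrightarrow> \<exists>ys. e x = False # ys"
  shows "parses w I (Cond (Input pos_reg 2) p q) e (\<lambda>x. V x \<or> V' x) Q"
  unfolding parses_def
proof (intro conjI allI impI)
  let ?p = "Cond (Input pos_reg 2) p q"
  show "sticky ?p" using assms(1,2) by (simp add: parses_def)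
  fix \<sigma> assume \<sigma>: "I \<sigma>" "good w \<sigma>"
  note t = eval_Input(2)[OF \<sigma>(2)]
  show "(\<exists>x ys. (V x \<or> V' x) \<and> rest w \<sigma> = e x @ ys \<and> good w (exec w ?p \<sigma>) \<and> rest w (exec w ?p \<sigma>) = ys \<and> Q x \<sigma> (exec w ?p \<sigma>)) \<or>
     (0 < reg (exec w ?p \<sigma>) fail_reg \<and> (\<nexists>x ys. (V x \<or> V' x) \<and> rest w \<sigma> = e x @ ys))"
  proof (cases "\<exists>ys. rest w \<sigma> = True # ys")
    case True
    then have p: "exec w ?p \<sigma> = exec w p \<sigma>" using t by (simp del: eval.simps)
    from assms(1) \<sigma> show ?thesis
    proof (cases rule: parses_cases)
      case (1 x ys)
      then show ?thesis unfolding p by blast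
    next
      case 2
      then show ?thesis unfolding p using True assms(4) by fastforce
    qed
  next
    case False
    then have p: "exec w ?p \<sigma> = exec w q \<sigma>" using t by (simp del: eval.simps)
    from assms(2) \<sigma> show ?thesis
    proof (cases rule: parses_cases)
      case (1 x ys)
      then show ?thesis unfolding p by blast
    next
      case 2
      then show ?thesis unfolding p using False assms(3) by fastforce
    qed
  qed
qed

lemma parses_fail: "parses w I (Inc fail_reg) e (\<lambda>_. False) Q"
  by (simp add: parses_def bound_def)

definition add_reg :: "nat \<Rightarrow> nat \<Rightarrow> prog" where
  "add_reg k r = ((;;) (Inc r) ^^ k) Skip"

lemma add_reg_simps [simp]: "mod_regs (add_reg k r) = (if k = 0 then {} else {r})" "mod_arrs (add_reg k r) = {}"
    "silent (add_reg k r)"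
  "reg \<sigma> r + k \<le> bound w \<Longrightarrow> exec w (add_reg k r) \<sigma> = set_reg r (reg \<sigma> r + k) \<sigma>"
proof -
  show "mod_regs (add_reg k r) = (if k = 0 then {} else {r})" "mod_arrs (add_reg k r) = {}" "silent (add_reg k r)"
    by (induction k) (auto simp: add_reg_def)
  show "reg \<sigma> r + k \<le> bound w \<Longrightarrow> exec w (add_reg k r) \<sigma> = set_reg r (reg \<sigma> r + k) \<sigma>"
    by (induction k arbitrary: \<sigma>) (auto simp: add_reg_def set_reg_def)
qed

definition set_const :: "nat \<Rightarrow> nat \<Rightarrow> prog" where
  "set_const r k = Zero r ;; add_reg k r"

lemma set_const_simps [simp]: "mod_regs (set_const r k) = {r}" "mod_arrs (set_const r k) = {}" "silent (set_const r k)"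
  "k \<le> 8 \<Longrightarrow> exec w (set_const r k) \<sigma> = set_reg r k \<sigma>"
  by (auto simp: set_const_def bound_def set_reg_def)

text \<open>
  The elements are three copies \<open>0, 1, 2\<close> of the constant false, two copies \<open>3, 4\<close> of the constant true
  and \<open>x + 5\<close> for every variable \<open>x\<close>. With these copies, every equation in at most three elements is
  equivalent to one in three distinct elements.
\<close>

fun arg_elem :: "nat arg \<Rightarrow> nat" where
  "arg_elem (Var x) = x + 5"
| "arg_elem (Const b) = (if b then 3 else 0)"

text \<open>The first bit read is the list mark in front of the argument. Variables are shifted by 5
  to make room for the copies of the constants; with \<open>cf\<close> set, the alternative of a
  constant fails at once.\<close>

definition parse_arg :: "bool \<Rightarrow> nat \<Rightarrow> prog" where
  "parse_arg cf r = eat True ;; Cond (Input pos_reg 2)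
     (eat True ;; ((parse_nat r 2 ;; Cond (Less r 3) Skip (Inc fail_reg)) ;; add_reg 5 r))
     (if cf then Inc fail_reg
      else eat False ;; Cond (Input pos_reg 2) (eat True ;; set_const r 3) (eat False ;; set_const r 0))"

lemma parse_arg_simps [simp]: "mod_regs (parse_arg cf r) \<subseteq> {0, Suc 0, 2, r}" "mod_arrs (parse_arg cf r) = {}" "silent (parse_arg cf r)"
  by (auto simp: parse_arg_def)

definition vars_read :: "bool list \<Rightarrow> nat \<Rightarrow> store \<Rightarrow> bool" where
  "vars_read w n \<sigma> \<longleftrightarrow> reg \<sigma> 3 = n \<and> n \<le> length w"

lemma parses_eat_seq:
  assumes "parses w I p e V Q" "\<And>v \<sigma>. I \<sigma> \<Longrightarrow> I (set_reg pos_reg v \<sigma>)"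
    and "\<And>x v \<sigma> \<sigma>'. V x \<Longrightarrow> Q x (set_reg pos_reg v \<sigma>) \<sigma>' \<Longrightarrow> Q x \<sigma> \<sigma>'"
  shows "parses w I (eat b ;; p) (\<lambda>x. b # e x) V Q"
proof -
  have "parses w I (eat b ;; p) (\<lambda>(x, y). (\<lambda>_ :: unit. [b]) x @ e y) (\<lambda>(x, y). (\<lambda>_ :: unit. True) x \<and> V y)
      (\<lambda>(x, y) \<sigma> \<sigma>'. (\<lambda>_ \<sigma> \<sigma>'. \<exists>v. \<sigma>' = set_reg pos_reg v \<sigma>) x \<sigma> (exec w (eat b) \<sigma>) \<and> Q y (exec w (eat b) \<sigma>) \<sigma>')"
    by (rule parses_seq[OF parses_eat[where I = I] assms(1)]) (use assms(2) in \<open>auto intro: parses_sticky[OF assms(1)]\<close>)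
  then show ?thesis
    by (rule parses_map[where g = snd]) (use assms(3) in auto)
qed

lemma parses_eat_act:
  assumes "pos_reg \<notin> mod_regs q" "fail_reg \<notin> mod_regs q"
  shows "parses w I (eat b ;; q) (\<lambda>_ :: unit. [b]) (\<lambda>_. True) (\<lambda>_ \<sigma> \<sigma>'. \<exists>v. \<sigma>' = exec w q (set_reg pos_reg v \<sigma>))"
  by (rule parses_act[OF parses_eat assms]) metis

lemma parses_arg:
  assumes "r \<notin> {0, 1, 2, 3}"
  shows "parses w (vars_read w n) (parse_arg cf r) (\<lambda>a. True # enc_arg a) (valid_arg cf n)
    (\<lambda>a \<sigma> \<sigma>'. reg \<sigma>' r = arg_elem a)"
proof -
  let ?I = "vars_read w n" and ?Q = "\<lambda>a \<sigma> \<sigma>'. reg \<sigma>' r = arg_elem a"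
  have I: "?I (set_reg pos_reg v \<sigma>)" if "?I \<sigma>" for v \<sigma> using that by (simp add: vars_read_def)
  have r: "r \<noteq> 0" "r \<noteq> Suc 0" "r \<noteq> 2" "r \<noteq> 3" using assms by auto
  have "parses w ?I (parse_nat r 2 ;; Cond (Less r 3) Skip (Inc fail_reg)) enc_nat (\<lambda>x. True \<and> x < n)
      (\<lambda>x \<sigma> \<sigma>'. reg \<sigma>' r = x)"
    by (rule parses_check[OF parses_nat]) (use r in \<open>auto simp: exec_reg_frame vars_read_def dest: enc_nat_prefix\<close>)
  then have "parses w ?I ((parse_nat r 2 ;; Cond (Less r 3) Skip (Inc fail_reg)) ;; add_reg 5 r) enc_nat (\<lambda>x. True \<and> x < n)
      (\<lambda>x \<sigma> \<sigma>'. reg \<sigma>' r = x + 5)"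
  proof (rule parses_act)
    fix x \<sigma> assume "?I \<sigma>" "True \<and> x < n"
    then have "x + 5 \<le> bound w" by (simp add: vars_read_def bound_def)
    moreover assume "reg (exec w (parse_nat r 2 ;; Cond (Less r 3) Skip (Inc fail_reg)) \<sigma>) r = x"
    ultimately show "reg (exec w (add_reg 5 r) (exec w (parse_nat r 2 ;; Cond (Less r 3) Skip (Inc fail_reg)) \<sigma>)) r = x + 5"
      by (simp del: exec.simps)
  qed (use r in auto)
  then have "parses w ?I (eat True ;; ((parse_nat r 2 ;; Cond (Less r 3) Skip (Inc fail_reg)) ;; add_reg 5 r))
      (\<lambda>x. True # enc_nat x) (\<lambda>x. True \<and> x < n) (\<lambda>x \<sigma> \<sigma>'. reg \<sigma>' r = x + 5)"
    by (rule parses_eat_seq) (auto intro: I)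
  then have 1: "parses w ?I (eat True ;; ((parse_nat r 2 ;; Cond (Less r 3) Skip (Inc fail_reg)) ;; add_reg 5 r))
      enc_arg (\<lambda>a. \<exists>x<n. a = Var x) ?Q"
    by (rule parses_map[where g = Var]) auto
  have "parses w ?I (eat True ;; set_const r 3) (\<lambda>b. [b]) (\<lambda>b. b = True) (\<lambda>b \<sigma> \<sigma>'. reg \<sigma>' r = (if b then 3 else 0))"
    by (rule parses_map[OF parses_eat_act, where g = "\<lambda>_. True"]) (use r in auto)
  moreover have "parses w ?I (eat False ;; set_const r 0) (\<lambda>b. [b]) (\<lambda>b. b = False) (\<lambda>b \<sigma> \<sigma>'. reg \<sigma>' r = (if b then 3 else 0))"
    by (rule parses_map[OF parses_eat_act, where g = "\<lambda>_. False"]) (use r in auto)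
  ultimately have "parses w ?I (Cond (Input pos_reg 2) (eat True ;; set_const r 3) (eat False ;; set_const r 0))
      (\<lambda>b. [b]) (\<lambda>b. b = True \<or> b = False) (\<lambda>b \<sigma> \<sigma>'. reg \<sigma>' r = (if b then 3 else 0))"
    by (rule parses_branch) auto
  then have "parses w ?I (eat False ;; Cond (Input pos_reg 2) (eat True ;; set_const r 3) (eat False ;; set_const r 0))
      (\<lambda>b. False # [b]) (\<lambda>b. b = True \<or> b = False) (\<lambda>b \<sigma> \<sigma>'. reg \<sigma>' r = (if b then 3 else 0))"
    by (rule parses_eat_seq) (auto intro: I)
  then have "parses w ?I (eat False ;; Cond (Input pos_reg 2) (eat True ;; set_const r 3) (eat False ;; set_const r 0))
      enc_arg (\<lambda>a. \<exists>b. a = Const b) ?Q"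
    by (rule parses_map[where g = Const]) auto
  then have 2: "parses w ?I (if cf then Inc fail_reg
      else eat False ;; Cond (Input pos_reg 2) (eat True ;; set_const r 3) (eat False ;; set_const r 0))
      enc_arg (\<lambda>a. \<not> cf \<and> (\<exists>b. a = Const b)) ?Q"
    using parses_fail by (cases cf) simp_all
  have "parses w ?I (parse_arg cf r) (\<lambda>a. True # enc_arg a)
      (\<lambda>a. (\<exists>x<n. a = Var x) \<or> (\<not> cf \<and> (\<exists>b. a = Const b))) ?Q"
    unfolding parse_arg_def by (rule parses_eat_seq[OF parses_branch[OF 1 2]]) (auto intro: I)
  moreover have "(\<lambda>a. (\<exists>x<n. a = Var x) \<or> (\<not> cf \<and> (\<exists>b. a = Const b))) = valid_arg cf n"
  proof
    fix a show "((\<exists>x<n. a = Var x) \<or> (\<not> cf \<and> (\<exists>b. a = Const b))) = valid_arg cf n a"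
      by (cases a) auto
  qed
  ultimately show ?thesis by simp
qed

definition eat_list :: "bool list \<Rightarrow> prog" where
  "eat_list bs = foldr (\<lambda>b p. eat b ;; p) bs Skip"

lemma eat_list_simps [simp]: "mod_regs (eat_list bs) \<subseteq> {0, Suc 0}" "mod_arrs (eat_list bs) = {}" "silent (eat_list bs)"
    "sticky (eat_list bs)"
  by (induction bs) (auto simp: eat_list_def)

lemma parses_eat_list: "parses w (\<lambda>_. True) (eat_list bs) (\<lambda>_ :: unit. bs) (\<lambda>_. True) (\<lambda>_ \<sigma> \<sigma>'. True)"
proof (induction bs)
  case Nil
  then show ?case by (auto simp: parses_def eat_list_def)
next
  case (Cons b bs)
  have "parses w (\<lambda>_. True) (eat b ;; eat_list bs) (\<lambda>_ :: unit. b # bs) (\<lambda>_. True) (\<lambda>_ \<sigma> \<sigma>'. True)"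
    by (rule parses_eat_seq[OF Cons]) auto
  then show ?case by (simp add: eat_list_def)
qed

text \<open>Validity leaves only one arity and one truth table, so the argument list is read by
  three fixed parsers and the rest is compared literally.\<close>

definition parse_app :: "bool \<Rightarrow> prog" where
  "parse_app cf = parse_arg cf 5 ;; parse_arg cf 6 ;; parse_arg cf 7 ;; eat_list (False # xor3_table)"

definition app_elems :: "nat application \<Rightarrow> nat list" where
  "app_elems A = map arg_elem (snd A)"

lemma parse_app_simps [simp]: "mod_regs (parse_app cf) \<subseteq> {0, Suc 0, 2, 5, 6, 7}" "mod_arrs (parse_app cf) = {}"
    "silent (parse_app cf)"
proof -
  show "mod_regs (parse_app cf) \<subseteq> {0, Suc 0, 2, 5, 6, 7}"
    using parse_arg_simps(1)[of cf 5] parse_arg_simps(1)[of cf 6] parse_arg_simps(1)[of cf 7]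
      eat_list_simps(1)[of "False # xor3_table"]
    unfolding parse_app_def mod_regs.simps by blast
qed (simp_all add: parse_app_def)

lemma parses_app:
  "parses w (vars_read w n) (parse_app cf) enc_application (valid_app cf n)
    (\<lambda>A \<sigma> \<sigma>'. app_elems A = [reg \<sigma>' 5, reg \<sigma>' 6, reg \<sigma>' 7])"
proof -
  let ?I = "vars_read w n" and ?V = "valid_arg cf n" and ?e = "\<lambda>a. True # enc_arg a"
  let ?t = "False # xor3_table"
  have pre: "x = y \<and> xs = ys" if "?e x @ xs = ?e y @ ys" for x y xs ys
    using that by (auto dest: enc_arg_prefix)
  have arg: "parses w ?I (parse_arg cf r) ?e ?V (\<lambda>a \<sigma> \<sigma>'. reg \<sigma>' r = arg_elem a)" if "r \<in> {5, 6, 7}" for r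
    using that by (intro parses_arg) auto
  have frame_arg: "reg (exec w (parse_arg cf r) \<sigma>) s = reg \<sigma> s" if "s \<notin> {0, Suc 0, 2, r}" for r s \<sigma>
    using that parse_arg_simps(1)[of cf r] by (intro exec_reg_frame) blast
  have frame_t: "reg (exec w (eat_list ?t) \<sigma>) s = reg \<sigma> s" if "s \<notin> {0, Suc 0}" for s \<sigma>
    using that eat_list_simps(1)[of ?t] by (intro exec_reg_frame) blast
  have sticky: "sticky (parse_arg cf r)" if "r \<in> {5, 6, 7}" for r using parses_sticky[OF arg[OF that]] .
  have "parses w ?I (parse_arg cf 7 ;; eat_list ?t) (\<lambda>(c, u). ?e c @ (\<lambda>_ :: unit. ?t) u) (\<lambda>(c, u). ?V c \<and> True)
      (\<lambda>(c, u) \<sigma> \<sigma>'. reg (exec w (parse_arg cf 7) \<sigma>) 7 = arg_elem c \<and> True)"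
    by (rule parses_seq[OF arg parses_eat_list]) (use pre in auto)
  then have 1: "parses w ?I (parse_arg cf 7 ;; eat_list ?t) (\<lambda>c. ?e c @ ?t) ?V
      (\<lambda>c \<sigma> \<sigma>'. reg \<sigma>' 7 = arg_elem c \<and> reg \<sigma>' 6 = reg \<sigma> 6 \<and> reg \<sigma>' 5 = reg \<sigma> 5)"
    by (rule parses_map[where g = fst]) (auto simp: frame_arg frame_t)
  have "parses w ?I (parse_arg cf 6 ;; parse_arg cf 7 ;; eat_list ?t) (\<lambda>(b, c). ?e b @ ?e c @ ?t) (\<lambda>(b, c). ?V b \<and> ?V c)
      (\<lambda>(b, c) \<sigma> \<sigma>'. reg (exec w (parse_arg cf 6) \<sigma>) 6 = arg_elem b \<and> (reg \<sigma>' 7 = arg_elem c \<and>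
        reg \<sigma>' 6 = reg (exec w (parse_arg cf 6) \<sigma>) 6 \<and> reg \<sigma>' 5 = reg (exec w (parse_arg cf 6) \<sigma>) 5))"
    by (rule parses_seq[OF arg 1]) (use pre in \<open>auto simp: vars_read_def frame_arg sticky\<close>)
  then have 2: "parses w ?I (parse_arg cf 6 ;; parse_arg cf 7 ;; eat_list ?t) (\<lambda>(b, c). ?e b @ ?e c @ ?t) (\<lambda>(b, c). ?V b \<and> ?V c)
      (\<lambda>(b, c) \<sigma> \<sigma>'. reg \<sigma>' 7 = arg_elem c \<and> reg \<sigma>' 6 = arg_elem b \<and> reg \<sigma>' 5 = reg \<sigma> 5)"
    by (rule parses_map[where g = "\<lambda>x. x"]) (auto simp: frame_arg)
  have "parses w ?I (parse_app cf) (\<lambda>(a, bc). ?e a @ (case bc of (b, c) \<Rightarrow> ?e b @ ?e c @ ?t)) (\<lambda>(a, bc). ?V a \<and> (case bc of (b, c) \<Rightarrow> ?V b \<and> ?V c))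
      (\<lambda>(a, bc) \<sigma> \<sigma>'. reg (exec w (parse_arg cf 5) \<sigma>) 5 = arg_elem a \<and> (case bc of (b, c) \<Rightarrow>
        (\<lambda>\<sigma> \<sigma>'. reg \<sigma>' 7 = arg_elem c \<and> reg \<sigma>' 6 = arg_elem b \<and> reg \<sigma>' 5 = reg \<sigma> 5)) (exec w (parse_arg cf 5) \<sigma>) \<sigma>')"
    unfolding parse_app_def
    by (rule parses_seq[OF arg 2]) (use pre in \<open>auto simp: vars_read_def frame_arg sticky\<close>)
  then show ?thesis
    by (rule parses_map[where g = "\<lambda>(a, b, c). (xor3, [a, b, c])"])
      (auto simp: enc_application_xor3 valid_app_def app_elems_def)
qed

subsection \<open>Solution spaces\<close>

text \<open>
  The solutions of a set of equations, made homogeneous by replacing the constant 1 by the value of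
  element 3, form the span of the first \<open>m\<close> rows of a matrix over the two-element field.
\<close>

inductive_set row_span :: "nat \<Rightarrow> (nat \<Rightarrow> nat \<Rightarrow> bool) \<Rightarrow> (nat \<Rightarrow> bool) set" for m M where
  span_zero: "(\<lambda>_. False) \<in> row_span m M"
| span_row: "x \<in> row_span m M \<Longrightarrow> i < m \<Longrightarrow> (\<lambda>k. x k \<noteq> M i k) \<in> row_span m M"

lemma row_in_span: "i < m \<Longrightarrow> M i \<in> row_span m M"
  using span_row[OF span_zero, of i m M] by simp

lemma span_add: "y \<in> row_span m M \<Longrightarrow> x \<in> row_span m M \<Longrightarrow> (\<lambda>k. x k \<noteq> y k) \<in> row_span m M"
proof (induction y rule: row_span.induct)
  case span_zero
  then show ?case by simp
next
  case (span_row y i)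
  have "(\<lambda>k. x k \<noteq> (y k \<noteq> M i k)) = (\<lambda>k. (x k \<noteq> y k) \<noteq> M i k)" by auto
  then show ?case using row_span.span_row[OF span_row.IH[OF span_row.prems] span_row.hyps(2)] by simp
qed

text \<open>One step of Gaussian elimination for the functional \<open>P\<close>: a pivot row not
  annihilated by \<open>P\<close> is added to all such rows, itself included, which makes the pivot
  row zero. The number \<open>m\<close> of rows never changes.\<close>

definition eliminated :: "nat \<Rightarrow> ((nat \<Rightarrow> bool) \<Rightarrow> bool) \<Rightarrow> (nat \<Rightarrow> nat \<Rightarrow> bool) \<Rightarrow> (nat \<Rightarrow> nat \<Rightarrow> bool) \<Rightarrow> bool" where
  "eliminated m P M M' \<longleftrightarrow> (\<forall>i<m. \<not> P (M i) \<and> M' i = M i) \<or>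
     (\<exists>p<m. P (M p) \<and> (\<forall>i<m. M' i = (if P (M i) then (\<lambda>k. M i k \<noteq> M p k) else M i)))"

text \<open>\<open>P\<close> is a linear functional over the two-element field, so the sum of two
  rows outside its kernel lies in the kernel.\<close>

lemma span_eliminated:
  assumes P: "\<And>x y. P (\<lambda>k. x k \<noteq> y k) \<longleftrightarrow> (P x \<noteq> P y)" and "eliminated m P M M'"
  shows "row_span m M' = {x \<in> row_span m M. \<not> P x}"
proof
  have P0: "\<not> P (\<lambda>_. False)" using P[of "\<lambda>_. False" "\<lambda>_. False"] by simp
  have row: "M' i \<in> row_span m M \<and> \<not> P (M' i)" if "i < m" for i
    using assms(2) unfolding eliminated_def
  proof
    assume "\<forall>i<m. \<not> P (M i) \<and> M' i = M i"
    then show ?thesis using that row_in_span[OF that, of M] by simp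
  next
    assume "\<exists>p<m. P (M p) \<and> (\<forall>i<m. M' i = (if P (M i) then (\<lambda>k. M i k \<noteq> M p k) else M i))"
    then obtain p where "p < m" "P (M p)" and
      p: "\<forall>i<m. M' i = (if P (M i) then (\<lambda>k. M i k \<noteq> M p k) else M i)"
      by (elim exE conjE)
    moreover have "M' i = (if P (M i) then (\<lambda>k. M i k \<noteq> M p k) else M i)" using p that by blast
    ultimately show ?thesis
      using P[of "M i" "M p"] row_in_span[OF that] row_in_span[of p m M] span_add[of "M p" m M "M i"]
      by (cases "P (M i)") simp_all
  qed
  show "row_span m M' \<subseteq> {x \<in> row_span m M. \<not> P x}"
  proof
    fix x assume "x \<in> row_span m M'"
    then show "x \<in> {x \<in> row_span m M. \<not> P x}"
    proof induction
      case span_zero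
      then show ?case using P0 row_span.span_zero by simp
    next
      case (span_row x i)
      then show ?case using row[of i] P[of x "M' i"] span_add[of "M' i" m M x] by simp
    qed
  qed
  show "{x \<in> row_span m M. \<not> P x} \<subseteq> row_span m M'"
    using assms(2) unfolding eliminated_def
  proof
    assume *: "\<forall>i<m. \<not> P (M i) \<and> M' i = M i"
    have "x \<in> row_span m M'" if "x \<in> row_span m M" for x
      using that
    proof induction
      case (span_row x i)
      then show ?case using row_span.span_row[of x m M' i] * by simp
    qed (rule row_span.span_zero)
    then show ?thesis by blast
  next
    assume "\<exists>p<m. P (M p) \<and> (\<forall>i<m. M' i = (if P (M i) then (\<lambda>k. M i k \<noteq> M p k) else M i))"
    then obtain p where p: "p < m" "P (M p)"
      "\<And>i. i < m \<Longrightarrow> M' i = (if P (M i) then (\<lambda>k. M i k \<noteq> M p k) else M i)" by blast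
    \<comment> \<open>This projection along the pivot is additive and takes the old rows to the new
      ones, so it maps the old span into the new; on the kernel of \<open>P\<close> it is the
      identity.\<close>
    have "(if P x then (\<lambda>k. x k \<noteq> M p k) else x) \<in> row_span m M'" if "x \<in> row_span m M" for x
      using that
    proof induction
      case span_zero
      then show ?case using P0 row_span.span_zero by simp
    next
      case (span_row x i)
      let ?x = "if P x then (\<lambda>k. x k \<noteq> M p k) else x"
      have "(\<lambda>k. ?x k \<noteq> M' i k) \<in> row_span m M'" using row_span.span_row span_row by blast
      moreover have "(\<lambda>k. ?x k \<noteq> M' i k) = (if P (\<lambda>k. x k \<noteq> M i k) then (\<lambda>k. (x k \<noteq> M i k) \<noteq> M p k) else (\<lambda>k. x k \<noteq> M i k))"
        using P[of x "M i"] p(3)[OF span_row.hyps(2)] by (auto simp: fun_eq_iff)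
      ultimately show ?case by simp
    qed
    then show ?thesis by force
  qed
qed

definition violated :: "nat \<Rightarrow> nat \<Rightarrow> nat \<Rightarrow> (nat \<Rightarrow> bool) \<Rightarrow> bool" where
  "violated a b c x \<longleftrightarrow> ((x a \<noteq> x b) \<noteq> x c) \<noteq> x 3"

text \<open>Elements 3 and 4 have to agree but not to be true, so that these vectors form a linear
  space; the normalization \<open>x 3\<close> is imposed only when entailment is tested.\<close>

definition well_valued :: "nat \<Rightarrow> (nat \<Rightarrow> bool) \<Rightarrow> bool" where
  "well_valued m x \<longleftrightarrow> \<not> x 0 \<and> \<not> x 1 \<and> \<not> x 2 \<and> x 3 = x 4 \<and> (\<forall>k\<ge>m. \<not> x k)"

definition sols :: "nat \<Rightarrow> nat application set \<Rightarrow> (nat \<Rightarrow> bool) set" where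
  "sols m S = {x. well_valued m x \<and> (\<forall>A \<in> S. \<forall>a b c. app_elems A = [a, b, c] \<longrightarrow> \<not> violated a b c x)}"

text \<open>A basis of that space padded with zero rows: unit vectors for the variables, and for the
  constant true the vector supported on 3 and 4.\<close>

definition init_matrix :: "nat \<Rightarrow> nat \<Rightarrow> nat \<Rightarrow> bool" where
  "init_matrix m i k \<longleftrightarrow> (i = k \<and> 5 \<le> i \<and> i < m) \<or> (i = 3 \<and> (k = 3 \<or> k = 4))"

lemma less_5: "k < 5 \<longleftrightarrow> k = 0 \<or> k = 1 \<or> k = 2 \<or> k = 3 \<or> k = (4::nat)"
  by arith

lemma span_init_matrix:
  assumes "5 \<le> m"
  shows "row_span m (init_matrix m) = sols m {}"
proof
  show "row_span m (init_matrix m) \<subseteq> sols m {}"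
  proof
    fix x assume "x \<in> row_span m (init_matrix m)"
    then show "x \<in> sols m {}"
      by induction (use assms in \<open>auto simp: sols_def well_valued_def init_matrix_def\<close>)
  qed
  show "sols m {} \<subseteq> row_span m (init_matrix m)"
  proof
    fix x assume "x \<in> sols m {}"
    then have x: "well_valued m x" by (simp add: sols_def)
    \<comment> \<open>Truncations of \<open>x\<close> are built up one variable at a time, starting
      with the five constant coordinates.\<close>
    have "(\<lambda>k. x k \<and> k < t + 5) \<in> row_span m (init_matrix m)" if "t + 5 \<le> m" for t
      using that
    proof (induction t)
      case 0
      show ?case
      proof (cases "x 3")
        case True
        have "(\<lambda>k. x k \<and> k < 0 + 5) = init_matrix m 3"
        proof
          fix k show "(x k \<and> k < 0 + 5) = init_matrix m 3 k"
            using x True by (auto simp: well_valued_def init_matrix_def less_5)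
        qed
        then show ?thesis using row_in_span[of 3 m "init_matrix m"] assms by simp
      next
        case False
        have "(\<lambda>k. x k \<and> k < 0 + 5) = (\<lambda>_. False)"
        proof
          fix k show "(x k \<and> k < 0 + 5) = False"
            using x False by (cases "k = 0") (auto simp: well_valued_def less_5)
        qed
        then show ?thesis using span_zero by simp
      qed
    next
      case (Suc t)
      then have IH: "(\<lambda>k. x k \<and> k < t + 5) \<in> row_span m (init_matrix m)" by simp
      show ?case
      proof (cases "x (t + 5)")
        case True
        have "(\<lambda>k. x k \<and> k < Suc t + 5) = (\<lambda>k. (x k \<and> k < t + 5) \<noteq> init_matrix m (t + 5) k)"
        proof
          fix k
          consider "k < t + 5" | "k = t + 5" | "t + 5 < k" by linarith
          then show "(x k \<and> k < Suc t + 5) = ((x k \<and> k < t + 5) \<noteq> init_matrix m (t + 5) k)"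
            by cases (use True Suc.prems in \<open>auto simp: init_matrix_def\<close>)
        qed
        then show ?thesis using span_row[OF IH, of "t + 5"] Suc.prems by simp
      next
        case False
        have "(\<lambda>k. x k \<and> k < Suc t + 5) = (\<lambda>k. x k \<and> k < t + 5)"
        proof
          fix k show "(x k \<and> k < Suc t + 5) = (x k \<and> k < t + 5)"
            using False by (cases "k = t + 5") auto
        qed
        then show ?thesis using IH by simp
      qed
    qed
    from this[of "m - 5"] assms have "(\<lambda>k. x k \<and> k < m) \<in> row_span m (init_matrix m)" by simp
    moreover have "(\<lambda>k. x k \<and> k < m) = x" using x by (auto simp: well_valued_def fun_eq_iff not_le[symmetric])
    ultimately show "x \<in> row_span m (init_matrix m)" by simp
  qed
qed

lemma violated_add: "violated a b c (\<lambda>k. x k \<noteq> y k) \<longleftrightarrow> (violated a b c x \<noteq> violated a b c y)"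
  by (auto simp: violated_def)

definition entailed :: "nat \<Rightarrow> (nat \<Rightarrow> nat \<Rightarrow> bool) \<Rightarrow> nat \<Rightarrow> nat \<Rightarrow> nat \<Rightarrow> bool" where
  "entailed m M a b c \<longleftrightarrow> \<not> ((\<exists>i<m. M i 3) \<and> (\<exists>i<m. violated a b c (M i)))"

text \<open>Two linear functionals that are each nonzero somewhere on the span are simultaneously
  nonzero somewhere: at one of the two witnesses or at their sum. So the rows can be tested for each
  functional separately.\<close>

lemma entailed_iff: "entailed m M a b c \<longleftrightarrow> (\<forall>x \<in> row_span m M. x 3 \<longrightarrow> \<not> violated a b c x)"
proof
  assume "entailed m M a b c"
  then consider "\<forall>i<m. \<not> M i 3" | "\<forall>i<m. \<not> violated a b c (M i)" unfolding entailed_def by blast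
  then show "\<forall>x \<in> row_span m M. x 3 \<longrightarrow> \<not> violated a b c x"
  proof cases
    case 1
    have "\<not> x 3" if "x \<in> row_span m M" for x
      using that by induction (use 1 in auto)
    then show ?thesis by blast
  next
    case 2
    have "\<not> violated a b c x" if "x \<in> row_span m M" for x
      using that by induction (use 2 violated_add in \<open>auto simp: violated_def\<close>)
    then show ?thesis by blast
  qed
next
  assume *: "\<forall>x \<in> row_span m M. x 3 \<longrightarrow> \<not> violated a b c x"
  show "entailed m M a b c"
    unfolding entailed_def
  proof
    assume "(\<exists>i<m. M i 3) \<and> (\<exists>i<m. violated a b c (M i))"
    then obtain i j where ij: "i < m" "M i 3" "j < m" "violated a b c (M j)" by blast
    have "\<not> violated a b c (M i)" "\<not> M j 3" using * ij row_in_span by blast+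
    then show False
      using bspec[OF *, OF span_add[OF row_in_span row_in_span], OF ij(3,1)] ij(2,4)
      unfolding violated_add by blast
  qed
qed

subsection \<open>Elimination\<close>

text \<open>
  Register 4 holds the number \<open>m\<close> of elements, registers 5, 6 and 7 the elements of the current
  application, and registers 13, 16 and 17 the constants 3, 5 and 4.
\<close>

definition flip :: "test \<Rightarrow> prog" where
  "flip t = Cond t (Cond (Pos 11) (Zero 11) (Inc 11)) Skip"

definition parity :: "nat \<Rightarrow> nat \<Rightarrow> nat \<Rightarrow> nat \<Rightarrow> nat \<Rightarrow> prog" where
  "parity a i x y z = Zero 11 ;; flip (Bit a i x) ;; flip (Bit a i y) ;; flip (Bit a i z) ;; flip (Bit a i 13)"

lemma flip_simps [simp]: "mod_regs (flip t) = {11}" "mod_arrs (flip t) = {}" "silent (flip t)"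
  by (auto simp: flip_def)

lemma parity_simps [simp]: "mod_regs (parity a i x y z) = {11}" "mod_arrs (parity a i x y z) = {}" "silent (parity a i x y z)"
  by (auto simp: parity_def)

lemma set_reg_twice [simp]: "set_reg r u (set_reg r v \<sigma>) = set_reg r u \<sigma>"
  by (simp add: set_reg_def)

lemma exec_flip:
  "exec w (flip t) (set_reg 11 (of_bool b) \<sigma>) = set_reg 11 (of_bool (b \<noteq> eval w t (set_reg 11 (of_bool b) \<sigma>))) \<sigma>"
  by (cases b) (simp_all add: flip_def bound_def)

lemma exec_parity:
  assumes "i \<noteq> 11" "x \<noteq> 11" "y \<noteq> 11" "z \<noteq> 11" "reg \<sigma> 13 = 3"
  shows "exec w (parity a i x y z) \<sigma> =
    set_reg 11 (of_bool (violated (reg \<sigma> x) (reg \<sigma> y) (reg \<sigma> z) (arr \<sigma> a (reg \<sigma> i)))) \<sigma>"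
proof -
  have z: "exec w (Zero 11) \<sigma> = set_reg 11 (of_bool False) \<sigma>" by simp
  show ?thesis
    unfolding parity_def exec.simps(8) z exec_flip using assms by (simp add: violated_def)
qed

definition copy_row :: "nat \<Rightarrow> prog" where
  "copy_row a = For 9 4 (Cond (Bit a 8 9) (Put 2 13 9 True) (Put 2 13 9 False))"

definition add_row :: "nat \<Rightarrow> prog" where
  "add_row a = For 9 4 (Cond (Bit 2 13 9) (Cond (Bit a 8 9) (Put a 8 9 False) (Put a 8 9 True)) Skip)"

lemma row_simps [simp]: "mod_regs (copy_row a) = {9}" "mod_arrs (copy_row a) = {2}" "silent (copy_row a)"
    "mod_regs (add_row a) = {9}" "mod_arrs (add_row a) = {a}" "silent (add_row a)"
  by (auto simp: copy_row_def add_row_def)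

lemma exec_copy_row:
  assumes "reg \<sigma> 4 = m" "m \<le> bound w" "reg \<sigma> 13 = 3" "a \<noteq> 2" "k < m"
  shows "arr (exec w (copy_row a) \<sigma>) 2 3 k = arr \<sigma> a (reg \<sigma> 8) k"
proof -
  let ?J = "\<lambda>j \<tau>. \<forall>k<j. arr \<tau> 2 3 k = arr \<sigma> a (reg \<sigma> 8) k"
  have "?J m (exec w (copy_row a) \<sigma>)"
    unfolding copy_row_def
    by (rule For_rule[where J = ?J, OF assms(1,2)]) (use assms in \<open>auto simp: less_Suc_eq\<close>)
  then show ?thesis using assms(5) by blast
qed

lemma exec_add_row:
  assumes "reg \<sigma> 4 = m" "m \<le> bound w" "reg \<sigma> 13 = 3" "a \<noteq> 2"
  shows "arr (exec w (add_row a) \<sigma>) a = (arr \<sigma> a)(reg \<sigma> 8 := (\<lambda>k. arr \<sigma> a (reg \<sigma> 8) k \<noteq> (k < m \<and> arr \<sigma> 2 3 k)))"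
proof -
  let ?J = "\<lambda>j \<tau>. arr \<tau> a = (arr \<sigma> a)(reg \<sigma> 8 := (\<lambda>k. arr \<sigma> a (reg \<sigma> 8) k \<noteq> (k < j \<and> arr \<sigma> 2 3 k)))"
  show ?thesis
    unfolding add_row_def
    by (rule For_rule[where J = ?J, OF assms(1,2)]) (use assms in \<open>auto simp: less_Suc_eq fun_eq_iff\<close>)
qed

text \<open>The pivot row is kept in row 3 of array 2; register 12 says whether there is one.\<close>

definition eliminate :: "nat \<Rightarrow> prog" where
  "eliminate a = Zero 12 ;; For 8 4 (parity a 8 5 6 7 ;;
     Cond (Pos 11) (Cond (Pos 12) Skip (Inc 12 ;; copy_row a) ;; add_row a) Skip)"

lemma eliminate_simps [simp]: "mod_regs (eliminate a) = {8, 9, 11, 12}" "mod_arrs (eliminate a) = {2, a}" "silent (eliminate a)"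
  by (auto simp: eliminate_def)

text \<open>The pivot row is itself cleared when it is processed, so later rows are changed by means
  of its copy. The loops cover the columns below \<open>m\<close> only, which suffices because all
  rows vanish from \<open>m\<close> on.\<close>

lemma exec_eliminate:
  assumes "reg \<sigma> 4 = m" "m \<le> bound w" "reg \<sigma> 13 = 3" "a \<noteq> 2"
    and zero: "\<And>i k. i < m \<Longrightarrow> m \<le> k \<Longrightarrow> \<not> arr \<sigma> a i k"
  shows "eliminated m (violated (reg \<sigma> 5) (reg \<sigma> 6) (reg \<sigma> 7)) (arr \<sigma> a) (arr (exec w (eliminate a) \<sigma>) a)"
proof -
  define M where "M = arr \<sigma> a"
  define P where "P = violated (reg \<sigma> 5) (reg \<sigma> 6) (reg \<sigma> 7)"
  \<comment> \<open>Either no violating row has been met and nothing has changed, or a pivot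
    \<open>p\<close> has been saved and added to all violating rows below \<open>j\<close>.\<close>
  let ?J = "\<lambda>j \<tau>. (reg \<tau> 12 = 0 \<and> arr \<tau> a = M \<and> (\<forall>i<j. \<not> P (M i))) \<or>
    (0 < reg \<tau> 12 \<and> (\<exists>p<m. P (M p) \<and> (\<forall>k<m. arr \<tau> 2 3 k = M p k) \<and>
      arr \<tau> a = (\<lambda>i. if i < j \<and> P (M i) then (\<lambda>k. M i k \<noteq> (k < m \<and> M p k)) else M i)))"
  have "?J m (exec w (For 8 4 (parity a 8 5 6 7 ;;
     Cond (Pos 11) (Cond (Pos 12) Skip (Inc 12 ;; copy_row a) ;; add_row a) Skip)) (set_reg 12 0 \<sigma>))"
  proof (rule For_rule[where J = ?J and k = m], goal_cases)
    case (6 j \<tau>)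
    note \<tau> = 6
    let ?add = "(\<lambda>p. \<lambda>i. if i < Suc j \<and> P (M i) then (\<lambda>k. M i k \<noteq> (k < m \<and> M p k)) else M i)"
    have regs: "reg \<tau> 4 = m" "reg \<tau> 13 = 3" "reg \<tau> 5 = reg \<sigma> 5" "reg \<tau> 6 = reg \<sigma> 6" "reg \<tau> 7 = reg \<sigma> 7"
      using \<tau>(4) assms by auto
    have row: "arr \<tau> a j = M j" using \<tau>(2) by auto
    have par: "exec w (parity a 8 5 6 7) \<tau> = set_reg 11 (of_bool (P (M j))) \<tau>"
      using regs \<tau>(3) row by (simp add: exec_parity P_def)
    define \<tau>\<^sub>1 where "\<tau>\<^sub>1 = set_reg 11 (of_bool (P (M j))) \<tau>"
    have regs1: "reg \<tau>\<^sub>1 4 = m" "reg \<tau>\<^sub>1 13 = 3" "reg \<tau>\<^sub>1 8 = j" using regs \<tau>(3) by (auto simp: \<tau>\<^sub>1_def)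
    show ?case
    proof (cases "P (M j)")
      case False
      then have "exec w (parity a 8 5 6 7 ;;
        Cond (Pos 11) (Cond (Pos 12) Skip (Inc 12 ;; copy_row a) ;; add_row a) Skip) \<tau> = \<tau>\<^sub>1"
        using par by (simp add: \<tau>\<^sub>1_def)
      moreover have "?J (Suc j) (set_reg 8 (Suc j) \<tau>\<^sub>1)"
        using \<tau>(2)
      proof
        assume "reg \<tau> 12 = 0 \<and> arr \<tau> a = M \<and> (\<forall>i<j. \<not> P (M i))"
        then show ?thesis using False by (simp add: \<tau>\<^sub>1_def less_Suc_eq)
      next
        assume *: "0 < reg \<tau> 12 \<and> (\<exists>p<m. P (M p) \<and> (\<forall>k<m. arr \<tau> 2 3 k = M p k) \<and>
          arr \<tau> a = (\<lambda>i. if i < j \<and> P (M i) then (\<lambda>k. M i k \<noteq> (k < m \<and> M p k)) else M i))"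
        moreover have "(i < j \<and> P (M i)) = (i < Suc j \<and> P (M i))" for i
          using False by (auto simp: less_Suc_eq)
        ultimately show ?thesis by (simp add: \<tau>\<^sub>1_def)
      qed
      ultimately show ?thesis by simp
    next
      case True
      define \<tau>\<^sub>2 where "\<tau>\<^sub>2 = exec w (Cond (Pos 12) Skip (Inc 12 ;; copy_row a)) \<tau>\<^sub>1"
      have e: "exec w (parity a 8 5 6 7 ;;
        Cond (Pos 11) (Cond (Pos 12) Skip (Inc 12 ;; copy_row a) ;; add_row a) Skip) \<tau> = exec w (add_row a) \<tau>\<^sub>2"
      proof -
        have "eval w (Pos 11) \<tau>\<^sub>1" using True by (simp add: \<tau>\<^sub>1_def)
        then show ?thesis
          unfolding \<tau>\<^sub>2_def exec.simps(8) par[folded \<tau>\<^sub>1_def] exec.simps(9)[of w "Pos 11"] by (rule if_P)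
      qed
      have regs2: "reg \<tau>\<^sub>2 4 = m" "reg \<tau>\<^sub>2 13 = 3" "reg \<tau>\<^sub>2 8 = j"
        using regs1 by (simp_all add: \<tau>\<^sub>2_def exec_reg_frame del: exec.simps)
      have arr2: "arr \<tau>\<^sub>2 a = arr \<tau> a"
        using assms(4) by (simp add: \<tau>\<^sub>2_def \<tau>\<^sub>1_def exec_arr_frame del: exec.simps)
      obtain p where p: "p < m" "P (M p)" "\<forall>k<m. arr \<tau>\<^sub>2 2 3 k = M p k" "0 < reg \<tau>\<^sub>2 12"
        "arr \<tau> a = (\<lambda>i. if i < j \<and> P (M i) then (\<lambda>k. M i k \<noteq> (k < m \<and> M p k)) else M i)"
      proof (cases "reg \<tau> 12 = 0")
        case True
        have "\<tau>\<^sub>2 = exec w (copy_row a) (set_reg 12 1 \<tau>\<^sub>1)"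
          using True by (simp add: \<tau>\<^sub>2_def \<tau>\<^sub>1_def bound_def)
        then have "\<forall>k<m. arr \<tau>\<^sub>2 2 3 k = M j k" "0 < reg \<tau>\<^sub>2 12"
          using regs1 assms(2,4) row exec_copy_row[of "set_reg 12 1 \<tau>\<^sub>1" m w a]
          by (auto simp: \<tau>\<^sub>1_def exec_reg_frame)
        moreover have "arr \<tau> a = (\<lambda>i. if i < j \<and> P (M i) then (\<lambda>k. M i k \<noteq> (k < m \<and> M j k)) else M i)"
          using \<tau>(2) True by (auto simp: fun_eq_iff)
        ultimately show ?thesis using that[of j] \<tau>(1) \<open>P (M j)\<close> by blast
      next
        case False
        then have "\<tau>\<^sub>2 = \<tau>\<^sub>1" by (simp add: \<tau>\<^sub>2_def \<tau>\<^sub>1_def)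
        then show ?thesis using that \<tau>(2) False by (auto simp: \<tau>\<^sub>1_def)
      qed
      have "arr (exec w (add_row a) \<tau>\<^sub>2) a = (arr \<tau> a)(j := (\<lambda>k. arr \<tau> a j k \<noteq> (k < m \<and> arr \<tau>\<^sub>2 2 3 k)))"
        using exec_add_row[of \<tau>\<^sub>2 m w a] regs2 arr2 assms(2,4) by simp
      also have "\<dots> = ?add p"
        unfolding row using p(3,5) True by (auto simp: fun_eq_iff less_Suc_eq)
      finally have "arr (exec w (add_row a) \<tau>\<^sub>2) a = ?add p" .
      moreover have "0 < reg (exec w (add_row a) \<tau>\<^sub>2) 12" "\<forall>k<m. arr (exec w (add_row a) \<tau>\<^sub>2) 2 3 k = M p k"
        using p(3,4) assms(4) by (simp_all add: exec_reg_frame exec_arr_frame)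
      ultimately show ?thesis unfolding e using p(1,2) by auto
    qed
  qed (use assms in \<open>auto simp: M_def\<close>)
  moreover have e: "exec w (eliminate a) \<sigma> = exec w (For 8 4 (parity a 8 5 6 7 ;;
     Cond (Pos 11) (Cond (Pos 12) Skip (Inc 12 ;; copy_row a) ;; add_row a) Skip)) (set_reg 12 0 \<sigma>)"
    by (simp add: eliminate_def)
  ultimately have "?J m (exec w (eliminate a) \<sigma>)" by simp
  then show ?thesis
    unfolding eliminated_def M_def[symmetric] P_def[symmetric]
  proof (rule disj_forward)
    assume "0 < reg (exec w (eliminate a) \<sigma>) 12 \<and> (\<exists>p<m. P (M p) \<and> (\<forall>k<m. arr (exec w (eliminate a) \<sigma>) 2 3 k = M p k) \<and>
      arr (exec w (eliminate a) \<sigma>) a = (\<lambda>i. if i < m \<and> P (M i) then (\<lambda>k. M i k \<noteq> (k < m \<and> M p k)) else M i))"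
    then obtain p where p: "p < m" "P (M p)"
      "arr (exec w (eliminate a) \<sigma>) a = (\<lambda>i. if i < m \<and> P (M i) then (\<lambda>k. M i k \<noteq> (k < m \<and> M p k)) else M i)"
      by blast
    have "(k < m \<and> M p k) = M p k" for k
      using zero[OF p(1)] unfolding M_def[symmetric] by (meson not_le)
    then show "\<exists>p<m. P (M p) \<and> (\<forall>i<m. arr (exec w (eliminate a) \<sigma>) a i = (if P (M i) then \<lambda>k. M i k \<noteq> M p k else M i))"
      using p by (intro exI[of _ p]) simp
  qed auto
qed

subsection \<open>Encoding ternary relations by graphs\<close>

text \<open>
  The elements below \<open>m\<close> form a clique, and every triple of elements has a vertex of its own, which is
  adjacent to the members of the triple if the triple is in \<open>K\<close>. As \<open>m \<ge> 5\<close>, exactly the elements have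
  degree at least 4.
\<close>

definition triple_vertex :: "nat \<Rightarrow> nat \<Rightarrow> nat \<Rightarrow> nat \<Rightarrow> nat" where
  "triple_vertex m a b c = m + (a * (m * m) + (b * m + c))"

abbreviation "num_vertices m \<equiv> m + m * (m * (m::nat))"

definition triple_edges :: "nat \<Rightarrow> nat \<Rightarrow> nat \<Rightarrow> nat \<Rightarrow> (nat \<times> nat) list" where
  "triple_edges m a b c = map (Pair (triple_vertex m a b c)) [a, b, c]"

definition hypergraph_edges :: "nat \<Rightarrow> (nat \<Rightarrow> nat \<Rightarrow> nat \<Rightarrow> bool) \<Rightarrow> (nat \<times> nat) list" where
  "hypergraph_edges m K =
     concat (map (\<lambda>a. concat (map (\<lambda>b. if a < b then [(a, b)] else []) [0..<m])) [0..<m]) @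
     concat (map (\<lambda>a. concat (map (\<lambda>b. concat (map (\<lambda>c. if K a b c then triple_edges m a b c else [])
       [0..<m])) [0..<m])) [0..<m])"

lemma triple_vertex_ge: "m \<le> triple_vertex m a b c"
  by (simp add: triple_vertex_def)

lemma digit_less: "v < m \<Longrightarrow> u < k \<Longrightarrow> u * m + v < k * (m::nat)"
proof -
  assume "v < m" "u < k"
  then have "u * m + v < Suc u * m" by simp
  also have "\<dots> \<le> k * m" using \<open>u < k\<close> by (intro mult_right_mono) auto
  finally show ?thesis .
qed

lemma digits: "v < m \<Longrightarrow> (u * m + v) div m = u" "v < m \<Longrightarrow> (u * m + v) mod m = (v::nat)"
  by simp_all

lemma triple_vertex_less:
  assumes "a < m" "b < m" "c < m"
  shows "triple_vertex m a b c < num_vertices m"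
  using digit_less[OF digit_less[OF assms(3,2)] assms(1)] by (simp add: triple_vertex_def)

lemma triple_vertex_inject:
  assumes "b < m" "c < m" "b' < m" "c' < m" "triple_vertex m a b c = triple_vertex m a' b' c'"
  shows "a = a' \<and> b = b' \<and> c = c'"
proof -
  have eq: "a * (m * m) + (b * m + c) = a' * (m * m) + (b' * m + c')"
    using assms(5) by (simp add: triple_vertex_def)
  have l: "b * m + c < m * m" "b' * m + c' < m * m" using assms digit_less by blast+
  have a: "a = a'" using arg_cong[OF eq, of "\<lambda>x. x div (m * m)"] digits(1)[OF l(1)] digits(1)[OF l(2)] by metis
  then have eq': "b * m + c = b' * m + c'" using eq by simp
  have "b = b'" using arg_cong[OF eq', of "\<lambda>x. x div m"] digits(1)[OF assms(2)] digits(1)[OF assms(4)] by metis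
  then show ?thesis using a eq' by simp
qed

lemma vertex_cases:
  assumes "v < num_vertices m"
  obtains "v < m" | a b c where "a < m" "b < m" "c < m" "v = triple_vertex m a b c"
proof (cases "v < m")
  case False
  define x where "x = v - m"
  have x: "x < m * (m * m)" "v = m + x" using assms False by (auto simp: x_def)
  have m: "0 < m" using x(1) by (cases m) auto
  define y where "y = x mod (m * m)"
  have "x div (m * m) < m" using x(1) m by (simp add: less_mult_imp_div_less)
  moreover have "y < m * m" using m by (simp add: y_def)
  then have "y div m < m" by (simp add: less_mult_imp_div_less)
  moreover have "y mod m < m" using m by simp
  moreover have "v = triple_vertex m (x div (m * m)) (y div m) (y mod m)"
    unfolding triple_vertex_def div_mult_mod_eq y_def x(2) ..
  ultimately show ?thesis using that(2) by blast
qed (use that in auto)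

lemma mem_hypergraph_edges:
  "(u, v) \<in> set (hypergraph_edges m K) \<longleftrightarrow> (u < v \<and> v < m) \<or>
     (\<exists>a<m. \<exists>b<m. \<exists>c<m. K a b c \<and> u = triple_vertex m a b c \<and> v \<in> {a, b, c})"
proof -
  have "(u, v) \<in> set (concat (map (\<lambda>a. concat (map (\<lambda>b. if a < b then [(a, b)] else []) [0..<m])) [0..<m]))
      \<longleftrightarrow> u < v \<and> v < m"
    by (auto split: if_splits)
  moreover have "(u, v) \<in> set (concat (map (\<lambda>a. concat (map (\<lambda>b. concat (map (\<lambda>c. if K a b c then triple_edges m a b c else [])
       [0..<m])) [0..<m])) [0..<m])) \<longleftrightarrow> (\<exists>a<m. \<exists>b<m. \<exists>c<m. K a b c \<and> (u, v) \<in> set (triple_edges m a b c))"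
    by (fastforce split: if_splits)
  ultimately show ?thesis
    unfolding hypergraph_edges_def set_append Un_iff by (simp add: triple_edges_def image_iff) blast
qed

lemma adj_elements:
  assumes "u < m" "v < m"
  shows "adj (hypergraph_edges m K) u v \<longleftrightarrow> u \<noteq> v"
  using assms triple_vertex_ge[of m] unfolding adj_iff mem_hypergraph_edges
  by (metis leD nat_neq_iff)

lemma adj_triple:
  assumes "a < m" "b < m" "c < m"
  shows "adj (hypergraph_edges m K) (triple_vertex m a b c) v \<longleftrightarrow> K a b c \<and> v \<in> {a, b, c}"
proof
  assume "adj (hypergraph_edges m K) (triple_vertex m a b c) v"
  then consider "(triple_vertex m a b c, v) \<in> set (hypergraph_edges m K)" | "(v, triple_vertex m a b c) \<in> set (hypergraph_edges m K)"
    unfolding adj_iff by blast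
  then show "K a b c \<and> v \<in> {a, b, c}"
  proof cases
    case 1
    then obtain a' b' c' where *: "a' < m" "b' < m" "c' < m" "K a' b' c'"
      "triple_vertex m a b c = triple_vertex m a' b' c'" "v \<in> {a', b', c'}"
      using triple_vertex_ge[of m a b c] unfolding mem_hypergraph_edges by fastforce
    then show ?thesis using triple_vertex_inject[OF assms(2,3) *(2,3,5)] by simp
  next
    case 2
    then show ?thesis using triple_vertex_ge[of m a b c] assms unfolding mem_hypergraph_edges by fastforce
  qed
next
  assume "K a b c \<and> v \<in> {a, b, c}"
  then show "adj (hypergraph_edges m K) (triple_vertex m a b c) v"
    unfolding adj_iff mem_hypergraph_edges using assms by blast
qed

lemma adj_sym: "adj es u v \<longleftrightarrow> adj es v u"
  by (auto simp: adj_iff)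

text \<open>Sets instead of triples, because the vertex of a triple reveals only which elements it
  is adjacent to, not their order or multiplicity.\<close>

definition hyperedges :: "nat \<Rightarrow> (nat \<Rightarrow> nat \<Rightarrow> nat \<Rightarrow> bool) \<Rightarrow> nat set set" where
  "hyperedges m K = {{a, b, c} | a b c. a < m \<and> b < m \<and> c < m \<and> K a b c}"

lemma hypergraph_isoI:
  assumes "bij_betw \<pi> {..<m} {..<m}"
    and K: "\<And>a b c. a < m \<Longrightarrow> b < m \<Longrightarrow> c < m \<Longrightarrow> K a b c \<longleftrightarrow> K' (\<pi> a) (\<pi> b) (\<pi> c)"
  shows "\<exists>\<phi>. bij_betw \<phi> {..<num_vertices m} {..<num_vertices m} \<and>
    (\<forall>u<num_vertices m. \<forall>v<num_vertices m.
      adj (hypergraph_edges m K) u v \<longleftrightarrow> adj (hypergraph_edges m K') (\<phi> u) (\<phi> v))"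
proof -
  have \<pi>: "\<pi> a < m" if "a < m" for a using assms(1) that by (auto simp: bij_betw_def)
  have inj: "\<pi> a = \<pi> b \<longleftrightarrow> a = b" if "a < m" "b < m" for a b
    using assms(1) that by (auto simp: bij_betw_def inj_on_def)
  define \<phi> where "\<phi> v = (if v < m then \<pi> v else
    triple_vertex m (\<pi> ((v - m) div (m * m))) (\<pi> ((v - m) mod (m * m) div m)) (\<pi> ((v - m) mod (m * m) mod m)))" for v
  have \<phi>1: "\<phi> v = \<pi> v" if "v < m" for v using that by (simp add: \<phi>_def)
  have \<phi>2: "\<phi> (triple_vertex m a b c) = triple_vertex m (\<pi> a) (\<pi> b) (\<pi> c)" if "b < m" "c < m" for a b c
  proof -
    have l: "b * m + c < m * m" using digit_less that by blast
    have "(a * (m * m) + (b * m + c)) div (m * m) = a" "(a * (m * m) + (b * m + c)) mod (m * m) = b * m + c"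
      by (rule digits[OF l])+
    moreover have "(b * m + c) div m = b" "(b * m + c) mod m = c" by (rule digits[OF that(2)])+
    ultimately show ?thesis
      unfolding \<phi>_def triple_vertex_def by (simp only: diff_add_inverse) simp
  qed
  have "inj_on \<phi> {..<num_vertices m}"
  proof (rule inj_onI)
    fix u v assume "u \<in> {..<num_vertices m}" "v \<in> {..<num_vertices m}" and eq: "\<phi> u = \<phi> v"
    then have u: "u < num_vertices m" and v: "v < num_vertices m" by auto
    from u show "u = v"
    proof (cases rule: vertex_cases)
      case 1
      note u1 = 1
      from v show ?thesis
      proof (cases rule: vertex_cases)
        case 1
        then show ?thesis using u1 eq \<phi>1 inj by simp
      next
        case (2 a b c)
        then show ?thesis using u1 eq \<phi>1 \<phi>2 \<pi>[of u] triple_vertex_ge[of m "\<pi> a" "\<pi> b" "\<pi> c"] by simp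
      qed
    next
      case (2 a b c)
      note u2 = 2
      from v show ?thesis
      proof (cases rule: vertex_cases)
        case 1
        then show ?thesis using u2 eq \<phi>1 \<phi>2 \<pi>[of v] triple_vertex_ge[of m "\<pi> a" "\<pi> b" "\<pi> c"] by simp
      next
        case (2 a' b' c')
        have "triple_vertex m (\<pi> a) (\<pi> b) (\<pi> c) = triple_vertex m (\<pi> a') (\<pi> b') (\<pi> c')"
          using u2 2 eq \<phi>2 by simp
        then have "\<pi> a = \<pi> a' \<and> \<pi> b = \<pi> b' \<and> \<pi> c = \<pi> c'"
          by (intro triple_vertex_inject[of _ m]) (use \<pi> u2 2 in auto)
        then show ?thesis using inj u2 2 by simp
      qed
    qed
  qed
  moreover have "\<phi> ` {..<num_vertices m} \<subseteq> {..<num_vertices m}"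
  proof
    fix y assume "y \<in> \<phi> ` {..<num_vertices m}"
    then obtain v where v: "v < num_vertices m" "y = \<phi> v" by auto
    from v(1) show "y \<in> {..<num_vertices m}"
    proof (cases rule: vertex_cases)
      case 1
      then show ?thesis using \<phi>1 \<pi> v(2) by (simp add: trans_less_add1)
    next
      case (2 a b c)
      then show ?thesis using \<phi>2 \<pi> v(2) triple_vertex_less by simp
    qed
  qed
  ultimately have "bij_betw \<phi> {..<num_vertices m} {..<num_vertices m}"
    by (simp add: bij_betw_def endo_inj_surj)
  moreover have triple: "adj (hypergraph_edges m K) (triple_vertex m a b c) v \<longleftrightarrow>
      adj (hypergraph_edges m K') (\<phi> (triple_vertex m a b c)) (\<phi> v)"
    if abc: "a < m" "b < m" "c < m" and v: "v < num_vertices m" for a b c v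
    using v
  proof (cases rule: vertex_cases)
    case 1
    then show ?thesis using abc \<pi> K inj by (simp add: \<phi>1 \<phi>2 adj_triple)
  next
    case (2 a' b' c')
    have "m \<le> v" "m \<le> \<phi> v" using 2 triple_vertex_ge by (simp_all add: \<phi>2)
    then have "v \<notin> {a, b, c}" "\<phi> v \<notin> {\<pi> a, \<pi> b, \<pi> c}"
      using abc \<pi>[OF abc(1)] \<pi>[OF abc(2)] \<pi>[OF abc(3)] by auto
    then show ?thesis
      unfolding \<phi>2[OF abc(2,3)] adj_triple[OF abc] adj_triple[OF \<pi>[OF abc(1)] \<pi>[OF abc(2)] \<pi>[OF abc(3)]]
      by simp
  qed
  moreover have "adj (hypergraph_edges m K) u v \<longleftrightarrow> adj (hypergraph_edges m K') (\<phi> u) (\<phi> v)"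
    if "u < num_vertices m" "v < num_vertices m" for u v
    using that(1)
  proof (cases rule: vertex_cases)
    case 1
    note u1 = 1
    from that(2) show ?thesis
    proof (cases rule: vertex_cases)
      case 1
      then show ?thesis using u1 \<pi> inj by (simp add: \<phi>1 adj_elements)
    next
      case (2 a b c)
      then show ?thesis using triple[OF 2(1-3) that(1)] by (simp add: adj_sym[of _ u] adj_sym[of _ "\<phi> u"])
    qed
  next
    case (2 a b c)
    then show ?thesis using triple[OF 2(1-3) that(2)] by simp
  qed
  ultimately show ?thesis by blast
qed

text \<open>Isomorphisms preserve degrees and thus the set of elements, and they carry
  neighbourhoods of triple vertices to such neighbourhoods. The converse inclusion of hyperedges is
  obtained by applying the result to the inverse.\<close>

lemma hypergraph_isoD:
  assumes "5 \<le> m" "bij_betw \<phi> {..<num_vertices m} {..<num_vertices m}"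
    and adj: "\<And>u v. u < num_vertices m \<Longrightarrow> v < num_vertices m \<Longrightarrow>
      adj (hypergraph_edges m K) u v \<longleftrightarrow> adj (hypergraph_edges m K') (\<phi> u) (\<phi> v)"
  shows "bij_betw \<phi> {..<m} {..<m}" "s \<in> hyperedges m K \<Longrightarrow> \<phi> ` s \<in> hyperedges m K'"
proof -
  define nb where "nb K v = {u. u < num_vertices m \<and> adj (hypergraph_edges m K) v u}" for K v
  have fin: "finite (nb K v)" for K v by (simp add: nb_def)
  have \<phi>: "\<phi> v < num_vertices m" if "v < num_vertices m" for v
    using assms(2) that by (auto simp: bij_betw_def)
  have surj: "\<exists>u<num_vertices m. v = \<phi> u" if "v < num_vertices m" for v
    using assms(2) that unfolding bij_betw_def by (metis imageE lessThan_iff)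
  have inj: "inj_on \<phi> {..<num_vertices m}" using assms(2) by (simp add: bij_betw_def)
  have nb_image: "nb K' (\<phi> v) = \<phi> ` nb K v" if "v < num_vertices m" for v
  proof
    show "nb K' (\<phi> v) \<subseteq> \<phi> ` nb K v"
    proof
      fix y assume y: "y \<in> nb K' (\<phi> v)"
      then obtain u where "u < num_vertices m" "y = \<phi> u" using surj by (auto simp: nb_def)
      then show "y \<in> \<phi> ` nb K v" using y adj that by (auto simp: nb_def)
    qed
    show "\<phi> ` nb K v \<subseteq> nb K' (\<phi> v)" using adj that \<phi> by (auto simp: nb_def)
  qed
  have card_image: "card (nb K' (\<phi> v)) = card (nb K v)" if "v < num_vertices m" for v
    unfolding nb_image[OF that]
    by (rule card_image) (rule inj_on_subset[OF inj], auto simp: nb_def)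
  have nb_triple: "nb K (triple_vertex m a b c) = (if K a b c then {a, b, c} else {})"
    if "a < m" "b < m" "c < m" for a b c and K :: "nat \<Rightarrow> nat \<Rightarrow> nat \<Rightarrow> bool"
    using that by (auto simp: nb_def adj_triple)
  have deg: "4 \<le> card (nb K v) \<longleftrightarrow> v < m" if "v < num_vertices m" for v and K :: "nat \<Rightarrow> nat \<Rightarrow> nat \<Rightarrow> bool"
    using that
  proof (cases rule: vertex_cases)
    case 1
    have "{..<m} - {v} \<subseteq> nb K v" using 1 by (auto simp: nb_def adj_elements)
    then have "card ({..<m} - {v}) \<le> card (nb K v)" by (rule card_mono[OF fin])
    then show ?thesis using 1 assms(1) by simp
  next
    case (2 a b c)
    have "card (nb K v) \<le> card {a, b, c}"
      unfolding 2(4) nb_triple[OF 2(1-3)] by (rule card_mono) auto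
    also have "\<dots> \<le> 3" by (simp add: card_insert_if)
    finally show ?thesis using 2(4) triple_vertex_ge[of m a b c] by simp
  qed
  have less: "\<phi> v < m \<longleftrightarrow> v < m" if "v < num_vertices m" for v
    using deg[OF that, of K] deg[OF \<phi>[OF that], of K'] card_image[OF that] by simp
  have "\<phi> ` {..<m} \<subseteq> {..<m}" using less by auto
  moreover have "inj_on \<phi> {..<m}" by (rule inj_on_subset[OF inj]) auto
  ultimately show "bij_betw \<phi> {..<m} {..<m}" by (simp add: bij_betw_def endo_inj_surj)
  show "\<phi> ` s \<in> hyperedges m K'" if "s \<in> hyperedges m K"
  proof -
    obtain a b c where s: "s = {a, b, c}" "a < m" "b < m" "c < m" "K a b c"
      using \<open>s \<in> hyperedges m K\<close> unfolding hyperedges_def by blast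
    let ?t = "triple_vertex m a b c"
    have t: "?t < num_vertices m" using triple_vertex_less s by blast
    have s': "\<phi> ` s = nb K' (\<phi> ?t)" using nb_image[OF t] nb_triple[OF s(2-4)] s(1,5) by simp
    have "\<not> \<phi> ?t < m" using less[OF t] triple_vertex_ge[of m a b c] by simp
    with \<phi>[OF t] obtain a' b' c' where *: "a' < m" "b' < m" "c' < m" "\<phi> ?t = triple_vertex m a' b' c'"
      by (cases rule: vertex_cases) auto
    have "nb K' (\<phi> ?t) = (if K' a' b' c' then {a', b', c'} else {})"
      unfolding *(4) using nb_triple[OF *(1-3)] .
    \<comment> \<open>A triple outside \<open>K'\<close> gives an isolated vertex, so a nonempty
      neighbourhood shows that the triple is in \<open>K'\<close>.\<close>
    moreover have "\<phi> ` s \<noteq> {}" using s(1) by simp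
    ultimately have "K' a' b' c' \<and> \<phi> ` s = {a', b', c'}" using s' by (auto split: if_splits)
    then show ?thesis using * unfolding hyperedges_def by blast
  qed
qed

subsection \<open>Isomorphism of constraints and of entailed equations\<close>

definition elem_value :: "nat \<Rightarrow> (nat \<Rightarrow> bool) \<Rightarrow> nat \<Rightarrow> bool" where
  "elem_value n \<alpha> k \<longleftrightarrow> k < n + 5 \<and> (if k < 5 then 3 \<le> k else \<alpha> (k - 5))"

lemma well_valued_elem_value: "well_valued (n + 5) (elem_value n \<alpha>)"
  by (auto simp: well_valued_def elem_value_def)

lemma valid_appE:
  assumes "valid_app cf n A"
  obtains a b c where "app_elems A = [a, b, c]" "a < n + 5" "b < n + 5" "c < n + 5"
proof -
  have less: "arg_elem x < n + 5" if "valid_arg cf n x" for x using that by (cases x) auto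
  show ?thesis using assms that unfolding valid_app_def app_elems_def by (auto simp: less)
qed

lemma elem_value_arg_elem: "valid_arg cf n a \<Longrightarrow> elem_value n \<alpha> (arg_elem a) = arg_value \<alpha> a"
  by (cases a) (auto simp: elem_value_def)

lemma satisfies_iff_elem_value:
  assumes "\<forall>A \<in> S. valid_app cf n A"
  shows "satisfies \<alpha> S \<longleftrightarrow> (\<forall>A \<in> S. \<forall>a b c. app_elems A = [a, b, c] \<longrightarrow> \<not> violated a b c (elem_value n \<alpha>))"
proof -
  have "(case A of (C, as) \<Rightarrow> map (arg_value \<alpha>) as \<in> C) \<longleftrightarrow>
      (\<forall>a b c. app_elems A = [a, b, c] \<longrightarrow> \<not> violated a b c (elem_value n \<alpha>))" if "A \<in> S" for A
  proof -
    obtain a b c where A: "A = (xor3, [a, b, c])" "valid_arg cf n a" "valid_arg cf n b" "valid_arg cf n c"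
      using assms \<open>A \<in> S\<close> unfolding valid_app_def by blast
    have "elem_value n \<alpha> 3" by (simp add: elem_value_def)
    then show ?thesis
      using elem_value_arg_elem[OF A(2)] elem_value_arg_elem[OF A(3)] elem_value_arg_elem[OF A(4)]
      by (simp add: A(1) app_elems_def violated_def xor3_iff)
  qed
  then show ?thesis unfolding satisfies_def by blast
qed

lemma satisfies_cong:
  assumes "\<forall>A \<in> S. valid_app cf n A" "\<And>v. v < n \<Longrightarrow> \<alpha> v = \<beta> v"
  shows "satisfies \<alpha> S \<longleftrightarrow> satisfies \<beta> S"
proof -
  have "elem_value n \<alpha> = elem_value n \<beta>"
    using assms(2) by (auto simp: fun_eq_iff elem_value_def)
  then show ?thesis unfolding satisfies_iff_elem_value[OF assms(1)] by simp
qed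

definition implies :: "nat \<Rightarrow> nat application set \<Rightarrow> nat \<Rightarrow> nat \<Rightarrow> nat \<Rightarrow> bool" where
  "implies n S a b c \<longleftrightarrow> (\<forall>\<alpha>. satisfies \<alpha> S \<longrightarrow> \<not> violated a b c (elem_value n \<alpha>))"

text \<open>Vectors of the solution space that are true at element 3 are exactly the
  \<open>elem_value n \<alpha>\<close> of satisfying assignments; those false there solve only the
  homogeneous equations and are disregarded by \<open>entailed_iff\<close>.\<close>

lemma entailed_iff_implies:
  assumes "\<forall>A \<in> S. valid_app cf n A" "row_span (n + 5) M = sols (n + 5) S"
  shows "entailed (n + 5) M a b c \<longleftrightarrow> implies n S a b c"
proof
  assume "entailed (n + 5) M a b c"
  then have *: "\<And>x. x \<in> sols (n + 5) S \<Longrightarrow> x 3 \<Longrightarrow> \<not> violated a b c x"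
    unfolding entailed_iff assms(2) by blast
  show "implies n S a b c"
    unfolding implies_def
  proof (intro allI impI)
    fix \<alpha> assume "satisfies \<alpha> S"
    then have "elem_value n \<alpha> \<in> sols (n + 5) S"
      unfolding sols_def satisfies_iff_elem_value[OF assms(1)] using well_valued_elem_value by blast
    moreover have "elem_value n \<alpha> 3" by (simp add: elem_value_def)
    ultimately show "\<not> violated a b c (elem_value n \<alpha>)" using * by blast
  qed
next
  assume *: "implies n S a b c"
  show "entailed (n + 5) M a b c"
    unfolding entailed_iff assms(2)
  proof (intro ballI impI)
    fix x assume x: "x \<in> sols (n + 5) S" "x 3"
    define \<alpha> where "\<alpha> = (\<lambda>v. x (v + 5))"
    have "x = elem_value n \<alpha>"
    proof
      fix k :: nat
      have wv: "well_valued (n + 5) x" using x(1) by (simp add: sols_def)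
      then have "k < n + 5 \<or> \<not> x k" unfolding well_valued_def by (meson not_le)
      then show "x k = elem_value n \<alpha> k"
        using wv x(2) by (cases "k < 5") (auto simp: well_valued_def elem_value_def \<alpha>_def less_5)
    qed
    then show "\<not> violated a b c x"
      using * x(1) unfolding implies_def satisfies_iff_elem_value[OF assms(1)] sols_def by blast
  qed
qed

lemma implies_perm:
  "implies n S a b c \<longleftrightarrow> implies n S b a c" "implies n S a b c \<longleftrightarrow> implies n S a c b"
  unfolding implies_def violated_def by blast+

text \<open>
  Triples of distinct elements stand for implied equations. The triples with a repeated element mark
  the copies of the two constants.
\<close>

definition marked :: "(nat \<Rightarrow> nat \<Rightarrow> nat \<Rightarrow> bool) \<Rightarrow> nat \<Rightarrow> nat \<Rightarrow> nat \<Rightarrow> bool" where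
  "marked R a b c \<longleftrightarrow> (a \<noteq> b \<and> b \<noteq> c \<and> a \<noteq> c \<and> R a b c) \<or>
     (a = b \<and> ((b = c \<and> 3 \<le> a \<and> a < 5) \<or> (b \<noteq> c \<and> a < 3 \<and> c < 3)))"

text \<open>Two equal elements cancel, which leaves a condition on a single element
  \<open>d\<close>. It is padded by two copies of false other than \<open>d\<close>, and three
  copies make sure that two are left.\<close>

lemma distinct_elements:
  assumes "5 \<le> m" "a < m" "b < m" "c < m"
  obtains a' b' c' where "a' < m" "b' < m" "c' < m" "a' \<noteq> b'" "b' \<noteq> c'" "a' \<noteq> c'"
    "\<forall>z. well_valued m z \<longrightarrow> (violated a b c z \<longleftrightarrow> violated a' b' c' z)"
proof -
  note goal = that
  have single: thesis if "d < m" "\<And>z. violated a b c z \<longleftrightarrow> z d \<noteq> z 3" for d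
  proof -
    have "\<exists>p q. p < 3 \<and> q < 3 \<and> p \<noteq> q \<and> p \<noteq> d \<and> q \<noteq> d"
    proof (cases "d = 0")
      case True
      then show ?thesis by (intro exI[of _ 1] exI[of _ 2]) simp
    next
      case False
      then show ?thesis
        by (cases "d = 1") (intro exI[of _ 0] exI[of _ 2], simp, intro exI[of _ 0] exI[of _ 1], simp)
    qed
    then obtain p q where pq: "p < 3" "q < 3" "p \<noteq> q" "p \<noteq> d" "q \<noteq> d" by blast
    have "\<not> z p \<and> \<not> z q" if "well_valued m z" for z
    proof -
      have "k = 0 \<or> k = 1 \<or> k = 2" if "k < 3" for k :: nat using that by arith
      then show ?thesis using pq(1,2) that unfolding well_valued_def by blast
    qed
    then show thesis
      using assms(1) pq that by (intro goal[of p q d]) (auto simp: violated_def)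
  qed
  consider "a = b" | "b = c" | "a = c" | "a \<noteq> b" "b \<noteq> c" "a \<noteq> c" by blast
  then show thesis
  proof cases
    case 1
    then show ?thesis using assms(4) by (intro single[of c]) (auto simp: violated_def)
  next
    case 2
    then show ?thesis using assms(2) by (intro single[of a]) (auto simp: violated_def)
  next
    case 3
    then show ?thesis using assms(3) by (intro single[of b]) (auto simp: violated_def)
  next
    case 4
    then show ?thesis using assms that by blast
  qed
qed

text \<open>A set with three members can only come from a triple of distinct elements, and
  \<open>R\<close> is invariant under two transpositions, which generate all permutations of its
  arguments.\<close>

lemma hyperedge_marked:
  assumes "\<And>a b c. R a b c \<longleftrightarrow> R b a c" "\<And>a b c. R a b c \<longleftrightarrow> R a c b"
    and "5 \<le> m" "a < m" "b < m" "c < m" "a \<noteq> b" "b \<noteq> c" "a \<noteq> c"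
  shows "{a, b, c} \<in> hyperedges m (marked R) \<longleftrightarrow> R a b c"
proof
  assume "{a, b, c} \<in> hyperedges m (marked R)"
  then obtain x y z where *: "{a, b, c} = {x, y, z}" "marked R x y z"
    unfolding hyperedges_def by blast
  have "card {a, b, c} = 3" using assms(7-9) by simp
  then have "x \<noteq> y \<and> y \<noteq> z \<and> x \<noteq> z"
    unfolding *(1) by (auto simp: card_insert_if split: if_splits)
  then have "R x y z" using *(2) by (simp add: marked_def)
  moreover have "a = x \<or> a = y \<or> a = z" "b = x \<or> b = y \<or> b = z" "c = x \<or> c = y \<or> c = z"
    using *(1) by blast+
  ultimately show "R a b c" using assms(1,2,7-9) by metis
next
  assume "R a b c"
  then show "{a, b, c} \<in> hyperedges m (marked R)"
    unfolding hyperedges_def marked_def using assms by blast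
qed

text \<open>A marked triple with exactly two distinct members falls under the clause of
  \<open>marked\<close> that tags the copies of false.\<close>

lemma hyperedge_marked_2:
  assumes "5 \<le> m" "a \<noteq> b"
  shows "{a, b} \<in> hyperedges m (marked R) \<longleftrightarrow> a < 3 \<and> b < 3"
proof
  assume "{a, b} \<in> hyperedges m (marked R)"
  then obtain x y z where *: "{a, b} = {x, y, z}" "marked R x y z"
    unfolding hyperedges_def by blast
  have "card {a, b} = 2" using assms(2) by simp
  then have "card {x, y, z} = 2" unfolding *(1) .
  then have "\<not> (x \<noteq> y \<and> y \<noteq> z \<and> x \<noteq> z)" "\<not> (x = y \<and> y = z)"
    by (auto simp: card_insert_if split: if_splits)
  then have "x < 3 \<and> y < 3 \<and> z < 3" using *(2) by (auto simp: marked_def)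
  moreover have "a \<in> {x, y, z}" "b \<in> {x, y, z}" using *(1) by blast+
  ultimately show "a < 3 \<and> b < 3" by blast
next
  assume ab: "a < 3 \<and> b < 3"
  then have "marked R a a b" using assms(2) by (simp add: marked_def)
  moreover have "{a, b} = {a, a, b}" by simp
  moreover have "a < m" "b < m" using ab assms(1) by auto
  ultimately show "{a, b} \<in> hyperedges m (marked R)" unfolding hyperedges_def by blast
qed

lemma hyperedge_marked_1:
  assumes "5 \<le> m"
  shows "{a} \<in> hyperedges m (marked R) \<longleftrightarrow> 3 \<le> a \<and> a < 5"
proof
  assume "{a} \<in> hyperedges m (marked R)"
  then obtain x y z where *: "{a} = {x, y, z}" "marked R x y z"
    unfolding hyperedges_def by blast
  then have "x = a" "y = a" "z = a" by blast+
  then show "3 \<le> a \<and> a < 5" using *(2) by (simp add: marked_def)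
next
  assume a: "3 \<le> a \<and> a < 5"
  then have "marked R a a a" by (simp add: marked_def)
  moreover have "{a} = {a, a, a}" by simp
  moreover have "a < m" using a assms by simp
  ultimately show "{a} \<in> hyperedges m (marked R)" unfolding hyperedges_def by blast
qed

abbreviation iso_edges :: "nat \<Rightarrow> nat application set \<Rightarrow> (nat \<times> nat) list" where
  "iso_edges n S \<equiv> hypergraph_edges (n + 5) (marked (implies n S))"

definition edge_iso :: "nat \<Rightarrow> (nat \<times> nat) list \<Rightarrow> (nat \<times> nat) list \<Rightarrow> (nat \<Rightarrow> nat) \<Rightarrow> bool" where
  "edge_iso N es fs \<phi> \<longleftrightarrow> bij_betw \<phi> {..<N} {..<N} \<and>
     (\<forall>u<N. \<forall>v<N. adj es u v \<longleftrightarrow> adj fs (\<phi> u) (\<phi> v))"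

lemma edge_iso_inv:
  assumes "edge_iso N es fs \<phi>"
  shows "edge_iso N fs es (inv_into {..<N} \<phi>)"
proof -
  let ?\<psi> = "inv_into {..<N} \<phi>"
  have bij: "bij_betw \<phi> {..<N} {..<N}" using assms by (simp add: edge_iso_def)
  have \<psi>: "?\<psi> v < N" "\<phi> (?\<psi> v) = v" if "v < N" for v
    using bij that inv_into_into[of v \<phi> "{..<N}"] f_inv_into_f[of v \<phi> "{..<N}"] by (auto simp: bij_betw_def)
  have "adj fs u v \<longleftrightarrow> adj es (?\<psi> u) (?\<psi> v)" if "u < N" "v < N" for u v
    using assms \<psi>[OF that(1)] \<psi>[OF that(2)] unfolding edge_iso_def by metis
  then show ?thesis using bij_betw_inv_into[OF bij] by (simp add: edge_iso_def)
qed

text \<open>Hyperedges with one and two members force \<open>\<phi>\<close> to permute the copies of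
  true and those of false. Hence evaluating along \<open>\<phi>\<close> treats constants correctly,
  and an assignment for \<open>U\<close> is pulled back to one for \<open>S\<close>.\<close>

lemma edge_iso_half:
  assumes "edge_iso (num_vertices (n + 5)) (iso_edges n S) (iso_edges n U) \<phi>"
    and S: "\<forall>A \<in> S. valid_app cf n A"
  shows "bij_betw \<phi> {..<n + 5} {..<n + 5}" "k < 5 \<Longrightarrow> \<phi> k < 5"
    "satisfies \<alpha> U \<Longrightarrow> satisfies (\<lambda>v. elem_value n \<alpha> (\<phi> (v + 5))) S"
proof -
  let ?m = "n + 5"
  have m: "5 \<le> ?m" by simp
  have b: "bij_betw \<phi> {..<num_vertices ?m} {..<num_vertices ?m}" and
    a: "\<And>u v. u < num_vertices ?m \<Longrightarrow> v < num_vertices ?m \<Longrightarrow>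
      adj (iso_edges n S) u v \<longleftrightarrow> adj (iso_edges n U) (\<phi> u) (\<phi> v)"
    using assms(1) unfolding edge_iso_def by blast+
  note iso = hypergraph_isoD[OF m b a]
  show bij: "bij_betw \<phi> {..<n + 5} {..<n + 5}" using iso(1) .
  have \<phi>: "\<phi> k < ?m" if "k < ?m" for k using bij that by (auto simp: bij_betw_def)
  have inj: "\<phi> k \<noteq> \<phi> l" if "k \<noteq> l" "k < ?m" "l < ?m" for k l
    using bij that by (auto simp: bij_betw_def inj_on_def)
  have zero: "\<phi> k < 3" if "k < 3" for k
  proof -
    \<comment> \<open>A second copy of false is needed to form a tag with two members.\<close>
    have "\<exists>l<3. l \<noteq> k"
      by (cases "k = 0") (intro exI[of _ 1], simp, intro exI[of _ 0], simp)
    then obtain l where l: "l \<noteq> k" "l < 3" by blast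
    then have "{k, l} \<in> hyperedges ?m (marked (implies n S))"
      using hyperedge_marked_2[OF m, of k l] that by blast
    then have "{\<phi> k, \<phi> l} \<in> hyperedges ?m (marked (implies n U))"
      using iso(2)[of "{k, l}"] by simp
    then show ?thesis using hyperedge_marked_2[OF m, of "\<phi> k" "\<phi> l"] inj[of k l] l that by simp
  qed
  have one: "3 \<le> \<phi> k \<and> \<phi> k < 5" if "3 \<le> k" "k < 5" for k
  proof -
    have "{k} \<in> hyperedges ?m (marked (implies n S))"
      using hyperedge_marked_1[OF m, of k] that by blast
    then have "{\<phi> k} \<in> hyperedges ?m (marked (implies n U))"
      using iso(2)[of "{k}"] by simp
    then show ?thesis using hyperedge_marked_1[OF m] by blast
  qed
  show "\<phi> k < 5" if "k < 5"
    using zero[of k] one[of k] that by (cases "k < 3") auto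
  have implies: "implies n U (\<phi> a) (\<phi> b) (\<phi> c)"
    if "implies n S a b c" "a < ?m" "b < ?m" "c < ?m" "a \<noteq> b" "b \<noteq> c" "a \<noteq> c" for a b c
  proof -
    have "{a, b, c} \<in> hyperedges ?m (marked (implies n S))"
      using hyperedge_marked[of "implies n S", OF implies_perm m that(2-7)] that(1) by blast
    then have "{\<phi> a, \<phi> b, \<phi> c} \<in> hyperedges ?m (marked (implies n U))"
      using iso(2)[of "{a, b, c}"] by simp
    then show ?thesis
      using hyperedge_marked[of "implies n U", OF implies_perm m \<phi>[OF that(2)] \<phi>[OF that(3)] \<phi>[OF that(4)]
          inj[OF that(5,2,3)] inj[OF that(6,3,4)] inj[OF that(7,2,4)]] by blast
  qed
  show "satisfies (\<lambda>v. elem_value n \<alpha> (\<phi> (v + 5))) S" if \<alpha>: "satisfies \<alpha> U"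
  proof -
    let ?\<beta> = "\<lambda>v. elem_value n \<alpha> (\<phi> (v + 5))"
    have val: "elem_value n ?\<beta> k = elem_value n \<alpha> (\<phi> k)" if "k < ?m" for k
    proof -
      consider "k < 3" | "3 \<le> k" "k < 5" | "5 \<le> k" by linarith
      then show ?thesis
      proof cases
        case 1
        then show ?thesis using zero[of k] by (simp add: elem_value_def)
      next
        case 2
        then show ?thesis using one[of k] by (simp add: elem_value_def)
      next
        case 3
        then have "elem_value n ?\<beta> k = ?\<beta> (k - 5)" using that unfolding elem_value_def[of n ?\<beta>] by simp
        then show ?thesis using 3 by simp
      qed
    qed
    have "\<not> violated a b c (elem_value n ?\<beta>)" if "A \<in> S" "app_elems A = [a, b, c]" for A a b c
    proof -
      have abc: "a < ?m" "b < ?m" "c < ?m"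
        using S that by (auto elim!: valid_appE)
      \<comment> \<open>Only equations in three distinct elements are visible as hyperedges, so the
        equation is first brought into that form.\<close>
      obtain a' b' c' where d: "a' < ?m" "b' < ?m" "c' < ?m" "a' \<noteq> b'" "b' \<noteq> c'" "a' \<noteq> c'"
        "\<forall>z. well_valued ?m z \<longrightarrow> (violated a b c z \<longleftrightarrow> violated a' b' c' z)"
        by (rule distinct_elements[OF m abc])
      have "implies n S a b c"
        unfolding implies_def satisfies_iff_elem_value[OF S] using that by blast
      then have "implies n S a' b' c'"
        unfolding implies_def d(7)[rule_format, OF well_valued_elem_value] .
      then have "implies n U (\<phi> a') (\<phi> b') (\<phi> c')" using implies d by blast
      then have "\<not> violated (\<phi> a') (\<phi> b') (\<phi> c') (elem_value n \<alpha>)" using \<alpha> unfolding implies_def by blast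
      moreover have "3 < ?m" by simp
      moreover have "elem_value n \<gamma> 3" for \<gamma> by (simp add: elem_value_def)
      ultimately have "\<not> violated a' b' c' (elem_value n ?\<beta>)"
        unfolding violated_def val[OF d(1)] val[OF d(2)] val[OF d(3)] by simp
      then show ?thesis unfolding d(7)[rule_format, OF well_valued_elem_value] .
    qed
    then show ?thesis unfolding satisfies_iff_elem_value[OF S] by blast
  qed
qed

text \<open>A renaming of the variables extends by the identity on the constants. Conversely a graph
  isomorphism preserves the elements and, among these, the copies of constants, so it restricts to
  the variables; the two implications between \<open>S\<close> and \<open>U\<close> come from it and
  from its inverse.\<close>

lemma isomorphic_iff_edge_iso:
  assumes S: "\<forall>A \<in> S. valid_app cf n A" and U: "\<forall>A \<in> U. valid_app cf n A"
  shows "isomorphic {..<n} S U \<longleftrightarrow>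
    (\<exists>\<phi>. edge_iso (num_vertices (n + 5)) (iso_edges n S) (iso_edges n U) \<phi>)"
proof
  let ?m = "n + 5"
  assume "isomorphic {..<n} S U"
  then obtain \<sigma> where \<sigma>: "\<sigma> permutes {..<n}" "\<And>\<alpha>. satisfies (\<alpha> \<circ> \<sigma>) S \<longleftrightarrow> satisfies \<alpha> U"
    unfolding isomorphic_iff by blast
  define \<pi> where "\<pi> k = (if k < 5 then k else \<sigma> (k - 5) + 5)" for k
  have less: "\<sigma> v < n \<longleftrightarrow> v < n" for v using permutes_in_image[OF \<sigma>(1), of v] by simp
  have \<sigma>inj: "\<sigma> u = \<sigma> v \<longleftrightarrow> u = v" for u v using permutes_inj[OF \<sigma>(1)] by (auto dest: injD)
  have \<pi>inj: "\<pi> k = \<pi> l \<longleftrightarrow> k = l" for k l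
    using \<sigma>inj[of "k - 5" "l - 5"] by (auto simp: \<pi>_def)
  have \<pi>less: "\<pi> k < ?m" if "k < ?m" for k
    using that less[of "k - 5"] by (auto simp: \<pi>_def)
  have "\<pi> ` {..<?m} \<subseteq> {..<?m}" using \<pi>less by auto
  moreover have "inj_on \<pi> {..<?m}" using \<pi>inj by (auto simp: inj_on_def)
  ultimately have bij: "bij_betw \<pi> {..<?m} {..<?m}" by (simp add: bij_betw_def endo_inj_surj)
  have val: "elem_value n \<alpha> (\<pi> k) = elem_value n (\<alpha> \<circ> \<sigma>) k" for \<alpha> k
    using less[of "k - 5"] by (auto simp: elem_value_def \<pi>_def)
  have viol: "violated (\<pi> a) (\<pi> b) (\<pi> c) (elem_value n \<alpha>) \<longleftrightarrow> violated a b c (elem_value n (\<alpha> \<circ> \<sigma>))" for a b c \<alpha>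
    unfolding violated_def val by (simp add: elem_value_def)
  have implies: "implies n S a b c \<longleftrightarrow> implies n U (\<pi> a) (\<pi> b) (\<pi> c)" for a b c
  proof
    assume "implies n S a b c"
    then show "implies n U (\<pi> a) (\<pi> b) (\<pi> c)" unfolding implies_def viol using \<sigma>(2) by blast
  next
    assume *: "implies n U (\<pi> a) (\<pi> b) (\<pi> c)"
    show "implies n S a b c"
      unfolding implies_def
    proof (intro allI impI)
      fix \<beta> assume \<beta>: "satisfies \<beta> S"
      have e: "\<beta> \<circ> inv \<sigma> \<circ> \<sigma> = \<beta>" using permutes_inverses(2)[OF \<sigma>(1)] by (simp add: fun_eq_iff)
      have "satisfies (\<beta> \<circ> inv \<sigma>) U" using \<sigma>(2)[of "\<beta> \<circ> inv \<sigma>"] \<beta> unfolding e by simp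
      then show "\<not> violated a b c (elem_value n \<beta>)"
        using * viol[of a b c "\<beta> \<circ> inv \<sigma>"] unfolding implies_def e by blast
    qed
  qed
  have \<pi>3: "\<pi> k < 3 \<longleftrightarrow> k < 3" "\<pi> k < 5 \<longleftrightarrow> k < 5" for k by (auto simp: \<pi>_def)
  have "marked (implies n S) a b c \<longleftrightarrow> marked (implies n U) (\<pi> a) (\<pi> b) (\<pi> c)" for a b c
    unfolding marked_def implies[symmetric] \<pi>inj \<pi>3 not_less[symmetric] ..
  then show "\<exists>\<phi>. edge_iso (num_vertices ?m) (iso_edges n S) (iso_edges n U) \<phi>"
    unfolding edge_iso_def using hypergraph_isoI[OF bij, of "marked (implies n S)" "marked (implies n U)"] by blast
next
  let ?m = "n + 5" and ?N = "num_vertices (n + 5)"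
  assume "\<exists>\<phi>. edge_iso ?N (iso_edges n S) (iso_edges n U) \<phi>"
  then obtain \<phi> where \<phi>: "edge_iso ?N (iso_edges n S) (iso_edges n U) \<phi>" by blast
  define \<psi> where "\<psi> = inv_into {..<?N} \<phi>"
  have \<psi>: "edge_iso ?N (iso_edges n U) (iso_edges n S) \<psi>"
    unfolding \<psi>_def by (rule edge_iso_inv[OF \<phi>])
  note h = edge_iso_half[OF \<phi> S] and h' = edge_iso_half[OF \<psi> U]
  have bij: "bij_betw \<phi> {..<?N} {..<?N}" using \<phi> by (simp add: edge_iso_def)
  have inv: "\<psi> (\<phi> k) = k" "\<phi> (\<psi> k) = k" if "k < ?m" for k
  proof -
    have "k < ?N" using that by simp
    then show "\<psi> (\<phi> k) = k" "\<phi> (\<psi> k) = k"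
      using bij inv_into_f_f[of \<phi> "{..<?N}" k] f_inv_into_f[of k \<phi> "{..<?N}"]
      by (auto simp: \<psi>_def bij_betw_def)
  qed
  have less: "\<phi> k < ?m" "\<psi> k < ?m" if "k < ?m" for k
    using h(1) h'(1) that by (auto simp: bij_betw_def)
  \<comment> \<open>The inverse also maps copies of constants to copies of constants, so no variable
    can be mapped to one.\<close>
  have ge: "5 \<le> \<phi> k" "5 \<le> \<psi> k" if "5 \<le> k" "k < ?m" for k
    using h(2)[of "\<psi> k"] h'(2)[of "\<phi> k"] inv[OF that(2)] that(1) by (auto simp: not_less[symmetric])
  define \<sigma> where "\<sigma> v = (if v < n then \<phi> (v + 5) - 5 else v)" for v
  have \<sigma>: "\<sigma> v < n" "\<sigma> v + 5 = \<phi> (v + 5)" if "v < n" for v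
    using less(1)[of "v + 5"] ge(1)[of "v + 5"] that by (auto simp: \<sigma>_def)
  have "inj_on \<sigma> {..<n}"
  proof (rule inj_onI)
    fix u v assume uv: "u \<in> {..<n}" "v \<in> {..<n}" "\<sigma> u = \<sigma> v"
    then have eq: "\<phi> (u + 5) = \<phi> (v + 5)" using \<sigma>(2)[of u] \<sigma>(2)[of v] by (simp only: lessThan_iff)
    have less: "u + 5 < ?m" "v + 5 < ?m" using uv by simp_all
    have "u + 5 = \<psi> (\<phi> (u + 5))" by (rule inv(1)[OF less(1), symmetric])
    also have "\<dots> = v + 5" unfolding eq by (rule inv(1)[OF less(2)])
    finally show "u = v" by simp
  qed
  moreover have "\<sigma> ` {..<n} \<subseteq> {..<n}" using \<sigma>(1) by auto
  ultimately have "bij_betw \<sigma> {..<n} {..<n}" by (simp add: bij_betw_def endo_inj_surj)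
  then have perm: "\<sigma> permutes {..<n}" by (rule bij_imp_permutes) (simp add: \<sigma>_def)
  have "satisfies (\<alpha> \<circ> \<sigma>) S \<longleftrightarrow> satisfies \<alpha> U" for \<alpha>
  proof
    assume "satisfies \<alpha> U"
    then have "satisfies (\<lambda>v. elem_value n \<alpha> (\<phi> (v + 5))) S" by (rule h(3))
    then show "satisfies (\<alpha> \<circ> \<sigma>) S"
    proof (subst satisfies_cong[OF S, of _ "\<lambda>v. elem_value n \<alpha> (\<phi> (v + 5))"])
      fix v assume "v < n"
      then show "(\<alpha> \<circ> \<sigma>) v = elem_value n \<alpha> (\<phi> (v + 5))"
        using less(1)[of "v + 5"] ge(1)[of "v + 5"] by (simp add: elem_value_def \<sigma>_def)
    qed
  next
    assume "satisfies (\<alpha> \<circ> \<sigma>) S"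
    then have "satisfies (\<lambda>v. elem_value n (\<alpha> \<circ> \<sigma>) (\<psi> (v + 5))) U" by (rule h'(3))
    then show "satisfies \<alpha> U"
    proof (subst satisfies_cong[OF U, of _ "\<lambda>v. elem_value n (\<alpha> \<circ> \<sigma>) (\<psi> (v + 5))"])
      fix v assume v: "v < n"
      then have "\<psi> (v + 5) < ?m" "5 \<le> \<psi> (v + 5)" using less(2)[of "v + 5"] ge(2)[of "v + 5"] by auto
      moreover have "\<sigma> (\<psi> (v + 5) - 5) = v"
        using inv(2)[of "v + 5"] calculation v by (simp add: \<sigma>_def less_diff_conv2)
      ultimately show "\<alpha> v = elem_value n (\<alpha> \<circ> \<sigma>) (\<psi> (v + 5))"
        by (simp add: elem_value_def)
    qed
  qed
  with perm show "isomorphic {..<n} S U" unfolding isomorphic_iff by blast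
qed

subsection \<open>The reduction\<close>

definition init_rows :: "nat \<Rightarrow> prog" where
  "init_rows a = For 8 4 (Cond (Less 8 16) Skip (Put a 8 8 True)) ;; Put a 13 13 True ;; Put a 13 17 True"

lemma init_rows_simps [simp]: "mod_regs (init_rows a) = {8}" "mod_arrs (init_rows a) = {a}" "silent (init_rows a)"
  by (auto simp: init_rows_def)

lemma exec_init_rows:
  assumes "reg \<sigma> 4 = m" "m \<le> bound w" "reg \<sigma> 13 = 3" "reg \<sigma> 16 = 5" "reg \<sigma> 17 = 4"
    "arr \<sigma> a = (\<lambda>_ _. False)"
  shows "arr (exec w (init_rows a) \<sigma>) a = init_matrix m"
proof -
  let ?p = "For 8 4 (Cond (Less 8 16) Skip (Put a 8 8 True))"
  let ?J = "\<lambda>j \<tau>. \<forall>i k. arr \<tau> a i k \<longleftrightarrow> i = k \<and> 5 \<le> i \<and> i < j"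
  have "?J m (exec w ?p \<sigma>)"
    by (rule For_rule[where J = ?J, OF assms(1,2)]) (use assms in \<open>auto simp: less_Suc_eq\<close>)
  then show ?thesis
    using assms by (auto simp: init_rows_def exec_reg_frame init_matrix_def fun_eq_iff)
qed

definition initialize :: prog where
  "initialize = Copy 4 3 ;; add_reg 5 4 ;; set_const 13 3 ;; set_const 16 5 ;; set_const 17 4 ;; init_rows 0 ;; init_rows 1"

definition regs_set :: "bool list \<Rightarrow> nat \<Rightarrow> store \<Rightarrow> bool" where
  "regs_set w n \<sigma> \<longleftrightarrow> vars_read w n \<sigma> \<and> reg \<sigma> 4 = n + 5 \<and> reg \<sigma> 13 = 3 \<and> reg \<sigma> 16 = 5"

definition apps_read :: "bool list \<Rightarrow> nat \<Rightarrow> nat \<Rightarrow> nat application list \<Rightarrow> store \<Rightarrow> bool" where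
  "apps_read w n a S \<sigma> \<longleftrightarrow> regs_set w n \<sigma> \<and> row_span (n + 5) (arr \<sigma> a) = sols (n + 5) (set S)"

lemma initialize_simps [simp]: "mod_regs initialize = {4, 8, 13, 16, 17}" "mod_arrs initialize = {0, 1}" "silent initialize"
  by (auto simp: initialize_def)

lemma exec_initialize:
  assumes "vars_read w n \<sigma>" "arr \<sigma> = (\<lambda>_ _ _. False)"
  shows "apps_read w n 0 [] (exec w initialize \<sigma>) \<and> apps_read w n 1 [] (exec w initialize \<sigma>)"
proof -
  define \<sigma>\<^sub>1 where "\<sigma>\<^sub>1 = exec w (Copy 4 3 ;; add_reg 5 4 ;; set_const 13 3 ;; set_const 16 5 ;; set_const 17 4) \<sigma>"
  have n: "n + 5 \<le> bound w" using assms(1) by (simp add: vars_read_def bound_def)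
  have \<sigma>\<^sub>1: "reg \<sigma>\<^sub>1 3 = n" "reg \<sigma>\<^sub>1 4 = n + 5" "reg \<sigma>\<^sub>1 13 = 3" "reg \<sigma>\<^sub>1 16 = 5" "reg \<sigma>\<^sub>1 17 = 4" "arr \<sigma>\<^sub>1 = (\<lambda>_ _ _. False)"
    using n assms by (simp_all add: \<sigma>\<^sub>1_def vars_read_def)
  have e: "exec w initialize \<sigma> = exec w (init_rows 1) (exec w (init_rows 0) \<sigma>\<^sub>1)"
    by (simp add: initialize_def \<sigma>\<^sub>1_def)
  have "arr (exec w initialize \<sigma>) 0 = init_matrix (n + 5)"
    using exec_init_rows[OF \<sigma>\<^sub>1(2) n \<sigma>\<^sub>1(3-5), of 0] \<sigma>\<^sub>1(6) by (simp add: e exec_arr_frame)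
  moreover have "arr (exec w initialize \<sigma>) 1 = init_matrix (n + 5)"
    unfolding e by (rule exec_init_rows) (use \<sigma>\<^sub>1 n in \<open>simp_all add: exec_reg_frame exec_arr_frame\<close>)
  moreover have "regs_set w n (exec w initialize \<sigma>)"
    using \<sigma>\<^sub>1(1-4) assms(1) by (simp add: regs_set_def vars_read_def e exec_reg_frame)
  ultimately show ?thesis by (simp add: apps_read_def span_init_matrix)
qed

definition read_app :: "bool \<Rightarrow> nat \<Rightarrow> prog" where
  "read_app cf a = parse_app cf ;; eliminate a"

lemma parse_app_frame: "r \<notin> {0, Suc 0, 2, 5, 6, 7} \<Longrightarrow> reg (exec w (parse_app cf) \<sigma>) r = reg \<sigma> r"
  using parse_app_simps(1)[of cf] by (intro exec_reg_frame) blast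

lemma read_app_simps [simp]: "mod_regs (read_app cf a) \<subseteq> {0, Suc 0, 2, 5, 6, 7, 8, 9, 11, 12}"
  "mod_arrs (read_app cf a) = {2, a}" "silent (read_app cf a)"
proof -
  show "mod_regs (read_app cf a) \<subseteq> {0, Suc 0, 2, 5, 6, 7, 8, 9, 11, 12}"
    using parse_app_simps(1)[of cf] unfolding read_app_def mod_regs.simps eliminate_simps by blast
qed (simp_all add: read_app_def)

lemma parses_read_app:
  assumes "a \<noteq> 2"
  shows "parses w (apps_read w n a S) (read_app cf a) enc_application (valid_app cf n)
    (\<lambda>A \<sigma> \<sigma>'. apps_read w n a (S @ [A]) \<sigma>')"
proof -
  have "parses w (apps_read w n a S) (parse_app cf) enc_application (valid_app cf n)
      (\<lambda>A \<sigma> \<sigma>'. app_elems A = [reg \<sigma>' 5, reg \<sigma>' 6, reg \<sigma>' 7] \<and> apps_read w n a S \<sigma>')"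
    by (rule parses_map[OF parses_app, where g = "\<lambda>x. x"])
      (auto simp: apps_read_def regs_set_def vars_read_def parse_app_frame exec_arr_frame)
  then show ?thesis
    unfolding read_app_def
  proof (rule parses_act)
    fix A \<sigma>
    let ?\<tau> = "exec w (parse_app cf) \<sigma>" and ?m = "n + 5"
    assume "app_elems A = [reg ?\<tau> 5, reg ?\<tau> 6, reg ?\<tau> 7] \<and> apps_read w n a S ?\<tau>"
    then have A: "app_elems A = [reg ?\<tau> 5, reg ?\<tau> 6, reg ?\<tau> 7]" and regs: "regs_set w n ?\<tau>" and
      span: "row_span ?m (arr ?\<tau> a) = sols ?m (set S)" by (auto simp: apps_read_def)
    let ?P = "violated (reg ?\<tau> 5) (reg ?\<tau> 6) (reg ?\<tau> 7)"
    \<comment> \<open>Rows belong to their own span, which consists of well-valued vectors.\<close>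
    have "\<not> arr ?\<tau> a i k" if "i < ?m" "?m \<le> k" for i k
      using row_in_span[OF that(1), of "arr ?\<tau> a"] that(2) unfolding span sols_def well_valued_def by blast
    then have "eliminated ?m ?P (arr ?\<tau> a) (arr (exec w (eliminate a) ?\<tau>) a)"
      using regs assms by (intro exec_eliminate) (auto simp: regs_set_def vars_read_def bound_def)
    then have "row_span ?m (arr (exec w (eliminate a) ?\<tau>) a) = {x \<in> row_span ?m (arr ?\<tau> a). \<not> ?P x}"
      by (rule span_eliminated[OF violated_add])
    also have "\<dots> = sols ?m (set (S @ [A]))"
      unfolding span sols_def using A by auto
    finally show "apps_read w n a (S @ [A]) (exec w (eliminate a) ?\<tau>)"
      using regs by (simp add: apps_read_def regs_set_def vars_read_def exec_reg_frame)
  qed auto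
qed

abbreviation "read_apps cf a \<equiv> parse_list (read_app cf a) 2"

lemma parses_apps:
  assumes "a \<noteq> 2"
  shows "parses w (apps_read w n a []) (read_apps cf a) (enc_list enc_application)
    (\<lambda>S. \<forall>A \<in> set S. valid_app cf n A) (\<lambda>S \<sigma> \<sigma>'. apps_read w n a S \<sigma>')"
proof (rule parses_list[OF parses_read_app[OF assms]])
  show "apps_read w n a xs (set_reg 0 v \<sigma>)" "apps_read w n a xs (set_reg 2 v \<sigma>)"
    if "apps_read w n a xs \<sigma>" for xs \<sigma> v
    using that by (simp_all add: apps_read_def regs_set_def vars_read_def)
  show "x = y \<and> xs = ys" if "valid_app cf n x" "valid_app cf n y" "enc_application x @ xs = enc_application y @ ys"
    for x y xs ys using enc_app_prefix[OF that] .
qed auto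

definition parse_inst :: "bool \<Rightarrow> prog" where
  "parse_inst cf = parse_nat 3 2 ;; (initialize ;; (read_apps cf 0 ;; read_apps cf 1))"

lemma silent_parse_inst: "silent (parse_inst cf)"
  by (simp add: parse_inst_def)

lemma parses_inst:
  "parses w (\<lambda>\<sigma>. arr \<sigma> = (\<lambda>_ _ _. False)) (parse_inst cf) enc_inst (valid_inst cf)
    (\<lambda>x \<sigma> \<sigma>'. case x of (n, S, U) \<Rightarrow> apps_read w n 0 S \<sigma>' \<and> apps_read w n 1 U \<sigma>')"
proof -
  let ?V = "\<lambda>n S. \<forall>A \<in> set S. valid_app cf n A"
  let ?e = "enc_list enc_application"
  have sticky: "sticky (read_apps cf a)" if "a \<noteq> 2" for a using parses_sticky[OF parses_apps[OF that]] .
  have frame: "apps_read w n b S (exec w (read_apps cf a) \<sigma>)" if "apps_read w n b S \<sigma>" "b \<noteq> a" "b \<noteq> 2" for n a b S \<sigma>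
  proof -
    have "mod_regs (read_apps cf a) \<subseteq> {0, Suc 0, 2, 5, 6, 7, 8, 9, 11, 12}"
      using read_app_simps(1)[of cf a] unfolding parse_list_simps by blast
    then have "reg (exec w (read_apps cf a) \<sigma>) r = reg \<sigma> r" if "r \<notin> {0, Suc 0, 2, 5, 6, 7, 8, 9, 11, 12}" for r
      using that by (intro exec_reg_frame) blast
    then show ?thesis
      using that by (simp add: apps_read_def regs_set_def vars_read_def exec_arr_frame)
  qed
  have 0: "parses w (\<lambda>\<sigma>. apps_read w n 0 [] \<sigma> \<and> apps_read w n 1 [] \<sigma>) (read_apps cf 0) ?e (?V n)
     (\<lambda>S \<sigma> \<sigma>'. apps_read w n 0 S \<sigma>' \<and> apps_read w n 1 [] \<sigma>')" for n
    by (rule parses_map[OF parses_apps[of 0], where g = "\<lambda>x. x"]) (auto intro: frame)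
  have 1: "parses w (apps_read w n 1 []) (read_apps cf 1) ?e (?V n) (\<lambda>S \<sigma> \<sigma>'. apps_read w n 1 S \<sigma>')" for n
    by (rule parses_apps) simp
  have "parses w (\<lambda>\<sigma>. apps_read w n 0 [] \<sigma> \<and> apps_read w n 1 [] \<sigma>) (read_apps cf 0 ;; read_apps cf 1)
     (\<lambda>(S, U). ?e S @ ?e U) (\<lambda>(S, U). ?V n S \<and> ?V n U)
     (\<lambda>(S, U) \<sigma> \<sigma>'. (apps_read w n 0 S (exec w (read_apps cf 0) \<sigma>) \<and> apps_read w n 1 [] (exec w (read_apps cf 0) \<sigma>)) \<and>
        apps_read w n 1 U \<sigma>')" for n
    by (rule parses_seq[OF 0 1]) (auto dest: enc_apps_prefix intro: sticky)
  then have "parses w (\<lambda>\<sigma>. apps_read w n 0 [] \<sigma> \<and> apps_read w n 1 [] \<sigma>) (read_apps cf 0 ;; read_apps cf 1)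
     (\<lambda>(S, U). ?e S @ ?e U) (\<lambda>(S, U). ?V n S \<and> ?V n U)
     (\<lambda>(S, U) \<sigma> \<sigma>'. apps_read w n 0 S \<sigma>' \<and> apps_read w n 1 U \<sigma>')" for n
    by (rule parses_map[where g = "\<lambda>x. x"]) (auto intro: frame)
  then have "parses w (\<lambda>\<sigma>. vars_read w n \<sigma> \<and> arr \<sigma> = (\<lambda>_ _ _. False)) (initialize ;; (read_apps cf 0 ;; read_apps cf 1))
     (\<lambda>(S, U). ?e S @ ?e U) (\<lambda>(S, U). ?V n S \<and> ?V n U)
     (\<lambda>x \<sigma>. (\<lambda>(S, U) \<sigma> \<sigma>'. apps_read w n 0 S \<sigma>' \<and> apps_read w n 1 U \<sigma>') x (exec w initialize \<sigma>))" for n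
    by (rule parses_pre) (use exec_initialize in auto)
  \<comment> \<open>The postcondition of the second parser in \<open>parses_seq\<close> does not
    depend on the object read first, so \<open>n\<close> is recovered from register 3.\<close>
  then have 2: "parses w (\<lambda>\<sigma>. vars_read w n \<sigma> \<and> arr \<sigma> = (\<lambda>_ _ _. False)) (initialize ;; (read_apps cf 0 ;; read_apps cf 1))
     (\<lambda>(S, U). ?e S @ ?e U) (\<lambda>(S, U). ?V n S \<and> ?V n U)
     (\<lambda>(S, U) \<sigma> \<sigma>'. apps_read w (reg \<sigma>' 3) 0 S \<sigma>' \<and> apps_read w (reg \<sigma>' 3) 1 U \<sigma>')" for n
    by (rule parses_map[where g = "\<lambda>x. x"]) (auto simp: apps_read_def regs_set_def vars_read_def)
  have "parses w (\<lambda>\<sigma>. arr \<sigma> = (\<lambda>_ _ _. False)) (parse_nat 3 2) enc_nat (\<lambda>_. True)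
     (\<lambda>n \<sigma> \<sigma>'. vars_read w n \<sigma>' \<and> arr \<sigma>' = (\<lambda>_ _ _. False))"
    by (rule parses_map[OF parses_length[OF parses_nat], where g = "\<lambda>x. x"])
      (auto simp: vars_read_def enc_nat_def exec_arr_frame fun_eq_iff)
  then have "parses w (\<lambda>\<sigma>. arr \<sigma> = (\<lambda>_ _ _. False)) (parse_inst cf)
     (\<lambda>(n, SU). enc_nat n @ (case SU of (S, U) \<Rightarrow> ?e S @ ?e U)) (\<lambda>(n, SU). True \<and> (case SU of (S, U) \<Rightarrow> ?V n S \<and> ?V n U))
     (\<lambda>(n, SU) \<sigma> \<sigma>'. (vars_read w n (exec w (parse_nat 3 2) \<sigma>) \<and> arr (exec w (parse_nat 3 2) \<sigma>) = (\<lambda>_ _ _. False)) \<and>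
        (case SU of (S, U) \<Rightarrow> \<lambda>\<sigma> \<sigma>'. apps_read w (reg \<sigma>' 3) 0 S \<sigma>' \<and> apps_read w (reg \<sigma>' 3) 1 U \<sigma>') (exec w (parse_nat 3 2) \<sigma>) \<sigma>')"
    unfolding parse_inst_def
    by (rule parses_seq[OF _ 2]) (auto dest: enc_nat_prefix intro: not_mod_sticky sticky)
  then show ?thesis
  proof (rule parses_map[where g = "\<lambda>x. x"], goal_cases)
    case (3 x \<sigma>)
    obtain n S U where x: "x = (n, S, U)" by (cases x)
    have "reg (exec w (read_apps cf a) \<tau>) 3 = reg \<tau> 3" for a \<tau>
    proof -
      have "3 \<notin> {0, Suc 0, 2, 5, 6, 7, 8, 9, 11, 12 :: nat}" by simp
      then have "3 \<notin> mod_regs (read_apps cf a)"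
        using read_app_simps(1)[of cf a] unfolding parse_list_simps by blast
      then show ?thesis by (rule exec_reg_frame)
    qed
    then have "reg (exec w (parse_inst cf) \<sigma>) 3 = reg (exec w (parse_nat 3 2) \<sigma>) 3"
      by (simp add: parse_inst_def exec_reg_frame[of 3 initialize])
    then show ?case using 3(3) by (auto simp: x vars_read_def)
  qed (auto simp: enc_inst_def enc_instance_def valid_inst_def)
qed

section \<open>Testing implication and writing the graph\<close>

definition test_entailed :: "nat \<Rightarrow> prog" where
  "test_entailed a = Zero 12 ;; Zero 14 ;; For 15 4 (parity a 15 8 9 10 ;;
     Cond (Pos 11) (Inc 14) Skip ;; Cond (Bit a 15 13) (Inc 12) Skip)"

lemma test_entailed_simps [simp]: "mod_regs (test_entailed a) = {11, 12, 14, 15}" "mod_arrs (test_entailed a) = {}"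
    "silent (test_entailed a)"
  by (auto simp: test_entailed_def)

text \<open>A single pass over the rows suffices: registers 12 and 14 record the two existential
  statements in \<open>entailed\<close> independently.\<close>

lemma exec_test_entailed:
  assumes "reg \<sigma> 4 = m" "m \<le> bound w" "reg \<sigma> 13 = 3"
  shows "0 < reg (exec w (test_entailed a) \<sigma>) 12 \<and> 0 < reg (exec w (test_entailed a) \<sigma>) 14 \<longleftrightarrow>
    \<not> entailed m (arr \<sigma> a) (reg \<sigma> 8) (reg \<sigma> 9) (reg \<sigma> 10)"
proof -
  let ?v = "violated (reg \<sigma> 8) (reg \<sigma> 9) (reg \<sigma> 10)"
  let ?J = "\<lambda>j \<tau>. (0 < reg \<tau> 12 \<longleftrightarrow> (\<exists>i<j. arr \<sigma> a i 3)) \<and> (0 < reg \<tau> 14 \<longleftrightarrow> (\<exists>i<j. ?v (arr \<sigma> a i)))"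
  let ?p = "parity a 15 8 9 10 ;; Cond (Pos 11) (Inc 14) Skip ;; Cond (Bit a 15 13) (Inc 12) Skip"
  have "?J m (exec w (For 15 4 ?p) (set_reg 14 0 (set_reg 12 0 \<sigma>)))"
  proof (rule For_rule[where J = ?J and k = m], goal_cases)
    case (6 j \<tau>)
    have regs: "reg \<tau> 13 = 3" "reg \<tau> 8 = reg \<sigma> 8" "reg \<tau> 9 = reg \<sigma> 9" "reg \<tau> 10 = reg \<sigma> 10" "arr \<tau> a = arr \<sigma> a"
      using 6(4,5) assms by auto
    have par: "exec w (parity a 15 8 9 10) \<tau> = set_reg 11 (of_bool (?v (arr \<sigma> a j))) \<tau>"
      using regs 6(3) by (simp add: exec_parity)
    show ?case
      using 6(2,3) regs unfolding exec.simps(8) par by (auto simp: less_Suc_eq bound_def)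
  qed (use assms in auto)
  moreover have "exec w (test_entailed a) \<sigma> = exec w (For 15 4 ?p) (set_reg 14 0 (set_reg 12 0 \<sigma>))"
    by (simp add: test_entailed_def)
  ultimately show ?thesis unfolding entailed_def by simp
qed

definition TOr :: "test \<Rightarrow> test \<Rightarrow> test" where
  "TOr t u = TNot (TAnd (TNot t) (TNot u))"

text \<open>Tests compare registers only, so the thresholds 3 and 5 are taken from registers 13 and
  16. The flags in registers 12 and 14 stand for the relation itself.\<close>

definition marked_test :: test where
  "marked_test = TOr
     (TAnd (TNot (equal_regs 8 9)) (TAnd (TNot (equal_regs 9 10)) (TAnd (TNot (equal_regs 8 10)) (TNot (TAnd (Pos 12) (Pos 14))))))
     (TAnd (equal_regs 8 9) (TOr (TAnd (equal_regs 9 10) (TAnd (TNot (Less 8 13)) (Less 8 16)))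
       (TAnd (TNot (equal_regs 9 10)) (TAnd (Less 8 13) (Less 10 13)))))"

text \<open>Consecutive runs of ones add up, so the number of a triple vertex, which can exceed
  \<open>bound w\<close>, is written summand by summand.\<close>

definition emit_incidence :: "nat \<Rightarrow> prog" where
  "emit_incidence r = Emit True ;; emit_unary 4 ;; emit_product3 8 4 4 ;; emit_product 9 4 ;; emit_unary 10 ;;
     Emit False ;; emit_unary r ;; Emit False"

definition emit_clique :: prog where
  "emit_clique = For 8 4 (For 9 4 (Cond (Less 8 9)
     (Emit True ;; emit_unary 8 ;; Emit False ;; emit_unary 9 ;; Emit False) Skip))"

definition emit_triples :: "nat \<Rightarrow> prog" where
  "emit_triples a = For 8 4 (For 9 4 (For 10 4 (test_entailed a ;;
     Cond marked_test (emit_incidence 8 ;; emit_incidence 9 ;; emit_incidence 10) Skip)))"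

definition emit_graph :: "nat \<Rightarrow> prog" where
  "emit_graph a = emit_unary 4 ;; emit_product3 4 4 4 ;; Emit False ;; emit_clique ;; emit_triples a ;; Emit False"

lemma emit_simps [simp]:
  "mod_regs (emit_incidence r) = {}" "mod_arrs (emit_incidence r) = {}"
  "mod_regs emit_clique = {8, 9}" "mod_arrs emit_clique = {}"
  "mod_regs (emit_triples a) = {8, 9, 10, 11, 12, 14, 15}" "mod_arrs (emit_triples a) = {}"
  "mod_regs (emit_graph a) = {8, 9, 10, 11, 12, 14, 15}" "mod_arrs (emit_graph a) = {}"
  by (auto simp: emit_incidence_def emit_clique_def emit_triples_def emit_graph_def)

lemma exec_emit_incidence: "exec w (emit_incidence r) \<sigma> =
    \<sigma>\<lparr>outp := outp \<sigma> @ True # enc_edge (triple_vertex (reg \<sigma> 4) (reg \<sigma> 8) (reg \<sigma> 9) (reg \<sigma> 10), reg \<sigma> r)\<rparr>"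
  by (simp add: emit_incidence_def enc_edge_def enc_nat_def triple_vertex_def replicate_add)

lemma enc_items_concat: "enc_items e (concat (map f xs)) = concat (map (\<lambda>x. enc_items e (f x)) xs)"
  by (induction xs) auto

lemma outp_emit_clique:
  assumes "reg \<sigma> 4 = m" "m \<le> bound w"
  shows "outp (exec w emit_clique \<sigma>) = outp \<sigma> @
    enc_items enc_edge (concat (map (\<lambda>a. concat (map (\<lambda>b. if a < b then [(a, b)] else []) [0..<m])) [0..<m]))"
  unfolding enc_items_concat emit_clique_def
proof (rule For_outp[OF assms], goal_cases)
  case (3 a \<tau>)
  have "reg \<tau> 4 = m" using 3(3) assms(1) by simp
  then show ?case
    by (rule For_outp[OF _ assms(2)]) (use 3(2) in \<open>auto simp: enc_edge_def enc_nat_def\<close>)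
qed auto

lemma outp_emit_triples:
  assumes "reg \<sigma> 4 = m" "m \<le> bound w" "reg \<sigma> 13 = 3" "reg \<sigma> 16 = 5"
  shows "outp (exec w (emit_triples d) \<sigma>) = outp \<sigma> @ enc_items enc_edge
    (concat (map (\<lambda>a. concat (map (\<lambda>b. concat (map (\<lambda>c. if marked (entailed m (arr \<sigma> d)) a b c then triple_edges m a b c else [])
       [0..<m])) [0..<m])) [0..<m]))"
  unfolding enc_items_concat emit_triples_def
proof (rule For_outp[OF assms(1,2)], goal_cases)
  case (3 a \<tau>)
  note \<tau> = 3
  have regs: "reg \<tau> 4 = m" "reg \<tau> 13 = 3" "reg \<tau> 16 = 5" "arr \<tau> d = arr \<sigma> d" using \<tau>(3,4) assms by auto
  show ?case
  proof (rule For_outp[OF regs(1) assms(2)], goal_cases)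
    case (3 b \<upsilon>)
    note \<upsilon> = 3
    have regs': "reg \<upsilon> 4 = m" "reg \<upsilon> 13 = 3" "reg \<upsilon> 16 = 5" "arr \<upsilon> d = arr \<sigma> d" "reg \<upsilon> 8 = a"
      using \<upsilon>(3,4) regs \<tau>(2) by auto
    show ?case
    proof (rule For_outp[OF regs'(1) assms(2)], goal_cases)
      case (3 c \<phi>)
      define \<psi> where "\<psi> = exec w (test_entailed d) \<phi>"
      have f: "reg \<phi> 4 = m" "reg \<phi> 13 = 3" "reg \<phi> 16 = 5" "reg \<phi> 8 = a" "reg \<phi> 9 = b" "reg \<phi> 10 = c" "arr \<phi> d = arr \<sigma> d"
        using 3(2-4) regs' \<upsilon>(2) by auto
      have p: "reg \<psi> 4 = m" "reg \<psi> 13 = 3" "reg \<psi> 16 = 5" "reg \<psi> 8 = a" "reg \<psi> 9 = b" "reg \<psi> 10 = c" "outp \<psi> = outp \<phi>"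
        using f by (simp_all add: \<psi>_def exec_reg_frame exec_outp_frame)
      have "0 < reg \<psi> 12 \<and> 0 < reg \<psi> 14 \<longleftrightarrow> \<not> entailed m (arr \<sigma> d) a b c"
        using exec_test_entailed[OF f(1) assms(2) f(2), of d] f by (simp add: \<psi>_def)
      then have "eval w marked_test \<psi> \<longleftrightarrow> marked (entailed m (arr \<sigma> d)) a b c"
        using p by (auto simp: marked_test_def TOr_def marked_def)
      then show ?case
        using p by (simp add: \<psi>_def[symmetric] exec_emit_incidence triple_edges_def)
    qed auto
  qed auto
qed auto

lemma outp_emit_graph:
  assumes "reg \<sigma> 4 = m" "m \<le> bound w" "reg \<sigma> 13 = 3" "reg \<sigma> 16 = 5"
  shows "outp (exec w (emit_graph a) \<sigma>) = outp \<sigma> @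
    enc_graph (num_vertices m) (hypergraph_edges m (marked (entailed m (arr \<sigma> a))))"
  using assms
  by (simp add: emit_graph_def outp_emit_triples outp_emit_clique exec_reg_frame exec_arr_frame
      enc_graph_alt enc_nat_def enc_list_def hypergraph_edges_def replicate_add)

lemma valid_hypergraph_edges:
  "x \<in> set (hypergraph_edges m K) \<Longrightarrow> valid_edge (num_vertices m) x"
proof -
  obtain u v where x: "x = (u, v)" by (cases x)
  assume "x \<in> set (hypergraph_edges m K)"
  then consider "u < v" "v < m" | a b c where "a < m" "b < m" "c < m" "u = triple_vertex m a b c" "v \<in> {a, b, c}"
    unfolding x mem_hypergraph_edges by blast
  then show ?thesis
  proof cases
    case 1
    then show ?thesis by (simp add: x valid_edge_def)
  next
    case (2 a b c)
    then have "u < num_vertices m" "m \<le> u" "v < m" using triple_vertex_less triple_vertex_ge by auto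
    then show ?thesis by (simp add: x valid_edge_def)
  qed
qed

text \<open>Besides the number of elements, the graphs depend on the matrices only through
  \<open>entailed\<close>, which agrees with \<open>implies\<close>; the choice of pivots therefore
  leaves no trace in the output.\<close>

lemma ISO_lang_reduces_GI: "poly_many_one_reducible (ISO_lang cf) GI"
  unfolding poly_many_one_reducible_def
proof (intro exI conjI allI)
  let ?q = "emit_graph 0 ;; emit_graph 1"
  let ?f = "\<lambda>w. outp (exec w (parse_then (parse_inst cf) ?q) init_store)"
  show "polytime_computable ?f" by (rule polytime_exec)
  fix w
  have Nil: "[] \<notin> GI" by (auto simp: GI_def enc_graph_def enc_nat_def)
  have ISO: "\<exists>x. valid_inst cf x \<and> w = enc_inst x" if "w \<in> ISO_lang cf"
    using that unfolding ISO_lang_alt by blast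
  have init: "arr init_store = (\<lambda>_ _ _. False)" by (simp add: init_store_def)
  show "w \<in> ISO_lang cf \<longleftrightarrow> ?f w \<in> GI"
    using parses_inst[of w cf] init silent_parse_inst[of cf]
  proof (cases rule: outp_parse_then[where q = ?q and w = w])
    case (1 x)
    obtain n S U where x: "x = (n, S, U)" by (cases x)
    let ?\<sigma> = "exec w (parse_inst cf) init_store" and ?m = "n + 5"
    have read: "apps_read w n 0 S ?\<sigma>" "apps_read w n 1 U ?\<sigma>" using 1(3) x by auto
    then have regs: "reg ?\<sigma> 4 = ?m" "?m \<le> bound w" "reg ?\<sigma> 13 = 3" "reg ?\<sigma> 16 = 5"
      and span: "row_span ?m (arr ?\<sigma> 0) = sols ?m (set S)" "row_span ?m (arr ?\<sigma> 1) = sols ?m (set U)"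
      by (auto simp: apps_read_def regs_set_def vars_read_def bound_def)
    have valid: "\<forall>A \<in> set S. valid_app cf n A" "\<forall>A \<in> set U. valid_app cf n A"
      using 1(1) x by (auto simp: valid_inst_def)
    have ent: "entailed ?m (arr ?\<sigma> 0) = implies n (set S)" "entailed ?m (arr ?\<sigma> 1) = implies n (set U)"
      using entailed_iff_implies[OF valid(1) span(1)] entailed_iff_implies[OF valid(2) span(2)] by blast+
    have "?f w = outp (exec w ?q ?\<sigma>)" by (rule 1(5))
    also have "\<dots> = enc_graphs ((num_vertices ?m, iso_edges n (set S)), (num_vertices ?m, iso_edges n (set U)))"
      using regs 1(6) by (simp add: outp_emit_graph exec_reg_frame exec_arr_frame ent[simplified] enc_graphs_def)
    finally have f: "?f w = \<dots>" .
    have "?f w \<in> GI \<longleftrightarrow> (\<exists>\<phi>. edge_iso (num_vertices ?m) (iso_edges n (set S)) (iso_edges n (set U)) \<phi>)"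
      unfolding f GI_enc_graphs edge_iso_def valid_graphs_def using valid_hypergraph_edges by simp
    also have "\<dots> \<longleftrightarrow> isomorphic {..<n} (set S) (set U)"
      using isomorphic_iff_edge_iso[OF valid] by simp
    also have "\<dots> \<longleftrightarrow> w \<in> ISO_lang cf"
      using enc_inst_ISO_lang[of cf n S U] 1(1,2) by (simp add: x)
    finally show ?thesis by simp
  next
    case (2 x y ys)
    have "w \<notin> ISO_lang cf"
    proof
      assume "w \<in> ISO_lang cf"
      then obtain z where "valid_inst cf z" "w = enc_inst z" using ISO by blast
      then show False using 2(1,2) enc_inst_prefix[of cf z x "[]" "y # ys"] by simp
    qed
    then show ?thesis using Nil 2(3) by simp
  next
    case 3
    have "w \<notin> ISO_lang cf" using ISO 3(1)[where ys = "[]"] by auto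
    then show ?thesis using Nil 3(2) by simp
  qed
qed

theorem theorem23:
  shows "poly_many_one_equivalent GI (ISO {xor3}) \<and> poly_many_one_equivalent GI (ISO_c {xor3})"
  using GI_reduces_ISO_lang[of True] GI_reduces_ISO_lang[of False]
    ISO_lang_reduces_GI[of True] ISO_lang_reduces_GI[of False]
  by (simp add: poly_many_one_equivalent_def ISO_lang_def)

end
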